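(* Any generating set of oriented Reidemeister moves contains at least four moves.
   Context: Diagrams of oriented links are generic plane projections with only transversal double points, with over/undercrossing information and orientations. The sign of a crossing is $+$ if (direction of the over-strand, direction of the under-strand) is a positively oriented basis of $\mathbb{R}^2$, and $-$ otherwise. Oriented Reidemeister moves. A move replaces the part of an oriented diagram inside an embedded disk $C\subset\mathbb{R}^2$ (the changing disk), oriented by the standard orientation of $\mathbb{R}^2$, by another one with the same boundary points, leaving the diagram unchanged outside $C$; the two local pictures are taken up to orientation-preserving diffeomorphism of $C$ (the same on $\partial C$ for both). No distinction is made between a move and its inverse. There are 16 oriented moves: four of type 1, four of type 2, eight of type 3. Type 1 moves: a single arc without crossings in $C$ is replaced by an arc with exactly one crossing, i.e. by an arc with one loop (kink). The four moves correspond to the sign of the crossing (positive or negative) and the direction in which the loop is traversed (clockwise or counter-clockwise). Type 2 moves: two disjoint arcs without crossings in $C$ are replaced by two arcs crossing each other at exactly two points that bound a bigon, the same arc being the over-strand at both crossings (the two crossings have opposite signs). The four moves are: both arcs pass through the crossings in the same order, with the positive crossing first, or with the negative crossing first; the arcs pass through the crossings in opposite orders, with the under-strand meeting the positive crossing first, or with the over-strand meeting the positive crossing first. Type 3 moves: $C$ contains three arcs $t,m,b$ (top, middle, bottom) without self-crossings, each two of which cross exactly once, $t$ passing over $m$ and $b$, and $m$ passing over $b$; the move slides one arc across the crossing of the other two (so that the central triangle is reversed), keeping the endpoints, the over/under information and the crossing signs. An oriented type 3 move is determined by the triple of signs of the crossings of $t$ with $m$, $m$ with $b$, $t$ with $b$;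 all eight triples occur. Generating set. A collection $S$ of oriented Reidemeister moves is a generating set if any oriented Reidemeister move $\Omega$ may be obtained by a finite sequence of isotopies and moves from $S$ (in either direction) performed inside the changing disk of $\Omega$. *)

theory Defs
  imports "HOL-Complex_Analysis.Complex_Analysis"
begin

text \<open>
  The plane is \<^typ>\<open>complex\<close> with its standard orientation; \<open>det2 u v > 0\<close> means that
  \<open>(u, v)\<close> is a positively oriented basis.
\<close>

definition det2 :: "complex \<Rightarrow> complex \<Rightarrow> real" where
  "det2 u v = Re u * Im v - Im u * Re v"

text \<open>
  \<open>C\<^sup>\<infinity>\<close> maps on a whole (finite-dimensional) space: \<open>f\<close> and all its iterated directional
  derivatives are differentiable everywhere.
\<close>

coinductive smooth :: "('a::euclidean_space \<Rightarrow> 'b::euclidean_space) \<Rightarrow> bool" where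
  "(\<And>x. f differentiable (at x)) \<Longrightarrow> (\<And>v. smooth (\<lambda>x. frechet_derivative f (at x) v)) \<Longrightarrow> smooth f"


section \<open>Oriented link diagrams\<close>

text \<open>
  Component \<open>i < ncomp D\<close> is the closed curve \<open>curve D i\<close>, parametrized over the circle
  \<open>\<real>/\<int>\<close>, i.e. by a 1-periodic function, and oriented by the parametrization.  A pair
  \<open>(i, t)\<close> stands for a point of the parametrizing circles; \<open>over D p q\<close> is meaningful only
  when \<open>p\<close> and \<open>q\<close> are the two preimages of a double point.
\<close>

record diagram =
  ncomp :: nat
  curve :: "nat \<Rightarrow> real \<Rightarrow> complex"
  over :: "nat \<times> real \<Rightarrow> nat \<times> real \<Rightarrow> bool"

definition param :: "diagram \<Rightarrow> nat \<times> real \<Rightarrow> bool" where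
  "param D p \<longleftrightarrow> fst p < ncomp D"

definition same_param :: "nat \<times> real \<Rightarrow> nat \<times> real \<Rightarrow> bool" where
  "same_param p q \<longleftrightarrow> fst p = fst q \<and> snd p - snd q \<in> \<int>"

definition pt :: "diagram \<Rightarrow> nat \<times> real \<Rightarrow> complex" where
  "pt D p = curve D (fst p) (snd p)"

definition tangent :: "diagram \<Rightarrow> nat \<times> real \<Rightarrow> complex" where
  "tangent D p = vector_derivative (curve D (fst p)) (at (snd p))"

definition crossing :: "diagram \<Rightarrow> nat \<times> real \<Rightarrow> nat \<times> real \<Rightarrow> bool" where
  "crossing D p q \<longleftrightarrow> param D p \<and> param D q \<and> \<not> same_param p q \<and> pt D p = pt D q"

definition double_points :: "diagram \<Rightarrow> complex set" where
  "double_points D = {pt D p | p q. crossing D p q}"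

definition link_diagram :: "diagram \<Rightarrow> bool" where
  "link_diagram D \<longleftrightarrow>
     (\<forall>i < ncomp D. smooth (curve D i) \<and> (\<forall>t. curve D i (t + 1) = curve D i t)) \<and>
     (\<forall>p. param D p \<longrightarrow> tangent D p \<noteq> 0) \<and>
     finite (double_points D) \<and>
     (\<forall>p q. crossing D p q \<longrightarrow> det2 (tangent D p) (tangent D q) \<noteq> 0) \<and>
     (\<nexists>p q r. crossing D p q \<and> crossing D q r \<and> crossing D p r) \<and>
     (\<forall>p q. crossing D p q \<longrightarrow> (over D p q \<longleftrightarrow> \<not> over D q p)) \<and>
     (\<forall>p q p' q'. crossing D p q \<and> same_param p p' \<and> same_param q q' \<longrightarrow>
        (over D p q \<longleftrightarrow> over D p' q'))"

datatype sign = Pos | Neg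

definition crossing_sign :: "diagram \<Rightarrow> nat \<times> real \<Rightarrow> nat \<times> real \<Rightarrow> sign" where
  "crossing_sign D p q =
     (let d = (if over D p q then det2 (tangent D p) (tangent D q)
               else det2 (tangent D q) (tangent D p))
      in if d > 0 then Pos else Neg)"

text \<open>
  Equality of the underlying oriented diagrams: relabelling of the components and
  orientation-preserving reparametrization of each of them.
\<close>

definition same_diagram :: "diagram \<Rightarrow> diagram \<Rightarrow> bool" where
  "same_diagram D D' \<longleftrightarrow> ncomp D' = ncomp D \<and>
     (\<exists>\<pi> h. bij_betw \<pi> {..<ncomp D} {..<ncomp D} \<and>
       (\<forall>i < ncomp D. smooth (h i) \<and> (\<forall>t. h i (t + 1) = h i t + 1) \<and> (\<forall>t. deriv (h i) t > 0) \<and>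
          (\<forall>t. curve D' i t = curve D (\<pi> i) (h i t))) \<and>
       (\<forall>i s j t. crossing D' (i, s) (j, t) \<longrightarrow>
          (over D' (i, s) (j, t) \<longleftrightarrow> over D (\<pi> i, h i s) (\<pi> j, h j t))))"


section \<open>Isotopies inside a disk\<close>

text \<open>
  The family is taken to be defined for all real times, but only its part over \<open>[0, 1]\<close> has
  to consist of diffeomorphisms (a smooth map on \<open>[0, 1] \<times> \<complex>\<close> can be extended).
\<close>

definition ambient_isotopy :: "complex set \<Rightarrow> (real \<Rightarrow> complex \<Rightarrow> complex) \<Rightarrow> bool" where
  "ambient_isotopy C \<phi> \<longleftrightarrow>
     smooth (\<lambda>x. \<phi> (fst x) (snd x)) \<and>
     (\<forall>t\<in>{0..1}. bij (\<phi> t) \<and> smooth (inv (\<phi> t)) \<and> (\<forall>z. z \<notin> C \<longrightarrow> \<phi> t z = z)) \<and>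
     (\<forall>z. \<phi> 0 z = z)"

definition isotopic_in :: "complex set \<Rightarrow> diagram \<Rightarrow> diagram \<Rightarrow> bool" where
  "isotopic_in C D D' \<longleftrightarrow> ncomp D' = ncomp D \<and>
     (\<exists>\<phi>. ambient_isotopy C \<phi> \<and>
       (\<forall>i < ncomp D. \<forall>t. curve D' i t = \<phi> 1 (curve D i t))) \<and>
     (\<forall>p q. crossing D p q \<longrightarrow> (over D' p q \<longleftrightarrow> over D p q))"


section \<open>Changing disks and arcs\<close>

text \<open>
  A smoothly embedded closed disk whose boundary is transversal to the diagram.
\<close>

definition changing_disk :: "complex set \<Rightarrow> diagram \<Rightarrow> bool" where
  "changing_disk C D \<longleftrightarrow>
     (\<exists>f :: complex \<Rightarrow> complex. smooth f \<and> inj_on f (cball 0 1) \<and>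
        (\<forall>z \<in> cball 0 1. inj (frechet_derivative f (at z))) \<and>
        C = f ` cball 0 1 \<and>
        (\<forall>p z. param D p \<and> cmod z = 1 \<and> pt D p = f z \<longrightarrow>
           det2 (frechet_derivative f (at z) (\<i> * z)) (tangent D p) \<noteq> 0))"

text \<open>
  The arc \<open>(i, a, b)\<close> is the restriction of component \<open>i\<close> to \<open>[a, b]\<close>.
\<close>

type_synonym arc = "nat \<times> real \<times> real"

fun on_arc :: "nat \<times> real \<Rightarrow> arc \<Rightarrow> bool" where
  "on_arc (j, t) (i, a, b) \<longleftrightarrow> j = i \<and> (\<exists>m::int. t + of_int m \<in> {a..b})"

fun proper_arc :: "diagram \<Rightarrow> complex set \<Rightarrow> arc \<Rightarrow> bool" where
  "proper_arc D C (i, a, b) \<longleftrightarrow> i < ncomp D \<and> a < b \<and> b < a + 1 \<and>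
     curve D i a \<in> frontier C \<and> curve D i b \<in> frontier C \<and>
     (\<forall>t \<in> {a<..<b}. curve D i t \<in> interior C)"

definition arcs_in :: "diagram \<Rightarrow> complex set \<Rightarrow> arc list \<Rightarrow> bool" where
  "arcs_in D C As \<longleftrightarrow> (\<forall>A \<in> set As. proper_arc D C A) \<and>
     (\<forall>p. param D p \<and> pt D p \<in> C \<longrightarrow> (\<exists>!k. k < length As \<and> on_arc p (As ! k)))"

text \<open>
  Since \<open>same_diagram\<close> is available as a step below, parametrizations of the two diagrams may
  be chosen to agree outside the disk.
\<close>

definition unchanged_outside :: "complex set \<Rightarrow> diagram \<Rightarrow> diagram \<Rightarrow> bool" where
  "unchanged_outside C D D' \<longleftrightarrow> ncomp D' = ncomp D \<and>
     (\<forall>p. param D p \<longrightarrow>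
        (pt D p \<in> interior C \<longleftrightarrow> pt D' p \<in> interior C) \<and>
        (pt D p \<notin> interior C \<longrightarrow> pt D' p = pt D p)) \<and>
     (\<forall>p q. crossing D p q \<and> pt D p \<notin> C \<longrightarrow> (over D' p q \<longleftrightarrow> over D p q))"


section \<open>Oriented Reidemeister moves\<close>

datatype rotation = Clockwise | Counterclockwise

datatype move2 =
    Same_Order_Pos_First
  | Same_Order_Neg_First
  | Opp_Order_Under_Pos_First  \<comment> \<open>the under-strand meets the positive crossing first\<close>
  | Opp_Order_Over_Pos_First   \<comment> \<open>the over-strand meets the positive crossing first\<close>

text \<open>
  The signs of a type 3 move are those of the crossings top/middle, middle/bottom and
  top/bottom, in this order.
\<close>

datatype move =
    Omega1 sign rotation
  | Omega2 move2
  | Omega3 sign sign sign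

definition plain_arcs :: "diagram \<Rightarrow> complex set \<Rightarrow> arc list \<Rightarrow> bool" where
  "plain_arcs D C As \<longleftrightarrow> arcs_in D C As \<and> double_points D \<inter> C = {}"

fun loop_rotates :: "rotation \<Rightarrow> (real \<Rightarrow> complex) \<Rightarrow> bool" where
  "loop_rotates Counterclockwise g \<longleftrightarrow> (\<forall>z \<in> inside (path_image g). winding_number g z = 1)"
| "loop_rotates Clockwise g \<longleftrightarrow> (\<forall>z \<in> inside (path_image g). winding_number g z = -1)"

fun kinked_arc :: "sign \<Rightarrow> rotation \<Rightarrow> diagram \<Rightarrow> complex set \<Rightarrow> arc \<Rightarrow> bool" where
  "kinked_arc e r D C (i, a, b) \<longleftrightarrow> arcs_in D C [(i, a, b)] \<and>
     (\<exists>s u. a < s \<and> s < u \<and> u < b \<and> crossing D (i, s) (i, u) \<and>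
        double_points D \<inter> C = {curve D i s} \<and>
        crossing_sign D (i, s) (i, u) = e \<and>
        loop_rotates r (subpath s u (curve D i)))"

text \<open>
  \<open>p\<close> and \<open>p'\<close> are the parameters of the positive and negative crossing on the over-strand,
  \<open>q\<close> and \<open>q'\<close> those on the under-strand.
\<close>

fun crossing_order :: "move2 \<Rightarrow> real \<Rightarrow> real \<Rightarrow> real \<Rightarrow> real \<Rightarrow> bool" where
  "crossing_order Same_Order_Pos_First p p' q q' \<longleftrightarrow> p < p' \<and> q < q'"
| "crossing_order Same_Order_Neg_First p p' q q' \<longleftrightarrow> p' < p \<and> q' < q"
| "crossing_order Opp_Order_Under_Pos_First p p' q q' \<longleftrightarrow> p' < p \<and> q < q'"
| "crossing_order Opp_Order_Over_Pos_First p p' q q' \<longleftrightarrow> p < p' \<and> q' < q"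

fun bigon_arcs :: "move2 \<Rightarrow> diagram \<Rightarrow> complex set \<Rightarrow> arc \<Rightarrow> arc \<Rightarrow> bool" where
  "bigon_arcs k D C (i, a, b) (j, c, d) \<longleftrightarrow> arcs_in D C [(i, a, b), (j, c, d)] \<and>
     (\<exists>p p' q q'. p \<in> {a<..<b} \<and> p' \<in> {a<..<b} \<and> q \<in> {c<..<d} \<and> q' \<in> {c<..<d} \<and>
        crossing D (i, p) (j, q) \<and> crossing D (i, p') (j, q') \<and>
        double_points D \<inter> C = {curve D i p, curve D i p'} \<and>
        over D (i, p) (j, q) \<and> over D (i, p') (j, q') \<and>
        crossing_sign D (i, p) (j, q) = Pos \<and> crossing_sign D (i, p') (j, q') = Neg \<and>
        crossing_order k p p' q q' \<and>
        (\<forall>x. param D x \<longrightarrow>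
           pt D x \<notin> inside (curve D i ` closed_segment p p' \<union> curve D j ` closed_segment q q')))"

text \<open>
  Three arcs \<open>(i, a, b)\<close>, \<open>(j, c, d)\<close>, \<open>(k, e, f)\<close> (top, middle, bottom).  Crossing top/middle
  has parameters \<open>tm\<close> on top and \<open>mt\<close> on middle, and similarly for the other two.
\<close>

fun triangle_arcs :: "sign \<Rightarrow> sign \<Rightarrow> sign \<Rightarrow> diagram \<Rightarrow> complex set \<Rightarrow> arc \<Rightarrow> arc \<Rightarrow> arc \<Rightarrow>
    real \<Rightarrow> real \<Rightarrow> real \<Rightarrow> real \<Rightarrow> real \<Rightarrow> real \<Rightarrow> bool" where
  "triangle_arcs e1 e2 e3 D C (i, a, b) (j, c, d) (k, e, f) tm tb mt mb bt bm \<longleftrightarrow>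
     arcs_in D C [(i, a, b), (j, c, d), (k, e, f)] \<and>
     tm \<in> {a<..<b} \<and> tb \<in> {a<..<b} \<and> mt \<in> {c<..<d} \<and> mb \<in> {c<..<d} \<and>
     bt \<in> {e<..<f} \<and> bm \<in> {e<..<f} \<and>
     crossing D (i, tm) (j, mt) \<and> crossing D (j, mb) (k, bm) \<and> crossing D (i, tb) (k, bt) \<and>
     double_points D \<inter> C = {curve D i tm, curve D j mb, curve D i tb} \<and>
     over D (i, tm) (j, mt) \<and> over D (j, mb) (k, bm) \<and> over D (i, tb) (k, bt) \<and>
     crossing_sign D (i, tm) (j, mt) = e1 \<and>
     crossing_sign D (j, mb) (k, bm) = e2 \<and>
     crossing_sign D (i, tb) (k, bt) = e3"

text \<open>
  The sides of the central triangle are the pieces of the arcs between their two crossings.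
  Sliding an arc across the crossing of the other two, so that this triangle is reversed,
  means that on each of the three arcs the two crossings change their order.
\<close>

fun local_move :: "move \<Rightarrow> complex set \<Rightarrow> diagram \<Rightarrow> diagram \<Rightarrow> bool" where
  "local_move (Omega1 e r) C D D' \<longleftrightarrow>
     (\<exists>A. plain_arcs D C [A] \<and> kinked_arc e r D' C A)"
| "local_move (Omega2 k) C D D' \<longleftrightarrow>
     (\<exists>A B. plain_arcs D C [A, B] \<and> bigon_arcs k D' C A B)"
| "local_move (Omega3 e1 e2 e3) C D D' \<longleftrightarrow>
     (\<exists>T M B tm tb mt mb bt bm tm' tb' mt' mb' bt' bm'.
        triangle_arcs e1 e2 e3 D C T M B tm tb mt mb bt bm \<and>
        triangle_arcs e1 e2 e3 D' C T M B tm' tb' mt' mb' bt' bm' \<and>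
        (tm < tb \<longleftrightarrow> tb' < tm') \<and> (mt < mb \<longleftrightarrow> mb' < mt') \<and> (bt < bm \<longleftrightarrow> bm' < bt'))"

definition reidemeister_move :: "move \<Rightarrow> complex set \<Rightarrow> diagram \<Rightarrow> diagram \<Rightarrow> bool" where
  "reidemeister_move \<Omega> C D D' \<longleftrightarrow> link_diagram D \<and> link_diagram D' \<and>
     changing_disk C D \<and> unchanged_outside C D D' \<and> local_move \<Omega> C D D'"


section \<open>Generating sets\<close>

definition step_in :: "move set \<Rightarrow> complex set \<Rightarrow> diagram \<Rightarrow> diagram \<Rightarrow> bool" where
  "step_in S C D D' \<longleftrightarrow> link_diagram D \<and> link_diagram D' \<and>
     (same_diagram D D' \<or> isotopic_in C D D' \<or>
      (\<exists>\<omega> \<in> S. \<exists>C' \<subseteq> C. reidemeister_move \<omega> C' D D' \<or> reidemeister_move \<omega> C' D' D))"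

definition generating :: "move set \<Rightarrow> bool" where
  "generating S \<longleftrightarrow>
     (\<forall>\<Omega> C D D'. reidemeister_move \<Omega> C D D' \<longrightarrow> (step_in S C)\<^sup>*\<^sup>* D D')"

end

theory Submission
  imports Defs
begin

text \<open>
  Every generating set contains a move of type 3, a move of type 2, and two moves of type 1, one of
  each of two kinds.  For each of these four claims there is an invariant of all the other moves, of
  isotopies and of reparametrizations, together with an explicit example of a move that changes it.
  The invariants are relative to base points on the diagram: a sequence of moves inside the disk
  \<open>C\<close> never touches the diagram outside \<open>C\<close>, so base points outside \<open>C\<close> persist and also
  distinguish the components (\<open>invariant_along_steps\<close>, \<open>not_generating\<close>).

  Type 2: two different components that do not meet cannot be made to meet by moves of types 1 and 3.

  Type 3: follow a component from its base point and record its crossings with two other components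
  in their order.  A move of type 1 does not affect this word in two letters, and a move of type 2
  inserts or deletes twice the same letter at one place.  Hence the parity of the number of
  inversions is invariant, but moving a strand across a crossing of the two other components
  exchanges two different letters and changes it (\<open>omega2_inversions\<close>, \<open>omega3_inversions\<close>).

  Type 1: the parity of the number of self-crossings of a component that are met first from above
  is invariant under moves of types 2 and 3, since a crossing of two arcs in a disk is met first on
  the arc that comes first, wherever it is on the arc (\<open>arcs_ordered\<close>).  The same holds for those met
  first from below.  A kink changes one of the two parities, so moves of both kinds are needed, once
  it is known that the kind is determined by the type of the move.  This is the geometric
  part.  The strand entering a kink starts on the boundary of the disk, so it is outside the loop.
  The corner of the loop is therefore convex, and comparing the winding numbers on both sides of it
  shows that the rotation is opposite to the sign of (first tangent, second tangent)
  (\<open>corner_winding\<close>, \<open>kink_orientation\<close>).  So the crossing is met first from above exactly if it is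
  positive and the loop clockwise, or negative and counterclockwise (\<open>omega1_kind\<close>).

  The examples are explicit curves with coordinates polynomial in \<open>sin\<close>, \<open>cos\<close> and a bump function of
  \<open>cos\<close> that vanishes on the half-circle outside the disk (\<open>kink_example\<close>, \<open>overlap_example\<close>,
  \<open>triangle_example\<close>).
\<close>


section \<open>Crossings and parameters\<close>

lemma same_param_refl [simp]: "same_param p p"
  by (simp add: same_param_def)

lemma same_param_sym: "same_param p q \<Longrightarrow> same_param q p"
  unfolding same_param_def by (metis Ints_minus minus_diff_eq)

lemma same_param_trans: "same_param p q \<Longrightarrow> same_param q r \<Longrightarrow> same_param p r"
  unfolding same_param_def by (metis Ints_add diff_add_cancel add_diff_eq)

lemma same_param_shift [simp]: "same_param (i, s) (j, t) \<longleftrightarrow> i = j \<and> s - t \<in> \<int>"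
  by (simp add: same_param_def)

lemma curve_add_int:
  assumes "link_diagram D" "i < ncomp D"
  shows "curve D i (t + of_int m) = curve D i t"
proof -
  interpret periodic_fun_simple' "curve D i"
    using assms by unfold_locales (auto simp: link_diagram_def)
  show ?thesis by (rule plus_of_int)
qed

lemma pt_same_param:
  assumes "link_diagram D" "param D p" "same_param p q"
  shows "pt D q = pt D p"
proof -
  obtain m where "snd p - snd q = of_int m"
    using assms(3) unfolding same_param_def by (metis Ints_cases)
  then have "snd p = snd q + of_int m" by simp
  then show ?thesis
    using assms curve_add_int[OF assms(1), of "fst q" "snd q" m]
    by (simp add: pt_def param_def same_param_def)
qed

lemma param_same_param: "param D p \<Longrightarrow> same_param p q \<Longrightarrow> param D q"
  by (simp add: param_def same_param_def)

lemma crossing_sym: "crossing D p q \<Longrightarrow> crossing D q p"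
  unfolding crossing_def by (metis same_param_sym)

lemma crossing_cong:
  assumes "link_diagram D" "crossing D p q" "same_param p p'" "same_param q q'"
  shows "crossing D p' q'"
  using assms unfolding crossing_def
  by (metis param_same_param pt_same_param same_param_sym same_param_trans)

lemma no_triple_point:
  "link_diagram D \<Longrightarrow> crossing D p q \<Longrightarrow> crossing D q r \<Longrightarrow> crossing D p r \<Longrightarrow> False"
  unfolding link_diagram_def by blast

lemma crossing_pt: "crossing D p q \<Longrightarrow> pt D p = pt D q"
  by (simp add: crossing_def)

text \<open>
  Without triple points, a point of the plane is visited by at most two parameters modulo 1, so the
  two parameters of a crossing are determined by its position up to their order.
\<close>

lemma crossing_unique:
  assumes D: "link_diagram D" and pq: "crossing D p q" and xy: "crossing D x y"
    and eq: "pt D x = pt D p"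
  shows "same_param p x \<and> same_param q y \<or> same_param q x \<and> same_param p y"
proof -
  have *: "same_param p z \<or> same_param q z" if "param D z" "pt D z = pt D p" for z
  proof (rule ccontr)
    assume "\<not> ?thesis"
    then have "crossing D p z" "crossing D q z"
      using pq that by (auto simp: crossing_def)
    then show False using no_triple_point[OF D pq] by blast
  qed
  have "same_param p x \<or> same_param q x" "same_param p y \<or> same_param q y"
    using xy eq * by (auto simp: crossing_def)
  moreover have "\<not> (same_param r x \<and> same_param r y)" for r
    using xy unfolding crossing_def by (meson same_param_sym same_param_trans)
  ultimately show ?thesis by blast
qed

text \<open>
  Ordering the two parameters of a crossing by height removes the last ambiguity: a crossing is then
  one pair of parameters modulo 1.
\<close>

definition overpass :: "diagram \<Rightarrow> nat \<times> real \<Rightarrow> nat \<times> real \<Rightarrow> bool" where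
  "overpass D p q \<longleftrightarrow> crossing D p q \<and> over D p q"

lemma crossing_overpass:
  "link_diagram D \<Longrightarrow> crossing D p q \<longleftrightarrow> overpass D p q \<or> overpass D q p"
  unfolding overpass_def link_diagram_def by (meson crossing_sym)

lemma overpass_asym: "link_diagram D \<Longrightarrow> overpass D p q \<Longrightarrow> \<not> overpass D q p"
  unfolding overpass_def link_diagram_def by blast

lemma overpass_cong:
  assumes "link_diagram D" "overpass D p q" "same_param p p'" "same_param q q'"
  shows "overpass D p' q'"
  using assms crossing_cong[OF assms(1) _ assms(3,4)]
  unfolding overpass_def link_diagram_def by blast

lemma overpass_unique:
  assumes D: "link_diagram D" and pq: "overpass D p q" and xy: "overpass D x y"
    and eq: "pt D x = pt D p"
  shows "same_param p x \<and> same_param q y"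
proof -
  have "\<not> (same_param q x \<and> same_param p y)"
    using overpass_cong[OF D pq] overpass_asym[OF D xy] by blast
  then show ?thesis
    using crossing_unique[OF D _ _ eq] pq xy unfolding overpass_def by blast
qed

text \<open>
  All that a local move changes is the list \<open>L\<close> of the crossings in its disk, and the invariants are
  computed from such lists.
\<close>

definition disk_passes :: "diagram \<Rightarrow> complex set \<Rightarrow> ((nat \<times> real) \<times> (nat \<times> real)) set \<Rightarrow> bool" where
  "disk_passes D C L \<longleftrightarrow>
     (\<forall>x y. overpass D x y \<and> pt D x \<in> C \<longleftrightarrow> (\<exists>(p, q) \<in> L. same_param p x \<and> same_param q y))"

lemma disk_passesI:
  assumes D: "link_diagram D" and L: "\<And>p q. (p, q) \<in> L \<Longrightarrow> overpass D p q"
    and dp: "double_points D \<inter> C = (\<lambda>(p, q). pt D p) ` L"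
  shows "disk_passes D C L"
  unfolding disk_passes_def
proof (intro allI iffI)
  fix x y assume xy: "overpass D x y \<and> pt D x \<in> C"
  then have "\<exists>p q. pt D x = pt D p \<and> crossing D p q" by (metis overpass_def)
  then have "pt D x \<in> double_points D \<inter> C"
    using xy by (simp add: double_points_def)
  then obtain p q where "(p, q) \<in> L" "pt D x = pt D p"
    using dp by auto
  then show "\<exists>(p, q) \<in> L. same_param p x \<and> same_param q y"
    using overpass_unique[OF D L] xy by blast
next
  fix x y assume "\<exists>(p, q) \<in> L. same_param p x \<and> same_param q y"
  then obtain p q where pq: "(p, q) \<in> L" "same_param p x" "same_param q y" by blast
  have "(\<lambda>(p, q). pt D p) (p, q) \<in> double_points D \<inter> C"
    unfolding dp using pq(1) by (rule imageI)
  then have "pt D p \<in> C" by simp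
  moreover have "param D p" using L[OF pq(1)] by (auto simp: overpass_def crossing_def)
  ultimately show "overpass D x y \<and> pt D x \<in> C"
    using overpass_cong[OF D L[OF pq(1)] pq(2,3)] pt_same_param[OF D _ pq(2)] by simp
qed

lemma unchanged_outside_disk:
  assumes "unchanged_outside C D D'" "param D p"
  shows "pt D p \<in> C \<longleftrightarrow> pt D' p \<in> C"
  using assms interior_subset[of C] unfolding unchanged_outside_def by (metis subsetD)

lemma unchanged_outside_crossing:
  assumes U: "unchanged_outside C D D'"
  shows "crossing D p q \<and> pt D p \<notin> C \<longleftrightarrow> crossing D' p q \<and> pt D' p \<notin> C"
proof -
  have "param D' r = param D r" for r
    using U by (simp add: unchanged_outside_def param_def)
  moreover have "pt D' r = pt D r" if "param D r" "pt D r \<notin> C \<or> pt D' r \<notin> C" for r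
    using U that unchanged_outside_disk[OF U that(1)] interior_subset[of C]
    unfolding unchanged_outside_def by (metis subsetD)
  ultimately show ?thesis
    by (smt (verit, best) crossing_def)
qed

lemma unchanged_outside_overpass:
  assumes U: "unchanged_outside C D D'"
  shows "overpass D p q \<and> pt D p \<notin> C \<longleftrightarrow> overpass D' p q \<and> pt D' p \<notin> C"
  using unchanged_outside_crossing[OF U, of p q] U
  unfolding overpass_def unchanged_outside_def by blast

section \<open>Arcs of a disk seen from a base point outside\<close>

lemma changing_disk_compact: "changing_disk C D \<Longrightarrow> compact C"
proof -
  assume "changing_disk C D"
  then obtain f :: "complex \<Rightarrow> complex" where f: "smooth f" "C = f ` cball 0 1"
    unfolding changing_disk_def by blast
  have "continuous_on (cball 0 1) f"
    using f(1) smooth.cases differentiable_imp_continuous_within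
    by (metis continuous_at_imp_continuous_on)
  then show ?thesis using f(2) compact_continuous_image compact_cball by blast
qed

lemma proper_arc_in:
  assumes "closed C" "proper_arc D C (i, a, b)" "t \<in> {a..b}"
  shows "curve D i t \<in> C"
proof -
  consider "t = a" | "t = b" | "t \<in> {a<..<b}" using assms(3) by fastforce
  then show ?thesis
    using assms(1,2) interior_subset[of C] frontier_subset_closed[of C] by cases auto
qed

definition window :: "real \<Rightarrow> real set" where
  "window t0 = {t0 <..< t0 + 1}"

lemma window_eq: "s \<in> window t0 \<Longrightarrow> t \<in> window t0 \<Longrightarrow> s - t \<in> \<int> \<Longrightarrow> s = t"
proof -
  assume st: "s \<in> window t0" "t \<in> window t0" and "s - t \<in> \<int>"
  then obtain z where z: "s - t = of_int z" by (auto elim: Ints_cases)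
  then have "\<bar>real_of_int z\<bar> < 1" using st by (auto simp: window_def)
  then have "z = 0" by linarith
  then show ?thesis using z by simp
qed

lemma arc_shift:
  assumes C: "closed C" and D: "link_diagram D" and A: "proper_arc D C (i, a, b)"
    and out: "pt D (i, t0) \<notin> C"
  obtains m :: int where "\<And>t. t \<in> {a..b} \<Longrightarrow> t + of_int m \<in> window t0"
proof
  define m where "m = \<lceil>t0 - a\<rceil>"
  have i: "i < ncomp D" using A by simp
  have not: "t + of_int m \<noteq> t0" "t + of_int m \<noteq> t0 + 1" if "t \<in> {a..b}" for t
  proof -
    have "curve D i t \<in> C" using proper_arc_in[OF C A that] .
    then have "curve D i (t + of_int n) \<in> C" for n using curve_add_int[OF D i] by simp
    from this[of m] this[of "m - 1"] out show "t + of_int m \<noteq> t0" "t + of_int m \<noteq> t0 + 1"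
      by (auto simp: pt_def algebra_simps)
  qed
  have ab: "a < b" "b < a + 1" using A by auto
  have 1: "t0 \<le> a + of_int m" "a + of_int m < t0 + 1" unfolding m_def by linarith+
  have 2: "t0 < a + of_int m" using not(1)[of a] 1 ab by simp
  have 3: "b + of_int m < t0 + 1"
  proof (rule ccontr)
    assume "\<not> ?thesis"
    then have "t0 + 1 - of_int m \<in> {a..b}" using 1 by simp
    from not(2)[OF this] show False by simp
  qed
  show "t + of_int m \<in> window t0" if "t \<in> {a..b}" for t
    using that 2 3 by (auto simp: window_def)
qed

lemma arcs_in_disjoint:
  assumes C: "closed C" and As: "arcs_in D C As" and kl: "k < length As" "l < length As" "k \<noteq> l"
    and p: "param D p" "on_arc p (As ! k)" and D: "link_diagram D"
  shows "\<not> on_arc p (As ! l)"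
proof -
  obtain i a b where A: "As ! k = (i, a, b)" by (cases "As ! k") auto
  obtain j t where pp: "p = (j, t)" by (cases p) auto
  obtain m :: int where m: "t + of_int m \<in> {a..b}" "j = i" using p A pp by auto
  have "proper_arc D C (i, a, b)" using As kl(1) A unfolding arcs_in_def by (metis nth_mem)
  then have "curve D i (t + of_int m) \<in> C" "i < ncomp D"
    using proper_arc_in[OF C _ m(1)] by auto
  then have "pt D p \<in> C" using curve_add_int[OF D, of i t m] pp m by (simp add: pt_def)
  then have "\<exists>!k. k < length As \<and> on_arc p (As ! k)" using As p unfolding arcs_in_def by blast
  then show ?thesis using kl p by blast
qed

text \<open>
  The base point being outside the disk, each arc occupies an interval of the window, and
  different arcs disjoint intervals.  So the order of two points on different arcs is decided
  by the arcs alone.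
\<close>

lemma arcs_ordered:
  assumes C: "closed C" and D: "link_diagram D" and As: "arcs_in D C As"
    and kl: "k < length As" "l < length As" "k \<noteq> l"
    and A: "As ! k = (i, a, b)" and B: "As ! l = (i, c, d)" and out: "pt D (i, t0) \<notin> C"
  obtains m n :: int and before :: bool
  where "\<And>s. s \<in> {a..b} \<Longrightarrow> s + of_int m \<in> window t0" "\<And>u. u \<in> {c..d} \<Longrightarrow> u + of_int n \<in> window t0"
    "\<And>s u. s \<in> {a..b} \<Longrightarrow> u \<in> {c..d} \<Longrightarrow> s + of_int m < u + of_int n \<longleftrightarrow> before"
proof -
  have pA: "proper_arc D C (i, a, b)" and pB: "proper_arc D C (i, c, d)"
    using As kl A B unfolding arcs_in_def by (metis nth_mem)+
  obtain m :: int where m: "\<And>t. t \<in> {a..b} \<Longrightarrow> t + of_int m \<in> window t0"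
    using arc_shift[OF C D pA out] by blast
  obtain n :: int where n: "\<And>t. t \<in> {c..d} \<Longrightarrow> t + of_int n \<in> window t0"
    using arc_shift[OF C D pB out] by blast
  have ab: "a < b" "c < d" "i < ncomp D" using pA pB by auto
  have ne: "s + of_int m \<noteq> u + of_int n" if "s \<in> {a..b}" "u \<in> {c..d}" for s u
  proof
    assume eq: "s + of_int m = u + of_int n"
    have "on_arc (i, s) (As ! k)" using that(1) A by (auto intro!: exI[of _ 0])
    moreover have "s + of_int (m - n) = u" using eq by simp
    then have "on_arc (i, s) (As ! l)" using that(2) B by (metis on_arc.simps)
    ultimately show False
      using arcs_in_disjoint[OF C As kl _ _ D] ab by (simp add: param_def)
  qed
  have one: "s + of_int m < u + of_int n \<longleftrightarrow> a + of_int m < c + of_int n" 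
    if su: "s \<in> {a..b}" "u \<in> {c..d}" for s u
  proof -
    have "a + of_int m < c + of_int n" if "s + of_int m < u + of_int n"
    proof (rule ccontr)
      assume "\<not> ?thesis"
      then have "a + of_int m - of_int n \<in> {c..d}" using that su by auto
      from ne[OF _ this, of a] ab show False by simp
    qed
    moreover have "s + of_int m < u + of_int n" if "a + of_int m < c + of_int n"
    proof (rule ccontr)
      assume "\<not> ?thesis"
      then have "c + of_int n - of_int m \<in> {a..b}" using that su by auto
      from ne[OF this, of c] ab show False by simp
    qed
    ultimately show ?thesis by blast
  qed
  show ?thesis using that[OF m n one] by blast
qed


section \<open>Local moves as changes of the list of crossings\<close>

lemma reidemeister_moveD:
  assumes "reidemeister_move \<omega> C D D'"
  shows "link_diagram D" "link_diagram D'" "closed C" "compact C" "unchanged_outside C D D'" "ncomp D' = ncomp D"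
proof -
  show "compact C" using assms changing_disk_compact unfolding reidemeister_move_def by blast
  then show "closed C" by (rule compact_imp_closed)
  show "link_diagram D" "link_diagram D'" "unchanged_outside C D D'"
    using assms unfolding reidemeister_move_def by blast+
  then show "ncomp D' = ncomp D" unfolding unchanged_outside_def by blast
qed

lemma plain_arcs_passes: "link_diagram D \<Longrightarrow> plain_arcs D C As \<Longrightarrow> disk_passes D C {}"
  by (rule disk_passesI) (simp_all add: plain_arcs_def)

lemma kinked_arc_passes:
  assumes D: "link_diagram D" and K: "kinked_arc e r D C (i, a, b)"
  obtains s u where "a < s" "s < u" "u < b" "crossing D (i, s) (i, u)" "arcs_in D C [(i, a, b)]"
    "crossing_sign D (i, s) (i, u) = e" "double_points D \<inter> C = {curve D i s}"
    "loop_rotates r (subpath s u (curve D i))"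
    "disk_passes D C {if over D (i, s) (i, u) then ((i, s), (i, u)) else ((i, u), (i, s))}"
proof -
  obtain s u where *: "a < s" "s < u" "u < b" "crossing D (i, s) (i, u)" "arcs_in D C [(i, a, b)]"
    "crossing_sign D (i, s) (i, u) = e" "double_points D \<inter> C = {curve D i s}"
    "loop_rotates r (subpath s u (curve D i))"
    using K by auto
  have "overpass D (i, s) (i, u)" if "over D (i, s) (i, u)"
    using *(4) that by (simp add: overpass_def)
  moreover have "overpass D (i, u) (i, s)" if "\<not> over D (i, s) (i, u)"
    using *(4) that crossing_overpass[OF D] overpass_def by blast
  moreover have "curve D i u = curve D i s" using crossing_pt[OF *(4)] by (simp add: pt_def)
  ultimately have "disk_passes D C {if over D (i, s) (i, u) then ((i, s), (i, u)) else ((i, u), (i, s))}"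
    using *(7) by (intro disk_passesI[OF D]) (auto simp: pt_def split: if_splits)
  with * show ?thesis using that by blast
qed

lemma bigon_arcs_passes:
  assumes D: "link_diagram D" and K: "bigon_arcs h D C (i, a, b) (j, c, d)"
  obtains p p' q q' where "p \<in> {a..b}" "p' \<in> {a..b}" "q \<in> {c..d}" "q' \<in> {c..d}" "p \<noteq> p'" "q \<noteq> q'"
    "arcs_in D C [(i, a, b), (j, c, d)]"
    "disk_passes D C {((i, p), (j, q)), ((i, p'), (j, q'))}"
proof -
  obtain p p' q q' where *: "p \<in> {a<..<b}" "p' \<in> {a<..<b}" "q \<in> {c<..<d}" "q' \<in> {c<..<d}"
    "crossing D (i, p) (j, q)" "crossing D (i, p') (j, q')"
    "double_points D \<inter> C = {curve D i p, curve D i p'}"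
    "over D (i, p) (j, q)" "over D (i, p') (j, q')" "crossing_order h p p' q q'"
    "arcs_in D C [(i, a, b), (j, c, d)]"
    using K unfolding bigon_arcs.simps by blast
  have "disk_passes D C {((i, p), (j, q)), ((i, p'), (j, q'))}"
    using *(5-9) by (intro disk_passesI[OF D]) (auto simp: overpass_def pt_def)
  moreover have "p \<noteq> p'" "q \<noteq> q'" using *(10) by (cases h; simp)+
  moreover have "p \<in> {a..b}" "p' \<in> {a..b}" "q \<in> {c..d}" "q' \<in> {c..d}" using *(1-4) by simp_all
  ultimately show ?thesis using that *(11) by blast
qed

lemma triangle_arcs_passes:
  assumes D: "link_diagram D"
    and K: "triangle_arcs e1 e2 e3 D C (i, a, b) (j, c, d) (k, e, f) tm tb mt mb bt bm"
  shows "tm \<in> {a..b}" "tb \<in> {a..b}" "mt \<in> {c..d}" "mb \<in> {c..d}" "bt \<in> {e..f}" "bm \<in> {e..f}"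
    "arcs_in D C [(i, a, b), (j, c, d), (k, e, f)]"
    "disk_passes D C {((i, tm), (j, mt)), ((j, mb), (k, bm)), ((i, tb), (k, bt))}"
proof -
  have arcs: "arcs_in D C [(i, a, b), (j, c, d), (k, e, f)]"
    and par: "tm \<in> {a<..<b}" "tb \<in> {a<..<b}" "mt \<in> {c<..<d}" "mb \<in> {c<..<d}" "bt \<in> {e<..<f}" "bm \<in> {e<..<f}"
    and cr: "overpass D (i, tm) (j, mt)" "overpass D (j, mb) (k, bm)" "overpass D (i, tb) (k, bt)"
    and dp: "double_points D \<inter> C = {curve D i tm, curve D j mb, curve D i tb}"
    using K unfolding triangle_arcs.simps overpass_def by blast+
  show "disk_passes D C {((i, tm), (j, mt)), ((j, mb), (k, bm)), ((i, tb), (k, bt))}"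
    using cr by (intro disk_passesI[OF D]) (auto simp: dp pt_def)
  show "arcs_in D C [(i, a, b), (j, c, d), (k, e, f)]" by (rule arcs)
  show "tm \<in> {a..b}" "tb \<in> {a..b}" "mt \<in> {c..d}" "mb \<in> {c..d}" "bt \<in> {e..f}" "bm \<in> {e..f}"
    using par by simp_all
qed

section \<open>Self-crossings met first from above\<close>

text \<open>
  The base point \<open>(i, t0)\<close> cuts component \<open>i\<close> open, so that of the two passages through a self-crossing
  one is the first.  For \<open>b\<close> true this set consists of the self-crossings that are met first from
  above, for \<open>b\<close> false of the others; each is listed as (over-parameter, under-parameter).
\<close>

fun self_passes :: "diagram \<Rightarrow> nat \<times> real \<Rightarrow> bool \<Rightarrow> (real \<times> real) set" where
  "self_passes D (i, t0) b =
     {(s, u). s \<in> window t0 \<and> u \<in> window t0 \<and> overpass D (i, s) (i, u) \<and> (s < u \<longleftrightarrow> b)}"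

lemma finite_crossing_params:
  assumes D: "link_diagram D"
  shows "finite {s \<in> window t0. \<exists>q. crossing D (i, s) q}"
proof -
  let ?A = "\<lambda>z. {s \<in> window t0. curve D i s = z \<and> (\<exists>q. crossing D (i, s) q)}"
  have one: "finite {s \<in> window t0. same_param q (i, s)}" for q
  proof (cases "{s \<in> window t0. same_param q (i, s)} = {}")
    case False
    then obtain x where x: "x \<in> window t0" "same_param q (i, x)" by blast
    have "{s \<in> window t0. same_param q (i, s)} \<subseteq> {x}"
    proof
      fix s assume s: "s \<in> {s \<in> window t0. same_param q (i, s)}"
      then have "same_param (i, s) (i, x)" using x by (metis (lifting) mem_Collect_eq same_param_sym same_param_trans)
      then show "s \<in> {x}" using s x window_eq by auto
    qed
    then show ?thesis using finite_subset by blast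
  qed (simp only: finite.emptyI)
  have fin: "finite (?A z)" for z
  proof (cases "?A z = {}")
    case False
    then obtain x q where x: "curve D i x = z" "crossing D (i, x) q" by blast
    have "?A z \<subseteq> {s \<in> window t0. same_param (i, x) (i, s)} \<union> {s \<in> window t0. same_param q (i, s)}"
    proof
      fix s assume s: "s \<in> ?A z"
      then obtain q' where "crossing D (i, s) q'" by blast
      from crossing_unique[OF D x(2) this] s x
      show "s \<in> {s \<in> window t0. same_param (i, x) (i, s)} \<union> {s \<in> window t0. same_param q (i, s)}"
        by (auto simp: pt_def)
    qed
    then show ?thesis by (rule finite_subset[OF _ finite_UnI[OF one one]])
  qed (simp only: finite.emptyI)
  have "{s \<in> window t0. \<exists>q. crossing D (i, s) q} \<subseteq> (\<Union>z\<in>double_points D. ?A z)"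
  proof
    fix s assume s: "s \<in> {s \<in> window t0. \<exists>q. crossing D (i, s) q}"
    then have "pt D (i, s) \<in> double_points D" unfolding double_points_def by blast
    then show "s \<in> (\<Union>z\<in>double_points D. ?A z)" using s by (auto simp: pt_def)
  qed
  moreover have "finite (double_points D)" using D by (simp add: link_diagram_def)
  ultimately show ?thesis by (rule finite_subset[OF _ finite_UN_I[OF _ fin]])
qed

lemma finite_self_passes:
  assumes D: "link_diagram D"
  shows "finite (self_passes D p b)"
proof (cases p)
  case (Pair i t0)
  let ?F = "{s \<in> window t0. \<exists>q. crossing D (i, s) q}"
  have "s \<in> ?F \<and> u \<in> ?F" if "(s, u) \<in> self_passes D p b" for s u
  proof -
    have "crossing D (i, s) (i, u)" "s \<in> window t0" "u \<in> window t0"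
      using that by (auto simp: Pair overpass_def)
    then show ?thesis using crossing_sym by blast
  qed
  then have "self_passes D p b \<subseteq> ?F \<times> ?F" by (auto simp del: mem_Collect_eq)
  then show ?thesis by (rule finite_subset[OF _ finite_cartesian_product[OF finite_crossing_params[OF D] finite_crossing_params[OF D]]])
qed

text \<open>
  The contribution of a single crossing, given by any parameters \<open>p\<close>, \<open>q\<close> of it.
\<close>

definition lifts :: "nat \<Rightarrow> real \<Rightarrow> bool \<Rightarrow> nat \<times> real \<Rightarrow> nat \<times> real \<Rightarrow> (real \<times> real) set" where
  "lifts i t0 b p q = {(s, u). s \<in> window t0 \<and> u \<in> window t0 \<and>
     same_param p (i, s) \<and> same_param q (i, u) \<and> (s < u \<longleftrightarrow> b)}"

definition outer_passes where
  "outer_passes D C i t0 b = {(s, u). s \<in> window t0 \<and> u \<in> window t0 \<and>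
     (overpass D (i, s) (i, u) \<and> pt D (i, s) \<notin> C) \<and> (s < u \<longleftrightarrow> b)}"

lemma card_self_passes:
  assumes D: "link_diagram D" and L: "disk_passes D C L" "finite L"
    and dist: "\<And>p q p' q'. (p, q) \<in> L \<Longrightarrow> (p', q') \<in> L \<Longrightarrow> same_param p p' \<Longrightarrow> same_param q q' \<Longrightarrow>
       (p, q) = (p', q')"
  shows "card (self_passes D (i, t0) b) = card (outer_passes D C i t0 b) + (\<Sum>(p, q) \<in> L. card (lifts i t0 b p q))"
proof -
  let ?Z = "\<lambda>(p, q). lifts i t0 b p q"
  have eq: "self_passes D (i, t0) b = outer_passes D C i t0 b \<union> (\<Union>x\<in>L. ?Z x)"
  proof (rule set_eqI, clarify)
    fix s u
    have "overpass D (i, s) (i, u) \<and> pt D (i, s) \<in> C \<longleftrightarrow>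
       (\<exists>x\<in>L. same_param (fst x) (i, s) \<and> same_param (snd x) (i, u))"
      using L(1)[unfolded disk_passes_def, rule_format, of "(i, s)" "(i, u)"]
      by (simp add: split_beta del: same_param_shift)
    then show "(s, u) \<in> self_passes D (i, t0) b \<longleftrightarrow> (s, u) \<in> outer_passes D C i t0 b \<union> (\<Union>x\<in>L. ?Z x)"
      by (simp add: outer_passes_def lifts_def split_beta del: same_param_shift) blast
  qed
  have fin: "finite (self_passes D (i, t0) b)" by (rule finite_self_passes[OF D])
  have "outer_passes D C i t0 b \<inter> (\<Union>x\<in>L. ?Z x) = {}"
  proof (rule equals0I)
    fix y assume "y \<in> outer_passes D C i t0 b \<inter> (\<Union>x\<in>L. ?Z x)"
    then obtain s u x where x: "x \<in> L" and su: "(s, u) \<in> outer_passes D C i t0 b" "(s, u) \<in> ?Z x"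
      by (cases y) blast
    have "\<exists>x\<in>L. same_param (fst x) (i, s) \<and> same_param (snd x) (i, u)"
      using x su(2) by (auto simp: lifts_def split_beta simp del: same_param_shift)
    then have "pt D (i, s) \<in> C"
      using L(1)[unfolded disk_passes_def, rule_format, of "(i, s)" "(i, u)"]
      by (simp add: split_beta del: same_param_shift)
    then show False using su(1) by (simp add: outer_passes_def)
  qed
  then have "card (self_passes D (i, t0) b) = card (outer_passes D C i t0 b) + card (\<Union>x\<in>L. ?Z x)"
    using fin unfolding eq by (subst card_Un_disjoint) auto
  also have "card (\<Union>x\<in>L. ?Z x) = (\<Sum>x\<in>L. card (?Z x))"
  proof (rule card_UN_disjoint)
    show "\<forall>x\<in>L. finite (?Z x)" using fin eq
      by (metis (no_types, lifting) UN_upper finite_Un finite_subset)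
    show "\<forall>x\<in>L. \<forall>y\<in>L. x \<noteq> y \<longrightarrow> ?Z x \<inter> ?Z y = {}"
    proof (intro ballI impI)
      fix x y assume xy: "x \<in> L" "y \<in> L" "x \<noteq> y"
      show "?Z x \<inter> ?Z y = {}"
      proof (rule ccontr)
        assume "?Z x \<inter> ?Z y \<noteq> {}"
        then obtain s u where "same_param (fst x) (i, s)" "same_param (snd x) (i, u)"
           "same_param (fst y) (i, s)" "same_param (snd y) (i, u)"
          by (auto simp: lifts_def split_beta)
        then have "same_param (fst x) (fst y)" "same_param (snd x) (snd y)"
          using same_param_sym same_param_trans by blast+
        then show False using dist[of "fst x" "snd x" "fst y" "snd y"] xy by simp
      qed
    qed
  qed (use L in simp)
  finally show ?thesis by (simp add: split_def)
qed

lemma outer_passes_unchanged: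
  assumes U: "unchanged_outside C D D'"
  shows "outer_passes D' C i t0 b = outer_passes D C i t0 b"
proof -
  have "overpass D' (i, s) (i, u) \<and> pt D' (i, s) \<notin> C \<longleftrightarrow> overpass D (i, s) (i, u) \<and> pt D (i, s) \<notin> C" for s u
    using unchanged_outside_overpass[OF U] by blast
  then show ?thesis unfolding outer_passes_def by simp
qed

lemma lifts_other: "fst p \<noteq> i \<or> fst q \<noteq> i \<Longrightarrow> lifts i t0 b p q = {}"
  by (auto simp: lifts_def same_param_def)

lemma lifts_eq:
  assumes "p + of_int m \<in> window t0" "q + of_int n \<in> window t0"
  shows "lifts i t0 b (i, p) (i, q) = (if p + of_int m < q + of_int n \<longleftrightarrow> b then {(p + of_int m, q + of_int n)} else {})"
proof -
  have "p - s \<in> \<int> \<longleftrightarrow> s = p + of_int m" if "s \<in> window t0" "p + of_int m \<in> window t0" for s p m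
  proof
    assume "p - s \<in> \<int>"
    then have "p + of_int m - s \<in> \<int>" by (metis Ints_add Ints_of_int add.commute add_diff_eq)
    then show "s = p + of_int m" using window_eq that by metis
  qed auto
  then show ?thesis using assms by (auto simp: lifts_def)
qed

text \<open>
  The contribution of a crossing of two different arcs depends on the arcs only, and not on its
  position on them.
\<close>

lemma card_lifts_arcs:
  assumes C: "closed C" and D: "link_diagram D" and As: "arcs_in D C As"
    and kl: "k < length As" "l < length As" "k \<noteq> l"
    and A: "As ! k = (i', a, b)" and B: "As ! l = (j', c, d)" and out: "pt D (i, t0) \<notin> C"
  obtains N where "\<And>s u. s \<in> {a..b} \<Longrightarrow> u \<in> {c..d} \<Longrightarrow> card (lifts i t0 b' (i', s) (j', u)) = N"
proof (cases "i' = i \<and> j' = i")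
  case True
  obtain m n :: int and before :: bool
  where *: "\<And>s. s \<in> {a..b} \<Longrightarrow> s + of_int m \<in> window t0" "\<And>u. u \<in> {c..d} \<Longrightarrow> u + of_int n \<in> window t0"
    "\<And>s u. s \<in> {a..b} \<Longrightarrow> u \<in> {c..d} \<Longrightarrow> s + of_int m < u + of_int n \<longleftrightarrow> before"
    using arcs_ordered[OF C D As kl, of i a b c d t0] A B out True by metis
  have "card (lifts i t0 b' (i', s) (j', u)) = (if before = b' then 1 else 0)"
    if "s \<in> {a..b}" "u \<in> {c..d}" for s u
    using lifts_eq[OF *(1)[OF that(1)] *(2)[OF that(2)]] *(3)[OF that] True by simp
  then show ?thesis using that by blast
next
  case False
  then have "card (lifts i t0 b' (i', s) (j', u)) = 0" for s u by (subst lifts_other) auto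
  then show ?thesis using that by blast
qed

text \<open>
  Both crossings of the bigon lie on the same two arcs with the same one on top, so they contribute
  equally.
\<close>

lemma omega2_self_passes:
  assumes R: "reidemeister_move (Omega2 h) C D D'" and out: "pt D (i, t0) \<notin> C" "param D (i, t0)"
  shows "even (card (self_passes D' (i, t0) b)) = even (card (self_passes D (i, t0) b))"
proof -
  note F = reidemeister_moveD[OF R]
  obtain A B where AB: "plain_arcs D C [A, B]" "bigon_arcs h D' C A B"
    using R unfolding reidemeister_move_def local_move.simps by blast
  obtain i1 a1 b1 j1 c1 d1 where A: "A = (i1, a1, b1)" and B: "B = (j1, c1, d1)"
    by (metis prod_cases3)
  obtain p p' q q' where p: "p \<in> {a1..b1}" "p' \<in> {a1..b1}" "q \<in> {c1..d1}" "q' \<in> {c1..d1}" "p \<noteq> p'" "q \<noteq> q'"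
    "arcs_in D' C [(i1, a1, b1), (j1, c1, d1)]"
    "disk_passes D' C {((i1, p), (j1, q)), ((i1, p'), (j1, q'))}"
    using bigon_arcs_passes[OF F(2)] AB(2) A B by metis
  have out': "pt D' (i, t0) \<notin> C" using unchanged_outside_disk[OF F(5) out(2)] out(1) by simp
  obtain N where N: "\<And>s u. s \<in> {a1..b1} \<Longrightarrow> u \<in> {c1..d1} \<Longrightarrow> card (lifts i t0 b (i1, s) (j1, u)) = N"
    using card_lifts_arcs[OF F(3,2) p(7), of 0 1 i1 a1 b1 j1 c1 d1 i t0 b] out' by auto
  have pp: "p - p' \<notin> \<int>"
  proof
    assume "p - p' \<in> \<int>"
    then obtain z where z: "p - p' = of_int z" by (auto elim: Ints_cases)
    moreover have "b1 < a1 + 1" using p(7) by (simp add: arcs_in_def)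
    ultimately have "\<bar>real_of_int z\<bar> < 1" using p(1,2) by auto
    then have "z = 0" by linarith
    then show False using z p(5) by simp
  qed
  moreover have "p' - p \<notin> \<int>" using pp by (metis Ints_minus minus_diff_eq)
  ultimately have 1: "card (self_passes D' (i, t0) b) = card (outer_passes D' C i t0 b) +
     (\<Sum>(p, q) \<in> {((i1, p), (j1, q)), ((i1, p'), (j1, q'))}. card (lifts i t0 b p q))"
    by (intro card_self_passes[OF F(2) p(8)]) auto
  have 2: "card (self_passes D (i, t0) b) = card (outer_passes D C i t0 b) + (\<Sum>(p, q) \<in> {}. card (lifts i t0 b p q))"
    using plain_arcs_passes[OF F(1) AB(1)] by (intro card_self_passes[OF F(1)]) auto
  have "((i1, p), (j1, q)) \<noteq> ((i1, p'), (j1, q'))" using p(5) by simp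
  then show ?thesis
    using 1 2 N p outer_passes_unchanged[OF F(5)] by simp
qed

lemma arcs_in_separate:
  assumes C: "closed C" and D: "link_diagram D" and As: "arcs_in D C As"
    and kl: "k < length As" "l < length As" "k \<noteq> l"
    and A: "As ! k = (i, a, b)" and B: "As ! l = (j, c, d)" and st: "s \<in> {a..b}" "u \<in> {c..d}"
  shows "\<not> same_param (i, s) (j, u)"
proof
  assume "same_param (i, s) (j, u)"
  then have ij: "i = j" and "u - s \<in> \<int>" by (simp_all, metis Ints_minus minus_diff_eq)
  then obtain m where "u - s = of_int m" by (auto elim: Ints_cases)
  then have "s + of_int m = u" by simp
  then have "on_arc (i, s) (As ! l)" using B ij st(2) by (auto intro!: exI[of _ m])
  moreover have "on_arc (i, s) (As ! k)" using A st(1) by (auto intro!: exI[of _ 0])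
  moreover have "proper_arc D C (As ! k)" using As kl(1) by (simp add: arcs_in_def)
  ultimately show False
    using arcs_in_disjoint[OF C As kl, of "(i, s)"] D A by (simp add: param_def)
qed

lemma sum3:
  fixes f :: "'a \<Rightarrow> nat"
  shows "x \<noteq> y \<Longrightarrow> x \<noteq> z \<Longrightarrow> y \<noteq> z \<Longrightarrow> sum f {x, y, z} = f x + f y + f z"
  by simp

text \<open>
  The crossings of the triangle move along their arcs but keep their pairs of arcs and the height of
  these, so each keeps its contribution.
\<close>

lemma omega3_self_passes:
  assumes R: "reidemeister_move (Omega3 e1 e2 e3) C D D'" and out: "pt D (i, t0) \<notin> C" "param D (i, t0)"
  shows "card (self_passes D' (i, t0) b) = card (self_passes D (i, t0) b)"
proof -
  note F = reidemeister_moveD[OF R]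
  obtain T M B tm tb mt mb bt bm tm' tb' mt' mb' bt' bm' where 
     tr: "triangle_arcs e1 e2 e3 D C T M B tm tb mt mb bt bm"
        "triangle_arcs e1 e2 e3 D' C T M B tm' tb' mt' mb' bt' bm'"
    using R unfolding reidemeister_move_def local_move.simps by blast
  obtain i1 a1 b1 j1 c1 d1 k1 l1 f1 where TMB: "T = (i1, a1, b1)" "M = (j1, c1, d1)" "B = (k1, l1, f1)"
    by (metis prod_cases3)
  note P = triangle_arcs_passes[OF F(1) tr(1)[unfolded TMB]]
  note P' = triangle_arcs_passes[OF F(2) tr(2)[unfolded TMB]]
  obtain N1 where N1: "\<And>s u. s \<in> {a1..b1} \<Longrightarrow> u \<in> {c1..d1} \<Longrightarrow> card (lifts i t0 b (i1, s) (j1, u)) = N1"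
    using card_lifts_arcs[OF F(3,1) P(7), of 0 1 i1 a1 b1 j1 c1 d1 i t0 b] out by auto
  obtain N2 where N2: "\<And>s u. s \<in> {c1..d1} \<Longrightarrow> u \<in> {l1..f1} \<Longrightarrow> card (lifts i t0 b (j1, s) (k1, u)) = N2"
    using card_lifts_arcs[OF F(3,1) P(7), of 1 2 j1 c1 d1 k1 l1 f1 i t0 b] out by auto
  obtain N3 where N3: "\<And>s u. s \<in> {a1..b1} \<Longrightarrow> u \<in> {l1..f1} \<Longrightarrow> card (lifts i t0 b (i1, s) (k1, u)) = N3"
    using card_lifts_arcs[OF F(3,1) P(7), of 0 2 i1 a1 b1 k1 l1 f1 i t0 b] out by auto
  have main: "card (self_passes E (i, t0) b) = card (outer_passes E C i t0 b) + (N1 + N2 + N3)"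
    if E: "link_diagram E" and arcs: "arcs_in E C [(i1, a1, b1), (j1, c1, d1), (k1, l1, f1)]"
      and in_arc: "tm \<in> {a1..b1}" "tb \<in> {a1..b1}" "mt \<in> {c1..d1}" "mb \<in> {c1..d1}" "bt \<in> {l1..f1}" "bm \<in> {l1..f1}"
      and L: "disk_passes E C {((i1, tm), (j1, mt)), ((j1, mb), (k1, bm)), ((i1, tb), (k1, bt))}"
    for E tm tb mt mb bt bm
  proof -
    have ne1: "\<not> same_param (i1, tm) (j1, mb)"
      by (rule arcs_in_separate[OF F(3) E arcs, of 0 1]) (use in_arc in simp_all)
    have ne2: "\<not> same_param (i1, tb) (j1, mb)"
      by (rule arcs_in_separate[OF F(3) E arcs, of 0 1]) (use in_arc in simp_all)
    have ne3: "\<not> same_param (j1, mt) (k1, bt)"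
      by (rule arcs_in_separate[OF F(3) E arcs, of 1 2]) (use in_arc in simp_all)
    note ne = ne1 ne2 ne3 ne1[THEN contrapos_nn, OF same_param_sym] ne2[THEN contrapos_nn, OF same_param_sym]
      ne3[THEN contrapos_nn, OF same_param_sym]
    have "card (self_passes E (i, t0) b) = card (outer_passes E C i t0 b) +
     (\<Sum>(p, q) \<in> {((i1, tm), (j1, mt)), ((j1, mb), (k1, bm)), ((i1, tb), (k1, bt))}. card (lifts i t0 b p q))"
      using ne by (intro card_self_passes[OF E L]) (auto simp del: same_param_shift)
    moreover have "(\<Sum>(p, q) \<in> {((i1, tm), (j1, mt)), ((j1, mb), (k1, bm)), ((i1, tb), (k1, bt))}.
        card (lifts i t0 b p q)) = N1 + N2 + N3"
    proof -
      have n: "((i1, tm), (j1, mt)) \<noteq> ((j1, mb), (k1, bm))" "((i1, tm), (j1, mt)) \<noteq> ((i1, tb), (k1, bt))"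
         "((j1, mb), (k1, bm)) \<noteq> ((i1, tb), (k1, bt))"
        using ne1 ne2 ne3 by (auto simp del: same_param_shift)
      show ?thesis
        unfolding sum3[OF n] prod.case N1[OF in_arc(1,3)] N2[OF in_arc(4,6)] N3[OF in_arc(2,5)] by (rule refl)
    qed
    ultimately show ?thesis by metis
  qed
  have "card (self_passes D (i, t0) b) = card (outer_passes D C i t0 b) + (N1 + N2 + N3)"
    by (rule main[OF F(1) P(7) P(1-6) P(8)])
  moreover have "card (self_passes D' (i, t0) b) = card (outer_passes D' C i t0 b) + (N1 + N2 + N3)"
    by (rule main[OF F(2) P'(7) P'(1-6) P'(8)])
  moreover have "outer_passes D' C i t0 b = outer_passes D C i t0 b"
    by (rule outer_passes_unchanged[OF F(5)])
  ultimately show ?thesis by metis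
qed

text \<open>
  A kink contributes one crossing, met from above first if and only if its over-strand is the
  beginning of the loop.
\<close>

lemma omega1_self_passes:
  assumes R: "link_diagram D" "link_diagram D'" "closed C" "unchanged_outside C D D'"
    and AB: "plain_arcs D C [(j, a1, b1)]" "arcs_in D' C [(j, a1, b1)]"
    and su: "a1 \<le> s" "s < u" "u \<le> b1" 
    and L: "disk_passes D' C {if o1 then ((j, s), (j, u)) else ((j, u), (j, s))}"
    and out: "pt D (i, t0) \<notin> C" "param D (i, t0)"
  shows "card (self_passes D' (i, t0) b) = card (self_passes D (i, t0) b) + of_bool (i = j \<and> b = o1)"
proof -
  let ?L = "{if o1 then ((j, s), (j, u)) else ((j, u), (j, s))}"
  have 1: "card (self_passes D' (i, t0) b) = card (outer_passes D' C i t0 b) +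
     (\<Sum>(p, q) \<in> ?L. card (lifts i t0 b p q))"
    by (intro card_self_passes[OF R(2) L]) (auto split: if_splits)
  have 2: "card (self_passes D (i, t0) b) = card (outer_passes D C i t0 b) + (\<Sum>(p, q) \<in> {}. card (lifts i t0 b p q))"
    using plain_arcs_passes[OF R(1) AB(1)] by (intro card_self_passes[OF R(1)]) auto
  have "(\<Sum>(p, q) \<in> ?L. card (lifts i t0 b p q)) = of_bool (i = j \<and> b = o1)"
  proof (cases "i = j")
    case True
    have "proper_arc D' C (j, a1, b1)" using AB(2) by (simp add: arcs_in_def)
    moreover have "pt D' (i, t0) \<notin> C" using unchanged_outside_disk[OF R(4) out(2)] out(1) by simp
    ultimately obtain m :: int where m: "\<And>t. t \<in> {a1..b1} \<Longrightarrow> t + of_int m \<in> window t0"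
      using arc_shift[OF R(3,2)] True by metis
    then show ?thesis
      using lifts_eq[of s m t0 u m i b] lifts_eq[of u m t0 s m i b] su True by auto
  next
    case False
    then show ?thesis using lifts_other by auto
  qed
  then show ?thesis using 1 2 outer_passes_unchanged[OF R(4)] by simp
qed


section \<open>The corner of a kink\<close>

lemma nonpos_Reals_add_nonneg:
  fixes z :: complex
  assumes "z \<notin> \<real>\<^sub>\<le>\<^sub>0" "p \<ge> 0"
  shows "of_real p + z \<notin> \<real>\<^sub>\<le>\<^sub>0"
  using assms by (auto simp: complex_nonpos_Reals_iff)

lemma nonpos_Reals_scale:
  fixes z :: complex
  assumes "z \<notin> \<real>\<^sub>\<le>\<^sub>0" "p > 0"
  shows "of_real p * z \<notin> \<real>\<^sub>\<le>\<^sub>0"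
  using assms by (auto simp: complex_nonpos_Reals_iff mult_le_0_iff)

text \<open>
  The quotient \<open>w / k t\<close> stays off the closed negative half-axis near both ends of the interval, and
  adding a nonnegative number or multiplying by a positive one does not spoil this.  Away from the ends
  the first summand dominates for small \<open>\<epsilon>\<close>.
\<close>

lemma avoid_slit:
  fixes k :: "real \<Rightarrow> complex"
  assumes "s < u" and k: "continuous_on {s..u} k" "\<And>t. t \<in> {s..u} \<Longrightarrow> k t \<noteq> 0"
    and ends: "w0 / k s \<notin> \<real>\<^sub>\<le>\<^sub>0" "w0 / k u \<notin> \<real>\<^sub>\<le>\<^sub>0"
  shows "\<exists>d>0. \<forall>\<epsilon> w. 0 < \<epsilon> \<and> \<epsilon> < d \<and> cmod (w - w0) < d \<longrightarrow>
     (\<forall>t\<in>{s..u}. of_real ((t - s) * (u - t)) + of_real \<epsilon> * (w / k t) \<notin> \<real>\<^sub>\<le>\<^sub>0)"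
proof -
  have near: "\<exists>d>0. \<forall>t w. t \<in> {s..u} \<and> \<bar>t - c\<bar> < d \<and> cmod (w - w0) < d \<longrightarrow> w / k t \<notin> \<real>\<^sub>\<le>\<^sub>0"
    if c: "c \<in> {s..u}" "w0 / k c \<notin> \<real>\<^sub>\<le>\<^sub>0" for c
  proof -
    have "continuous_on ({s..u} \<times> UNIV) (\<lambda>x. snd x / k (fst x))"
      using k by (intro continuous_intros continuous_on_compose2[OF k(1)]) auto
    moreover have "open (- \<real>\<^sub>\<le>\<^sub>0 :: complex set)" by (simp add: open_Compl)
    ultimately obtain A where A: "open A"
      "A \<inter> ({s..u} \<times> UNIV) = (\<lambda>x. snd x / k (fst x)) -` (- \<real>\<^sub>\<le>\<^sub>0) \<inter> ({s..u} \<times> UNIV)"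
      unfolding continuous_on_open_invariant by blast
    have "(c, w0) \<in> A" using A(2) c by auto
    then obtain P Q where PQ: "open P" "open Q" "c \<in> P" "w0 \<in> Q" "P \<times> Q \<subseteq> A"
      using A(1) by (metis open_prod_elim mem_Sigma_iff)
    obtain d1 where d1: "d1 > 0" "ball c d1 \<subseteq> P" using PQ openE by blast
    obtain d2 where d2: "d2 > 0" "ball w0 d2 \<subseteq> Q" using PQ openE by blast
    show ?thesis
    proof (intro exI[of _ "min d1 d2"] conjI allI impI)
      fix t w assume *: "t \<in> {s..u} \<and> \<bar>t - c\<bar> < min d1 d2 \<and> cmod (w - w0) < min d1 d2"
      then have "t \<in> ball c d1" "w \<in> ball w0 d2" by (auto simp: dist_norm norm_minus_commute)
      then have "(t, w) \<in> A \<inter> ({s..u} \<times> UNIV)" using d1 d2 PQ * by blast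
      then show "w / k t \<notin> \<real>\<^sub>\<le>\<^sub>0" unfolding A(2) by simp
    qed (use d1 d2 in auto)
  qed
  obtain d1 where d1: "d1 > 0" "\<And>t w. t \<in> {s..u} \<Longrightarrow> \<bar>t - s\<bar> < d1 \<Longrightarrow> cmod (w - w0) < d1 \<Longrightarrow> w / k t \<notin> \<real>\<^sub>\<le>\<^sub>0"
    using near[of s] ends assms(1) by auto
  obtain d2 where d2: "d2 > 0" "\<And>t w. t \<in> {s..u} \<Longrightarrow> \<bar>t - u\<bar> < d2 \<Longrightarrow> cmod (w - w0) < d2 \<Longrightarrow> w / k t \<notin> \<real>\<^sub>\<le>\<^sub>0"
    using near[of u] ends assms(1) by auto
  define e where "e = min d1 d2"
  have e: "e > 0" using d1 d2 by (simp add: e_def)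
  have "compact ((\<lambda>t. inverse (k t)) ` {s..u})"
    using k by (intro compact_continuous_image continuous_intros) auto
  then obtain B where B: "B > 0" "\<And>t. t \<in> {s..u} \<Longrightarrow> cmod (inverse (k t)) \<le> B"
    by (metis (no_types, lifting) bounded_pos compact_imp_bounded imageI)
  define M where "M = (cmod w0 + 1) * B"
  have M: "M > 0" using B by (simp add: M_def add_nonneg_pos)
  define d where "d = min (min e 1) (e * e / M)"
  show ?thesis
  proof (intro exI[of _ d] conjI allI impI ballI)
    show "d > 0" using e M by (simp add: d_def)
    fix \<epsilon> w t assume *: "0 < \<epsilon> \<and> \<epsilon> < d \<and> cmod (w - w0) < d" and t: "t \<in> {s..u}"
    show "of_real ((t - s) * (u - t)) + of_real \<epsilon> * (w / k t) \<notin> \<real>\<^sub>\<le>\<^sub>0"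
    proof (cases "\<bar>t - s\<bar> < e \<or> \<bar>t - u\<bar> < e")
      case True
      then have "w / k t \<notin> \<real>\<^sub>\<le>\<^sub>0" using d1(2)[of t w] d2(2)[of t w] t * by (auto simp: d_def e_def)
      then show ?thesis using t * by (intro nonpos_Reals_add_nonneg nonpos_Reals_scale) auto
    next
      case False
      then have "e \<le> t - s" "e \<le> u - t" using t by auto
      then have le: "e * e \<le> (t - s) * (u - t)" using e by (intro mult_mono) auto
      have "cmod w \<le> cmod w0 + cmod (w - w0)" by (metis add.commute diff_add_cancel norm_triangle_ineq)
      then have "cmod w \<le> cmod w0 + 1" using * by (auto simp: d_def)
      then have "cmod (w / k t) \<le> M"
        unfolding M_def divide_inverse norm_mult using B(2)[OF t] by (intro mult_mono) auto
      then have "cmod (of_real \<epsilon> * (w / k t)) \<le> \<epsilon> * M" using *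
        by (simp add: norm_mult norm_divide mult_left_mono flip: times_divide_eq_right)
      also have "\<dots> < e * e" using * M by (auto simp: d_def pos_less_divide_eq)
      finally have "\<bar>Re (of_real \<epsilon> * (w / k t))\<bar> < e * e" using abs_Re_le_cmod le_less_trans by blast
      then have "Re (of_real ((t - s) * (u - t)) + of_real \<epsilon> * (w / k t)) > 0" using le by simp
      then show ?thesis by (simp only: complex_nonpos_Reals_iff) simp
    qed
  qed
qed

lemma subpath_arg:
  fixes s u t :: real
  assumes "s < u" "0 \<le> t" "t \<le> 1"
  shows "(u - s) * t + s \<in> {s..u}"
proof -
  have "0 \<le> (u - s) * t" "(u - s) * t \<le> (u - s) * 1" using assms by (simp, intro mult_left_mono) auto
  then show ?thesis by simp
qed

lemma path_subpath_interval:
  fixes g :: "real \<Rightarrow> 'a::real_normed_vector"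
  assumes "continuous_on {s..u} g" "s < u"
  shows "path (subpath s u g)"
  unfolding path_def subpath_def
  using subpath_arg[OF assms(2)]
  by (intro continuous_on_compose2[OF assms(1)] continuous_intros) auto

text \<open>
  With \<open>k t = (g t - P) / ((t - s) * (u - t))\<close>, the loop \<open>g\<close> seen from \<open>P - \<epsilon> * w\<close> is the product
  of \<open>k\<close>, which has a logarithm \<open>l\<close>, and of a function avoiding the negative half-axis, for which
  \<open>Ln\<close> serves.  The winding number is the increment of the sum of the two logarithms.
\<close>

lemma winding_near_corner:
  fixes g k l :: "real \<Rightarrow> complex"
  assumes su: "s < u" and g: "continuous_on {s..u} g" "g s = P" "g u = P"
    and k: "\<And>t. t \<in> {s..u} \<Longrightarrow> g t - P = k t * of_real ((t - s) * (u - t))"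
    and l: "continuous_on {s..u} l" "\<And>t. t \<in> {s..u} \<Longrightarrow> k t = exp (l t)"
    and av: "\<And>t. t \<in> {s..u} \<Longrightarrow> of_real ((t - s) * (u - t)) + of_real \<epsilon> * (w / k t) \<notin> \<real>\<^sub>\<le>\<^sub>0"
    and z: "z = P - of_real \<epsilon> * w"
  shows "z \<notin> path_image (subpath s u g)"
    "winding_number (subpath s u g) z =
       (l u - l s + Ln (of_real \<epsilon> * (w / k u)) - Ln (of_real \<epsilon> * (w / k s))) / (2 * of_real pi * \<i>)"
proof -
  define m where "m t = of_real ((t - s) * (u - t)) + of_real \<epsilon> * (w / k t)" for t
  have kn: "k t \<noteq> 0" if "t \<in> {s..u}" for t using l(2)[OF that] by simp
  have gz: "g t - z = k t * m t" if "t \<in> {s..u}" for t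
    using k[OF that] kn[OF that] by (simp add: m_def z algebra_simps)
  have m: "m t \<notin> \<real>\<^sub>\<le>\<^sub>0" if "t \<in> {s..u}" for t using av[OF that] by (simp add: m_def)
  then have mn: "m t \<noteq> 0" if "t \<in> {s..u}" for t using that by (metis nonpos_Reals_zero_I)
  show z_out: "z \<notin> path_image (subpath s u g)"
  proof
    assume "z \<in> path_image (subpath s u g)"
    then obtain t where t: "t \<in> {s..u}" "z = g t" using su by (auto simp: path_image_subpath)
    then show False using gz[OF t(1)] kn[OF t(1)] mn[OF t(1)] by simp
  qed
  have k_cont: "continuous_on {s..u} k" 
    by (rule continuous_on_eq[OF continuous_on_exp[OF l(1)]]) (simp add: l(2))
  have m_cont: "continuous_on {s..u} m"
    unfolding m_def using kn by (intro continuous_intros k_cont) auto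
  define q where "q t = l t + Ln (m t)" for t
  have q_cont: "continuous_on {s..u} q"
    unfolding q_def using m by (intro continuous_intros l m_cont) auto
  have in_su: "(u - s) * t + s \<in> {s..u}" if "0 \<le> t" "t \<le> 1" for t
    by (rule subpath_arg[OF su that])
  have pq: "path (subpath s u q)" by (rule path_subpath_interval[OF q_cont su])
  have "winding_number (subpath s u g) z = winding_number (\<lambda>t. subpath s u g t - z) 0"
    by (rule winding_number_offset)
  also have "\<dots> = winding_number (exp \<circ> subpath s u q) 0"
  proof (rule winding_number_cong)
    fix t :: real assume "0 \<le> t" "t \<le> 1"
    from in_su[OF this] show "subpath s u g t - z = (exp \<circ> subpath s u q) t"
      using gz l(2) mn by (simp add: subpath_def q_def exp_add)
  qed
  also have "\<dots> = (pathfinish (subpath s u q) - pathstart (subpath s u q)) / (2 * of_real pi * \<i>)"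
    by (rule winding_number_compose_exp[OF pq])
  also have "\<dots> = (q u - q s) / (2 * of_real pi * \<i>)" by simp
  finally show "winding_number (subpath s u g) z =
       (l u - l s + Ln (of_real \<epsilon> * (w / k u)) - Ln (of_real \<epsilon> * (w / k s))) / (2 * of_real pi * \<i>)"
    by (simp add: q_def m_def)
qed

lemma Im_Ln_bounds:
  "Im z > 0 \<Longrightarrow> 0 < Im (Ln z) \<and> Im (Ln z) < pi" "Im z < 0 \<Longrightarrow> - pi < Im (Ln z) \<and> Im (Ln z) < 0"
proof -
  assume "Im z > 0"
  then show "0 < Im (Ln z) \<and> Im (Ln z) < pi" by (rule Im_Ln_pos_lt_imp)
next
  assume z: "Im z < 0"
  then have z0: "z \<noteq> 0" by auto
  have "\<not> 0 \<le> Im (Ln z)" using Im_Ln_pos_le[OF z0] z Im_Ln_le_pi[OF z0] by auto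
  then show "- pi < Im (Ln z) \<and> Im (Ln z) < 0" using mpi_less_Im_Ln[OF z0] by auto
qed

lemma Im_Ln_right: "Re z > 0 \<Longrightarrow> \<bar>Im (Ln z)\<bar> < pi / 2"
  by (rule Re_Ln_pos_lt_imp)

lemma Ln_scale: "p > 0 \<Longrightarrow> z \<noteq> 0 \<Longrightarrow> Im (Ln (of_real p * z)) = Im (Ln z)"
  using Ln_times_of_real[of p z] by simp

lemma difference_quotient_tendsto:
  fixes g :: "real \<Rightarrow> complex"
  assumes "(g has_vector_derivative v) (at c)"
  shows "((\<lambda>t. (g t - g c) / of_real (t - c)) \<longlongrightarrow> v) (at c)"
proof -
  have "((\<lambda>t. (g t - g c - (t - c) *\<^sub>R v) /\<^sub>R norm (t - c)) \<longlongrightarrow> 0) (at c)"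
    using assms unfolding has_vector_derivative_def has_derivative_within
    by (simp add: diff_diff_eq inverse_eq_divide)
  then have "((\<lambda>t. norm ((g t - g c - (t - c) *\<^sub>R v) /\<^sub>R norm (t - c))) \<longlongrightarrow> 0) (at c)"
    by (rule tendsto_norm_zero)
  moreover have "norm ((g t - g c - (t - c) *\<^sub>R v) /\<^sub>R norm (t - c)) = norm ((g t - g c) / of_real (t - c) - v)"
    if "t \<noteq> c" for t
  proof -
    have "(g t - g c) / of_real (t - c) - v = (g t - g c - (t - c) *\<^sub>R v) / of_real (t - c)"
      using that by (simp add: scaleR_conv_of_real diff_divide_distrib)
    then show ?thesis
      by (simp only: norm_divide norm_scaleR norm_of_real) (simp add: divide_inverse mult.commute)
  qed
  then have "eventually (\<lambda>t. norm ((g t - g c - (t - c) *\<^sub>R v) /\<^sub>R norm (t - c)) = norm ((g t - g c) / of_real (t - c) - v)) (at c)"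
    by (simp add: eventually_at_filter)
  ultimately have "((\<lambda>t. norm ((g t - g c) / of_real (t - c) - v)) \<longlongrightarrow> 0) (at c)"
    by (simp only: tendsto_cong)
  then show ?thesis by (rule Lim_null[THEN iffD2, OF tendsto_norm_zero_cancel])
qed

text \<open>
  Points just behind the corner \<open>P\<close> on the incoming strand, and points in the convex sector of the
  corner, are both of the form \<open>P - \<epsilon> * x\<close>.  Their winding numbers come from the same logarithm, so the
  difference consists of a few arguments \<open>Im (Ln _)\<close>.  The sign of the corner tells in which half-plane
  each of these lies, which confines the integer difference to a single value.
\<close>

lemma corner_winding:
  fixes g :: "real \<Rightarrow> complex"
  assumes su: "s < u" and g: "continuous_on {s..u} g" "g s = P" "g u = P"
    "\<And>t. s < t \<Longrightarrow> t < u \<Longrightarrow> g t \<noteq> P"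
    and d: "(g has_vector_derivative v) (at s)" "(g has_vector_derivative w) (at u)"
    and det: "det2 v w \<noteq> 0"
  shows "\<exists>d>0. \<forall>\<epsilon> v'. 0 < \<epsilon> \<and> \<epsilon> < d \<and> cmod (v' - v) < d \<longrightarrow>
     P - of_real \<epsilon> * v' \<notin> path_image (subpath s u g) \<longrightarrow>
     (\<exists>z. z \<notin> path_image (subpath s u g) \<and>
     winding_number (subpath s u g) z =
        winding_number (subpath s u g) (P - of_real \<epsilon> * v') - of_real (sgn (det2 v w)))"
proof -
  have v0: "v \<noteq> 0" and w0: "w \<noteq> 0" using det by (auto simp: det2_def)
  define k where "k t = (if t = s then v / of_real (u - s) else if t = u then - w / of_real (u - s)
     else (g t - P) / of_real ((t - s) * (u - t)))" for t
  have kn: "k t \<noteq> 0" if "t \<in> {s..u}" for t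
    using that su v0 w0 g(4)[of t] by (auto simp: k_def)
  have keq: "g t - P = k t * of_real ((t - s) * (u - t))" if "t \<in> {s..u}" for t
    using that g su by (auto simp: k_def)
  have k_cont: "continuous_on {s..u} k"
    unfolding continuous_on_def
  proof
    fix c assume "c \<in> {s..u}"
    then consider "c = s" | "c = u" | "c \<in> {s<..<u}" by fastforce
    then show "(k \<longlongrightarrow> k c) (at c within {s..u})"
    proof cases
      case 1
      have "((\<lambda>t. (g t - g s) / of_real (t - s) / of_real (u - t)) \<longlongrightarrow> v / of_real (u - s)) (at s within {s..u})"
        using su by (intro tendsto_intros tendsto_within_subset[OF difference_quotient_tendsto[OF d(1)]]) auto
      moreover have "eventually (\<lambda>t. t < u) (at s within {s..u})"
        using su order_tendstoD(2)[OF tendsto_ident_at] by blast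
      then have "eventually (\<lambda>t. (g t - g s) / of_real (t - s) / of_real (u - t) = k t) (at s within {s..u})"
        unfolding eventually_at_filter by eventually_elim (auto simp: k_def g)
      ultimately have "(k \<longlongrightarrow> v / of_real (u - s)) (at c within {s..u})"
        unfolding 1 by (rule Lim_transform_eventually)
      moreover have "k c = v / of_real (u - s)" using 1 su by (simp add: k_def)
      ultimately show ?thesis by simp
    next
      case 2
      have "((\<lambda>t. - ((g t - g u) / of_real (t - u)) / of_real (t - s)) \<longlongrightarrow> - w / of_real (u - s)) (at u within {s..u})"
        using su by (intro tendsto_intros tendsto_within_subset[OF difference_quotient_tendsto[OF d(2)]]) auto
      moreover have "eventually (\<lambda>t. s < t) (at u within {s..u})"
        using su order_tendstoD(1)[OF tendsto_ident_at] by blast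
      then have "eventually (\<lambda>t. - ((g t - g u) / of_real (t - u)) / of_real (t - s) = k t) (at u within {s..u})"
        unfolding eventually_at_filter
      proof eventually_elim
        case (elim t)
        have "- (x / (t' - u')) / (t' - s') = x / ((t' - s') * (u' - t'))" for x t' u' s' :: complex
          by (metis (no_types, opaque_lifting) divide_divide_eq_left' minus_diff_eq minus_divide_right)
        with elim show ?case by (auto simp: k_def g)
      qed
      ultimately have "(k \<longlongrightarrow> - w / of_real (u - s)) (at c within {s..u})"
        unfolding 2 by (rule Lim_transform_eventually)
      moreover have "k c = - w / of_real (u - s)" using 2 su by (simp add: k_def)
      ultimately show ?thesis by simp
    next
      case 3
      have "(g \<longlongrightarrow> g c) (at c within {s..u})" using 3 g(1) by (simp add: continuous_on_def)
      then have "((\<lambda>t. (g t - P) / of_real ((t - s) * (u - t))) \<longlongrightarrow> k c) (at c within {s..u})"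
        using 3 by (auto simp: k_def intro!: tendsto_eq_intros)
      moreover have "eventually (\<lambda>t. s < t) (at c within {s..u})" "eventually (\<lambda>t. t < u) (at c within {s..u})"
        using 3 order_tendstoD[OF tendsto_ident_at[of c "{s..u}"]] by auto
      then have "eventually (\<lambda>t. (g t - P) / of_real ((t - s) * (u - t)) = k t) (at c within {s..u})"
        by eventually_elim (simp add: k_def)
      ultimately show ?thesis by (rule Lim_transform_eventually)
    qed
  qed
  obtain l where l: "continuous_on {s..u} l" "\<And>t. t \<in> {s..u} \<Longrightarrow> k t = exp (l t)"
    using continuous_logarithm_on_contractible[OF k_cont convex_imp_contractible kn] by auto
  define W where "W = winding_number (subpath s u g)"
  define A where "A = Im (l u) - Im (l s)"
  have ku: "x / k u = of_real (u - s) * (- x / w)" and ks: "x / k s = of_real (u - s) * (x / v)" for x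
    using su by (simp_all add: k_def)
  have path: "path (subpath s u g)" "pathfinish (subpath s u g) = pathstart (subpath s u g)"
    using path_subpath_interval[OF g(1) su] g by simp_all
  have formula: "P - of_real \<epsilon> * x \<notin> path_image (subpath s u g)"
      "2 * pi * Re (W (P - of_real \<epsilon> * x)) = A + Im (Ln (- x / w)) - Im (Ln (x / v))"
      "W (P - of_real \<epsilon> * x) \<in> \<int>"
    if av: "\<And>t. t \<in> {s..u} \<Longrightarrow> of_real ((t - s) * (u - t)) + of_real \<epsilon> * (x / k t) \<notin> \<real>\<^sub>\<le>\<^sub>0"
      and x: "x \<noteq> 0" and e: "\<epsilon> > 0" for \<epsilon> x
  proof -
    note N = winding_near_corner[OF su g(1-3) keq l av refl]
    show 1: "P - of_real \<epsilon> * x \<notin> path_image (subpath s u g)" by (rule N(1))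
    show "W (P - of_real \<epsilon> * x) \<in> \<int>"
      unfolding W_def by (rule integer_winding_number[OF path 1])
    have nz: "x / v \<noteq> 0" "- x / w \<noteq> 0" and pos: "\<epsilon> * (u - s) > 0" using x v0 w0 e su by auto
    have "Im (Ln (of_real \<epsilon> * (x / k u))) = Im (Ln (- x / w))"
      "Im (Ln (of_real \<epsilon> * (x / k s))) = Im (Ln (x / v))"
      unfolding ku ks mult.assoc[symmetric] of_real_mult[symmetric]
      by (rule Ln_scale[OF pos nz(2)], rule Ln_scale[OF pos nz(1)])
    moreover have "2 * pi * Re (X / (2 * of_real pi * \<i>)) = Im X" for X
      by (simp add: Re_divide power2_eq_square)
    moreover have "W (P - of_real \<epsilon> * x) =
       (l u - l s + Ln (of_real \<epsilon> * (x / k u)) - Ln (of_real \<epsilon> * (x / k s))) / (2 * of_real pi * \<i>)"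
      unfolding W_def by (rule N(2))
    ultimately show "2 * pi * Re (W (P - of_real \<epsilon> * x)) = A + Im (Ln (- x / w)) - Im (Ln (x / v))"
      by (simp only: A_def minus_complex.sel plus_complex.sel)
  qed
  define D where "D = det2 v w"
  have D: "D \<noteq> 0" using det by (simp add: D_def)
  have Imq: "Im (v / w) = - D / (cmod w)\<^sup>2" "Im (w / v) = D / (cmod v)\<^sup>2"
    by (simp_all add: Im_divide D_def det2_def cmod_power2)
  have Imnz: "Im (v / w) \<noteq> 0" "Im (w / v) \<noteq> 0" using D v0 w0 by (auto simp: Imq)
  have slit: "x \<notin> \<real>\<^sub>\<le>\<^sub>0" if "Im x \<noteq> 0" for x using that by (auto simp: complex_nonpos_Reals_iff)
  have us: "u - s > 0" using su by simp
  have "v / k s \<notin> \<real>\<^sub>\<le>\<^sub>0" "v / k u \<notin> \<real>\<^sub>\<le>\<^sub>0"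
  proof -
    have "- v / w \<notin> \<real>\<^sub>\<le>\<^sub>0" using Imnz(1) by (intro slit) (simp del: Im_divide)
    moreover have "v / v \<notin> \<real>\<^sub>\<le>\<^sub>0" using v0 by simp
    ultimately show "v / k s \<notin> \<real>\<^sub>\<le>\<^sub>0" "v / k u \<notin> \<real>\<^sub>\<le>\<^sub>0"
      unfolding ku ks by - (rule nonpos_Reals_scale[OF _ us], assumption)+
  qed
  then obtain d1 where d1: "d1 > 0" "\<And>\<epsilon> x t. 0 < \<epsilon> \<Longrightarrow> \<epsilon> < d1 \<Longrightarrow> cmod (x - v) < d1 \<Longrightarrow> t \<in> {s..u} \<Longrightarrow>
      of_real ((t - s) * (u - t)) + of_real \<epsilon> * (x / k t) \<notin> \<real>\<^sub>\<le>\<^sub>0"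
    using avoid_slit[OF su k_cont kn, of v] by meson
  have q: "(w - v) / v = w / v - 1" "- (w - v) / w = v / w - 1"
    using v0 w0 by (simp_all add: field_simps)
  have "(w - v) / k s \<notin> \<real>\<^sub>\<le>\<^sub>0" "(w - v) / k u \<notin> \<real>\<^sub>\<le>\<^sub>0"
  proof -
    have "v / w - 1 \<notin> \<real>\<^sub>\<le>\<^sub>0" "w / v - 1 \<notin> \<real>\<^sub>\<le>\<^sub>0" using Imnz by (intro slit; simp)+
    then show "(w - v) / k s \<notin> \<real>\<^sub>\<le>\<^sub>0" "(w - v) / k u \<notin> \<real>\<^sub>\<le>\<^sub>0"
      unfolding ku ks q by - (rule nonpos_Reals_scale[OF _ us], assumption)+
  qed
  then obtain d2 where d2: "d2 > 0" "\<And>\<epsilon> x t. 0 < \<epsilon> \<Longrightarrow> \<epsilon> < d2 \<Longrightarrow> cmod (x - (w - v)) < d2 \<Longrightarrow> t \<in> {s..u} \<Longrightarrow>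
      of_real ((t - s) * (u - t)) + of_real \<epsilon> * (x / k t) \<notin> \<real>\<^sub>\<le>\<^sub>0"
    using avoid_slit[OF su k_cont kn, of "w - v"] by meson
  \<comment> \<open>the last two bounds keep \<open>v'\<close> in the half-planes of \<open>v\<close> as seen from \<open>v\<close> and from \<open>w\<close>\<close>
  define d where "d = min (min d1 d2) (min (cmod v) (cmod w * \<bar>Im (v / w)\<bar>))"
  have dpos: "d > 0" using d1 d2 v0 w0 Imnz by (simp add: d_def del: Im_divide)
  show ?thesis
  proof (intro exI[of _ d] conjI allI impI dpos)
    fix \<epsilon> v' assume e: "0 < \<epsilon> \<and> \<epsilon> < d \<and> cmod (v' - v) < d"
    then have e': "0 < \<epsilon>" "\<epsilon> < d1" "\<epsilon> < d2" "cmod (v' - v) < d1" "cmod (v' - v) < cmod v"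
      "cmod (v' - v) < cmod w * \<bar>Im (v / w)\<bar>" by (simp_all only: d_def min_less_iff_conj)
    have v'0: "v' \<noteq> 0" using e'(5) by auto
    have wv: "w - v \<noteq> 0" using D by (auto simp: D_def det2_def)
    note F1 = formula[OF d1(2)[OF e'(1,2,4)] v'0 e'(1)]
    have "cmod (v - v) < d1" using d1 by simp
    note F2 = formula[OF d1(2)[OF e'(1,2) this] v0 e'(1)]
    have "cmod (w - v - (w - v)) < d2" using d2 by simp
    note F3 = formula[OF d2(2)[OF e'(1,3) this] wv e'(1)]
    have right: "\<bar>Im (Ln (v' / v))\<bar> < pi / 2"
    proof (rule Im_Ln_right)
      have "cmod (v' / v - 1) < 1"
        using e'(5) v0 by (metis diff_divide_distrib divide_less_eq_1_pos divide_self norm_divide zero_less_norm_iff)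
      then have "\<bar>Re (v' / v - 1)\<bar> < 1" using abs_Re_le_cmod le_less_trans by blast
      then show "Re (v' / v) > 0" by simp
    qed
    have "cmod (v' / w - v / w) < \<bar>Im (v / w)\<bar>"
      using e'(6) w0 by (simp add: norm_divide pos_divide_less_eq mult.commute flip: diff_divide_distrib)
    then have "\<bar>Im (v' / w - v / w)\<bar> < \<bar>Im (v / w)\<bar>" using abs_Im_le_cmod le_less_trans by blast
    then have side: "Im (v / w) > 0 \<Longrightarrow> Im (v' / w) > 0" "Im (v / w) < 0 \<Longrightarrow> Im (v' / w) < 0" by auto
    obtain n1 n2 n3 where n: "W (P - of_real \<epsilon> * v') = of_int n1" "W (P - of_real \<epsilon> * v) = of_int n2"
      "W (P - of_real \<epsilon> * (w - v)) = of_int n3" using F1(3) F2(3) F3(3) by (auto elim!: Ints_cases)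
    have vv: "Im (Ln (v / v)) = 0" using v0 by simp
    have E: "2 * pi * real_of_int n1 = A + Im (Ln (- v' / w)) - Im (Ln (v' / v))"
      "2 * pi * real_of_int n2 = A + Im (Ln (- v / w))"
      "2 * pi * real_of_int n3 = A + Im (Ln (v / w - 1)) - Im (Ln (w / v - 1))"
      using F1(2) F2(2) F3(2) unfolding n q vv by simp_all
    have "\<bar>Im (Ln (- v' / w)) - Im (Ln (- v / w))\<bar> < pi"
      using Im_Ln_bounds[of "- v' / w"] Im_Ln_bounds[of "- v / w"] side Imnz(1) 
      by (cases "Im (v / w) > 0") (auto simp del: Im_divide Im_complex_div_gt_0)
    then have "\<bar>2 * pi * real_of_int n1 - 2 * pi * real_of_int n2\<bar> < 2 * pi" using E right by linarith
    then have "\<bar>2 * pi * real_of_int (n1 - n2)\<bar> < 2 * pi * 1" by (simp add: right_diff_distrib)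
    then have "\<bar>real_of_int (n1 - n2)\<bar> < 1" by (simp add: abs_mult)
    then have n12: "n1 = n2" by linarith
    have "n3 - n2 = (if D > 0 then -1 else 1)"
    proof (cases "D > 0")
      case True
      then have "Im (v / w) < 0" "Im (w / v) > 0" using v0 w0 by (auto simp: Imq)
      then have "2 * pi * real_of_int n3 - 2 * pi * real_of_int n2 < 0"
        "2 * pi * real_of_int n3 - 2 * pi * real_of_int n2 > - 3 * pi"
        using E Im_Ln_bounds[of "v / w - 1"] Im_Ln_bounds[of "w / v - 1"] Im_Ln_bounds[of "- v / w"] by auto
      then have "pi * (2 * real_of_int (n3 - n2)) < pi * 0" "pi * (- 3) < pi * (2 * real_of_int (n3 - n2))"
        by (simp_all add: right_diff_distrib)
      then have "2 * real_of_int (n3 - n2) < 0" "- 3 < 2 * real_of_int (n3 - n2)"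
        by (simp_all only: mult_less_cancel_left_pos[OF pi_gt_zero])
      then have "real_of_int (n3 - n2) < real_of_int 0" "real_of_int (- 2) < real_of_int (n3 - n2)" by simp_all
      then have "n3 - n2 < 0" "- 2 < n3 - n2" by (simp_all only: of_int_less_iff)
      then have "n3 - n2 = - 1" by linarith
      then show ?thesis using True by (simp only: if_True)
    next
      case False
      then have "Im (v / w) > 0" "Im (w / v) < 0" using v0 w0 D by (auto simp: Imq divide_less_0_iff)
      then have "2 * pi * real_of_int n3 - 2 * pi * real_of_int n2 > 0"
        "2 * pi * real_of_int n3 - 2 * pi * real_of_int n2 < 3 * pi"
        using E Im_Ln_bounds[of "v / w - 1"] Im_Ln_bounds[of "w / v - 1"] Im_Ln_bounds[of "- v / w"] by auto
      then have "pi * 0 < pi * (2 * real_of_int (n3 - n2))" "pi * (2 * real_of_int (n3 - n2)) < pi * 3"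
        by (simp_all add: right_diff_distrib)
      then have "0 < 2 * real_of_int (n3 - n2)" "2 * real_of_int (n3 - n2) < 3"
        by (simp_all only: mult_less_cancel_left_pos[OF pi_gt_zero])
      then have "real_of_int 0 < real_of_int (n3 - n2)" "real_of_int (n3 - n2) < real_of_int 2" by simp_all
      then have "0 < n3 - n2" "n3 - n2 < 2" by (simp_all only: of_int_less_iff)
      then have "n3 - n2 = 1" by linarith
      then show ?thesis using False by (simp only: if_False)
    qed
    then have "real_of_int n3 = real_of_int n2 - sgn D"
      using D by (auto simp: sgn_if split: if_splits)
    then have "complex_of_real (real_of_int n3) = complex_of_real (real_of_int n2 - sgn D)" by simp
    then have "W (P - of_real \<epsilon> * (w - v)) = W (P - of_real \<epsilon> * v') - of_real (sgn D)"
      unfolding n n12 by simp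
    then show "\<exists>z. z \<notin> path_image (subpath s u g) \<and>
      winding_number (subpath s u g) z =
        winding_number (subpath s u g) (P - of_real \<epsilon> * v') - of_real (sgn (det2 v w))"
      using F3(1) unfolding W_def D_def by blast
  qed
qed

lemma curve_has_tangent:
  assumes "link_diagram D" "i < ncomp D"
  shows "(curve D i has_vector_derivative tangent D (i, t)) (at t)"
proof -
  have "smooth (curve D i)" using assms by (simp add: link_diagram_def)
  then have "curve D i differentiable (at t)" by cases auto
  then show ?thesis by (simp add: tangent_def vector_derivative_works)
qed

lemma curve_continuous: "link_diagram D \<Longrightarrow> i < ncomp D \<Longrightarrow> continuous_on A (curve D i)"
  by (intro continuous_at_imp_continuous_on ballI has_vector_derivative_continuous[OF curve_has_tangent])

lemma changing_disk_complement:
  assumes "changing_disk C D"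
  shows "connected (- C)"
proof -
  obtain f :: "complex \<Rightarrow> complex" where f: "smooth f" "inj_on f (cball 0 1)" "C = f ` cball 0 1"
    using assms unfolding changing_disk_def by blast
  have "continuous_on (cball 0 1) f"
    using f(1) smooth.cases differentiable_imp_continuous_within
    by (metis continuous_at_imp_continuous_on)
  then obtain h where "homeomorphism (cball 0 1) C f h"
    using homeomorphism_compact[of "cball 0 1" f C] f by auto
  then have "cball (0 :: complex) 1 homeomorphic C" unfolding homeomorphic_def by blast
  then have "C homeomorphic cball (0 :: complex) 1" by (rule homeomorphic_sym[THEN iffD1])
  then show ?thesis
    by (rule connected_complement_homeomorphic_convex_compact) simp_all
qed

lemma disk_complement_outside:
  fixes C K :: "complex set"
  assumes C: "connected (- C)" "bounded C" and K: "K \<subseteq> C"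
  shows "- C \<subseteq> outside K"
proof
  fix x assume x: "x \<in> - C"
  then have "- C \<subseteq> connected_component_set (- K) x"
    using C K by (intro connected_component_maximal) auto
  then show "x \<in> outside K"
    using x K cobounded_imp_unbounded[of "- C"] C bounded_subset by (auto simp: outside_def)
qed

text \<open>
  The strand entering a kink starts on the boundary of the disk and does not meet the loop, so
  it lies outside the loop.  Hence the convex sector of the corner is the inner side, and the
  winding number of the loop is read off from the crossing.
\<close>

lemma kink_orientation:
  assumes D: "link_diagram D" and C: "changing_disk C E" and arc: "arcs_in D C [(i, a, b)]"
    and su: "a < s" "s < u" "u < b" and cr: "crossing D (i, s) (i, u)"
    and dp: "double_points D \<inter> C = {curve D i s}"
    and rot: "loop_rotates r (subpath s u (curve D i))"
  shows "det2 (tangent D (i, s)) (tangent D (i, u)) > 0 \<longleftrightarrow> r = Clockwise"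
proof -
  define g where "g = curve D i"
  define P where "P = g s"
  define K where "K = path_image (subpath s u g)"
  have pa: "proper_arc D C (i, a, b)" using arc by (simp add: arcs_in_def)
  then have i: "i < ncomp D" and ab: "a < b" "b < a + 1" by auto
  have cl: "closed C" using changing_disk_compact[OF C] by (rule compact_imp_closed)
  have inC: "g t \<in> C" if "t \<in> {a..b}" for t using proper_arc_in[OF cl pa that] by (simp add: g_def)
  have gu: "g u = P" using crossing_pt[OF cr] by (simp add: pt_def g_def P_def)
  have cross: "crossing D (i, t) (i, t')" if "t \<in> {a..b}" "t' \<in> {a..b}" "t \<noteq> t'" "g t = g t'" for t t'
  proof -
    have "t - t' \<notin> \<int>"
    proof
      assume "t - t' \<in> \<int>"
      then obtain z where z: "t - t' = of_int z" by (auto elim: Ints_cases)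
      then have "\<bar>real_of_int z\<bar> < 1" using that ab by auto
      then have "z = 0" by linarith
      then show False using z that by simp
    qed
    then show ?thesis using that i by (simp add: crossing_def param_def pt_def g_def)
  qed
  have onlyP: "t = s \<or> t = u" if "t \<in> {a..b}" "g t = P" for t
  proof (rule ccontr)
    assume "\<not> ?thesis"
    then have "crossing D (i, s) (i, t)" "crossing D (i, t) (i, u)"
      using that su gu P_def by (intro cross; simp)+
    then show False using no_triple_point[OF D] cr by blast
  qed
  have inj: "g t \<noteq> g t'" if "t \<in> {a..<s}" "t' \<in> {s..u}" for t t'
  proof
    assume eq: "g t = g t'"
    then have "crossing D (i, t) (i, t')" using that su by (intro cross) auto
    then have "g t \<in> double_points D \<inter> C"
      using inC[of t] that su unfolding double_points_def by (force simp: pt_def g_def)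
    then have "g t = P" by (simp add: dp P_def g_def)
    then show False using onlyP[of t] that su by auto
  qed
  have cont: "continuous_on A g" for A using curve_continuous[OF D i] by (simp add: g_def)
  have K: "K = g ` {s..u}" using su by (simp add: K_def path_image_subpath)
  have compK: "compact K" unfolding K by (intro compact_continuous_image cont) simp
  have out_eq: "- C \<subseteq> outside K"
    using changing_disk_complement[OF C] compact_imp_bounded[OF changing_disk_compact[OF C]] inC su
    by (intro disk_complement_outside) (auto simp: K)
  have "g a \<in> outside K"
  proof (rule ccontr)
    assume "\<not> ?thesis"
    moreover have "g a \<notin> K" using inj[of a] su(1) unfolding K by fastforce
    ultimately have "g a \<in> inside K" using inside_Un_outside[of K] by blast
    moreover have "g a \<in> closure (- C)" using pa by (simp add: g_def frontier_closures)
    ultimately have "inside K \<inter> - C \<noteq> {}"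
      using open_Int_closure_eq_empty[OF open_inside[OF compact_imp_closed[OF compK]]] by blast
    then show False using out_eq inside_Int_outside[of K] by blast
  qed
  have out: "g t \<in> outside K" if "t \<in> {a..<s}" for t
  proof (rule outside_same_component[OF _ \<open>g a \<in> outside K\<close>])
    have "connected (g ` {a..<s})" by (intro connected_continuous_image cont) simp
    moreover have "g ` {a..<s} \<subseteq> - K" using inj by (auto simp: K)
    ultimately show "connected_component (- K) (g a) (g t)"
      unfolding connected_component_def using that su by (intro exI[of _ "g ` {a..<s}"]) auto
  qed
  define v where "v = tangent D (i, s)"
  define w where "w = tangent D (i, u)"
  have dv: "(g has_vector_derivative v) (at s)" "(g has_vector_derivative w) (at u)"
    using curve_has_tangent[OF D i] by (simp_all add: g_def v_def w_def)
  have det: "det2 v w \<noteq> 0" using D cr unfolding link_diagram_def v_def w_def by blast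
  have notP: "g t \<noteq> P" if "s < t" "t < u" for t using onlyP[of t] that su by auto
  obtain d where d: "d > 0" and near: "\<And>\<epsilon> v'. 0 < \<epsilon> \<Longrightarrow> \<epsilon> < d \<Longrightarrow> cmod (v' - v) < d \<Longrightarrow>
     P - of_real \<epsilon> * v' \<notin> K \<Longrightarrow> \<exists>z. z \<notin> K \<and> winding_number (subpath s u g) z =
        winding_number (subpath s u g) (P - of_real \<epsilon> * v') - of_real (sgn (det2 v w))"
    using corner_winding[OF su(2) cont _ gu notP dv det] unfolding P_def K_def by blast
  have "eventually (\<lambda>t. cmod ((g t - g s) / of_real (t - s) - v) < d) (at s)"
    using tendstoD[OF difference_quotient_tendsto[OF dv(1)] d] by (simp add: dist_norm)
  then obtain e where e: "e > 0" "\<And>t. t \<noteq> s \<Longrightarrow> \<bar>t - s\<bar> < e \<Longrightarrow> cmod ((g t - g s) / of_real (t - s) - v) < d"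
    unfolding eventually_at by (auto simp: dist_real_def)
  define \<epsilon> where "\<epsilon> = min (min d e) (s - a) / 2"
  have \<epsilon>: "\<epsilon> > 0" "\<epsilon> < d" "\<epsilon> < e" "\<epsilon> < s - a" using d e su by (auto simp: \<epsilon>_def)
  define v' where "v' = (g (s - \<epsilon>) - g s) / of_real (s - \<epsilon> - s)"
  have v': "cmod (v' - v) < d" unfolding v'_def by (rule e(2)) (use \<epsilon> in auto)
  have pt: "P - of_real \<epsilon> * v' = g (s - \<epsilon>)" using \<epsilon> by (simp add: v'_def P_def)
  have o: "g (s - \<epsilon>) \<in> outside K" by (rule out) (use \<epsilon> in auto)
  then have "g (s - \<epsilon>) \<notin> K" by (simp add: outside_def)
  then obtain z where z: "z \<notin> K" "winding_number (subpath s u g) z =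
        winding_number (subpath s u g) (g (s - \<epsilon>)) - of_real (sgn (det2 v w))"
    using near[OF \<epsilon>(1,2) v'] unfolding pt by blast
  have path: "path (subpath s u g)" "pathfinish (subpath s u g) = pathstart (subpath s u g)"
    using path_subpath_interval[OF cont su(2)] gu by (simp_all add: P_def)
  have wz: "winding_number (subpath s u g) z = - of_real (sgn (det2 v w))"
    using z(2) winding_number_zero_in_outside[OF path] o by (simp add: K_def)
  have "z \<notin> outside K"
    using winding_number_zero_in_outside[OF path, of z] wz det by (auto simp: K_def sgn_if split: if_splits)
  then have "z \<in> inside K" using z(1) inside_Un_outside[of K] by blast
  then have "winding_number (subpath s u g) z = (if r = Clockwise then -1 else 1)"
    using rot by (cases r) (auto simp: K_def g_def)
  with wz det show ?thesis unfolding v_def[symmetric] w_def[symmetric]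
    by (auto simp: sgn_if split: if_splits)
qed


section \<open>The order of the contacts with two other components\<close>

text \<open>
  Along component \<open>i\<close>, cut open at a base point, consider its crossings with two other components.  A
  move of type 1 does not affect them, one of type 2 inserts two neighbouring crossings with the
  same component, but one of type 3 may exchange two neighbours with different components.  The
  parity of the number of inversions detects just this.
\<close>

fun contacts :: "diagram \<Rightarrow> nat \<times> real \<Rightarrow> nat \<Rightarrow> real set" where
  "contacts D (i, t0) j = {s \<in> window t0. \<exists>t. crossing D (i, s) (j, t)}"

definition inversions :: "real set \<Rightarrow> real set \<Rightarrow> (real \<times> real) set" where
  "inversions X Y = {(x, y). x \<in> X \<and> y \<in> Y \<and> x < y}"

lemma finite_inversions: "finite X \<Longrightarrow> finite Y \<Longrightarrow> finite (inversions X Y)"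
  by (rule finite_subset[of _ "X \<times> Y"]) (auto simp: inversions_def)

lemma even_inversions_add_left:
  assumes fin: "finite X" "finite Y" and x: "x \<noteq> x'" "x \<notin> X" "x' \<notin> X"
    and adj: "\<And>y. y \<in> Y \<Longrightarrow> x < y \<longleftrightarrow> x' < y"
  shows "even (card (inversions (X \<union> {x, x'}) Y)) = even (card (inversions X Y))"
proof -
  let ?Z = "{y \<in> Y. x < y}"
  have "inversions (X \<union> {x, x'}) Y = inversions X Y \<union> ({x, x'} \<times> ?Z)"
    using adj by (auto simp: inversions_def)
  moreover have "card (inversions X Y \<union> ({x, x'} \<times> ?Z)) = card (inversions X Y) + card ({x, x'} \<times> ?Z)"
    using fin x by (intro card_Un_disjoint finite_inversions finite_cartesian_product) (auto simp: inversions_def)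
  moreover have "card ({x, x'} \<times> ?Z) = 2 * card ?Z" using x by (simp add: card_cartesian_product)
  ultimately show ?thesis by simp
qed

lemma even_inversions_add_right:
  assumes fin: "finite X" "finite Y" and y: "y \<noteq> y'" "y \<notin> Y" "y' \<notin> Y"
    and adj: "\<And>x. x \<in> X \<Longrightarrow> x < y \<longleftrightarrow> x < y'"
  shows "even (card (inversions X (Y \<union> {y, y'}))) = even (card (inversions X Y))"
proof -
  let ?Z = "{x \<in> X. x < y}"
  have "inversions X (Y \<union> {y, y'}) = inversions X Y \<union> (?Z \<times> {y, y'})"
    using adj by (auto simp: inversions_def)
  moreover have "card (inversions X Y \<union> (?Z \<times> {y, y'})) = card (inversions X Y) + card (?Z \<times> {y, y'})"
    using fin y by (intro card_Un_disjoint finite_inversions finite_cartesian_product) (auto simp: inversions_def)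
  moreover have "card (?Z \<times> {y, y'}) = 2 * card ?Z" using y by (simp add: card_cartesian_product)
  ultimately show ?thesis by simp
qed

lemma card_inversions_insert:
  assumes fin: "finite X" "finite Y" and xy: "x \<in> {a..b}" "y \<in> {a..b}"
    and far: "X \<inter> {a..b} = {}" "Y \<inter> {a..b} = {}"
  shows "card (inversions (insert x X) (insert y Y)) =
     card (inversions X Y) + card {z \<in> Y. b < z} + card {z \<in> X. z < a} + of_bool (x < y)"
proof -
  have cmp: "x < z \<longleftrightarrow> b < z" if "z \<in> Y" for z
  proof -
    have "z \<notin> {a..b}" using that far(2) by blast
    then show ?thesis using xy by auto
  qed
  have cmp2: "z < y \<longleftrightarrow> z < a" if "z \<in> X" for z
  proof -
    have "z \<notin> {a..b}" using that far(1) by blast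
    then show ?thesis using xy by auto
  qed
  have nx: "x \<notin> X" "y \<notin> Y" using xy far by blast+
  have "inversions (insert x X) (insert y Y) =
     ((inversions X Y \<union> ({x} \<times> {z \<in> Y. b < z})) \<union> ({z \<in> X. z < a} \<times> {y})) \<union> (if x < y then {(x, y)} else {})"
    using cmp cmp2 by (auto simp: inversions_def)
  moreover have "card \<dots> = card ((inversions X Y \<union> ({x} \<times> {z \<in> Y. b < z})) \<union> ({z \<in> X. z < a} \<times> {y}))
     + card (if x < y then {(x, y)} else {})"
    using fin nx by (intro card_Un_disjoint finite_UnI finite_inversions finite_cartesian_product) (auto simp: inversions_def)
  moreover have "card ((inversions X Y \<union> ({x} \<times> {z \<in> Y. b < z})) \<union> ({z \<in> X. z < a} \<times> {y})) =
     card (inversions X Y \<union> ({x} \<times> {z \<in> Y. b < z})) + card ({z \<in> X. z < a} \<times> {y})"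
    using fin nx by (intro card_Un_disjoint finite_UnI finite_inversions finite_cartesian_product) (auto simp: inversions_def)
  moreover have "card (inversions X Y \<union> ({x} \<times> {z \<in> Y. b < z})) = card (inversions X Y) + card ({x} \<times> {z \<in> Y. b < z})"
    using fin nx by (intro card_Un_disjoint finite_UnI finite_inversions finite_cartesian_product) (auto simp: inversions_def)
  ultimately show ?thesis by (simp add: card_cartesian_product)
qed

lemma finite_contacts: "link_diagram D \<Longrightarrow> finite (contacts D p j)"
  by (cases p, rule finite_subset[OF _ finite_crossing_params[of D]]) auto

definition outer_contacts where
  "outer_contacts D C i t0 j = {s \<in> window t0. (\<exists>t. crossing D (i, s) (j, t) \<and> pt D (i, s) \<notin> C)}"

text \<open>
  The position in the window of a parameter modulo 1.
\<close>

definition lift1 :: "nat \<Rightarrow> real \<Rightarrow> nat \<times> real \<Rightarrow> real set" where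
  "lift1 i t0 p = {s \<in> window t0. same_param p (i, s)}"

definition inner_contacts where
  "inner_contacts L i t0 j = (\<Union>(p, q)\<in>L.
     (if fst q = j then lift1 i t0 p else {}) \<union> (if fst p = j then lift1 i t0 q else {}))"

lemma contacts_split:
  assumes D: "link_diagram D" and L: "disk_passes D C L"
  shows "contacts D (i, t0) j = outer_contacts D C i t0 j \<union> inner_contacts L i t0 j"
proof (rule set_eqI)
  fix s
  have 1: "\<exists>t. crossing D (i, s) (j, t)" "pt D (i, s) \<in> C"
    if "(p, q) \<in> L" "same_param p (i, s) \<and> fst q = j \<or> same_param q (i, s) \<and> fst p = j" for p q
  proof -
    have pq: "overpass D p q" "pt D p \<in> C"
      using L[unfolded disk_passes_def, rule_format, of p q] that(1) same_param_refl by fastforce+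
    then have c: "crossing D p q" "crossing D q p" using crossing_sym by (auto simp: overpass_def)
    then have pp: "param D p" "param D q" "pt D p = pt D q" by (simp_all add: crossing_def)
    from that(2) have "(\<exists>t. crossing D (i, s) (j, t)) \<and> pt D (i, s) \<in> C"
    proof
      assume "same_param p (i, s) \<and> fst q = j"
      then show ?thesis
        using crossing_cong[OF D c(1), of "(i, s)" q] pt_same_param[OF D pp(1), of "(i, s)"] pq
        by (metis prod.collapse same_param_refl)
    next
      assume "same_param q (i, s) \<and> fst p = j"
      then show ?thesis
        using crossing_cong[OF D c(2), of "(i, s)" p] pt_same_param[OF D pp(2), of "(i, s)"] pq pp(3)
        by (metis prod.collapse same_param_refl)
    qed
    then show "\<exists>t. crossing D (i, s) (j, t)" "pt D (i, s) \<in> C" by auto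
  qed
  have 2: "\<exists>(p, q) \<in> L. same_param p (i, s) \<and> fst q = j \<or> same_param q (i, s) \<and> fst p = j"
    if c: "crossing D (i, s) (j, t)" "pt D (i, s) \<in> C" for t
  proof -
    from c(1) crossing_overpass[OF D] consider "overpass D (i, s) (j, t)" | "overpass D (j, t) (i, s)" by blast
    then show ?thesis
    proof cases
      case 1
      then obtain p q where "(p, q) \<in> L" "same_param p (i, s)" "same_param q (j, t)"
        using L[unfolded disk_passes_def, rule_format, of "(i, s)" "(j, t)"] c(2) by blast
      then show ?thesis by (intro bexI[of _ "(p, q)"]) (auto simp: same_param_def)
    next
      case 2
      moreover have "pt D (j, t) \<in> C" using crossing_pt[OF c(1)] c(2) by simp
      ultimately obtain p q where "(p, q) \<in> L" "same_param p (j, t)" "same_param q (i, s)"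
        using L[unfolded disk_passes_def, rule_format, of "(j, t)" "(i, s)"] by blast
      then show ?thesis by (intro bexI[of _ "(p, q)"]) (auto simp: same_param_def)
    qed
  qed
  have in_inner: "s \<in> inner_contacts L i t0 j \<longleftrightarrow> s \<in> window t0 \<and>
      (\<exists>(p, q) \<in> L. same_param p (i, s) \<and> fst q = j \<or> same_param q (i, s) \<and> fst p = j)"
    by (force simp: inner_contacts_def lift1_def split_beta simp del: same_param_shift split: if_splits)
  show "s \<in> contacts D (i, t0) j \<longleftrightarrow> s \<in> outer_contacts D C i t0 j \<union> inner_contacts L i t0 j"
    unfolding Un_iff in_inner using 1 2 by (auto simp: outer_contacts_def simp del: same_param_shift) blast
qed

lemma outer_contacts_unchanged:
  assumes U: "unchanged_outside C D D'"
  shows "outer_contacts D' C i t0 j = outer_contacts D C i t0 j"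
proof -
  have "crossing D' (i, s) (j, t) \<and> pt D' (i, s) \<notin> C \<longleftrightarrow> crossing D (i, s) (j, t) \<and> pt D (i, s) \<notin> C" for s t
    using unchanged_outside_crossing[OF U] by blast
  then show ?thesis unfolding outer_contacts_def by simp
qed

lemma lift1_other: "fst p \<noteq> i \<Longrightarrow> lift1 i t0 p = {}"
  by (auto simp: lift1_def same_param_def)

lemma lift1_eq:
  assumes "p + of_int m \<in> window t0"
  shows "lift1 i t0 (i, p) = {p + of_int m}"
proof -
  have "lift1 i t0 (i, p) \<subseteq> {p + of_int m}"
  proof
    fix s assume "s \<in> lift1 i t0 (i, p)"
    then have s: "s \<in> window t0" "p - s \<in> \<int>" by (simp_all add: lift1_def)
    have "p + of_int m - s \<in> \<int>" using s(2) by (metis Ints_add Ints_of_int add.commute add_diff_eq)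
    then show "s \<in> {p + of_int m}" using window_eq[OF assms s(1)] by simp
  qed
  moreover have "p + of_int m \<in> lift1 i t0 (i, p)" using assms by (simp add: lift1_def)
  ultimately show ?thesis by blast
qed

lemma omega1_contacts:
  assumes R: "reidemeister_move (Omega1 e r) C D D'" and ij: "i \<noteq> j"
  shows "contacts D' (i, t0) j = contacts D (i, t0) j"
proof -
  note F = reidemeister_moveD[OF R]
  obtain A where A: "plain_arcs D C [A]" "kinked_arc e r D' C A"
    using R unfolding reidemeister_move_def local_move.simps by blast
  obtain k a b where Ak: "A = (k, a, b)" by (metis prod_cases3)
  obtain s u where L: "disk_passes D' C {if over D' (k, s) (k, u) then ((k, s), (k, u)) else ((k, u), (k, s))}"
    using kinked_arc_passes[OF F(2) A(2)[unfolded Ak]] by metis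
  have "inner_contacts {if over D' (k, s) (k, u) then ((k, s), (k, u)) else ((k, u), (k, s))} i t0 j = {}"
    using ij by (simp add: inner_contacts_def lift1_other)
  then show ?thesis
    using contacts_split[OF F(2) L] contacts_split[OF F(1) plain_arcs_passes[OF F(1) A(1)]]
      outer_contacts_unchanged[OF F(5)] by (simp add: inner_contacts_def)
qed

text \<open>
  If exactly one of the two arcs belongs to component \<open>i\<close>, then \<open>c\<close> is the component of the other and
  \<open>x\<close>, \<open>x'\<close> are the two new contacts; they lie in one arc, which has no other contact.  In all other
  cases nothing changes, and \<open>c = i\<close>.
\<close>

lemma omega2_contacts:
  assumes R: "reidemeister_move (Omega2 h) C D D'" and out: "pt D (i, t0) \<notin> C" "param D (i, t0)"
  obtains c x x' where "\<And>j. j \<noteq> i \<Longrightarrow> contacts D' (i, t0) j = contacts D (i, t0) j \<union> (if j = c then {x, x'} else {})"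
    "\<And>j y. c \<noteq> i \<Longrightarrow> y \<in> contacts D (i, t0) j \<Longrightarrow> y \<noteq> x \<and> y \<noteq> x' \<and> (x < y \<longleftrightarrow> x' < y) \<and> (y < x \<longleftrightarrow> y < x')"
    "c \<noteq> i \<Longrightarrow> x \<noteq> x'"
proof -
  note F = reidemeister_moveD[OF R]
  obtain A B where AB: "plain_arcs D C [A, B]" "bigon_arcs h D' C A B"
    using R unfolding reidemeister_move_def local_move.simps by blast
  obtain i1 a1 b1 j1 c1 d1 where A: "A = (i1, a1, b1)" and B: "B = (j1, c1, d1)"
    by (metis prod_cases3)
  obtain p p' q q' where p: "p \<in> {a1..b1}" "p' \<in> {a1..b1}" "q \<in> {c1..d1}" "q' \<in> {c1..d1}" "p \<noteq> p'" "q \<noteq> q'"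
    "arcs_in D' C [(i1, a1, b1), (j1, c1, d1)]"
    "disk_passes D' C {((i1, p), (j1, q)), ((i1, p'), (j1, q'))}"
    using bigon_arcs_passes[OF F(2)] AB(2) A B by metis
  have "arcs_in D C [A, B]" using AB(1) by (simp add: plain_arcs_def)
  then have pa: "proper_arc D C (i1, a1, b1)" "proper_arc D C (j1, c1, d1)"
    by (simp_all add: arcs_in_def A B)
  have D_contacts: "contacts D (i, t0) j = outer_contacts D C i t0 j" for j
    using contacts_split[OF F(1) plain_arcs_passes[OF F(1) AB(1)]] by (simp add: inner_contacts_def)
  have D'_contacts: "contacts D' (i, t0) j = contacts D (i, t0) j \<union>
     ((if j1 = j then lift1 i t0 (i1, p) \<union> lift1 i t0 (i1, p') else {}) \<union>
      (if i1 = j then lift1 i t0 (j1, q) \<union> lift1 i t0 (j1, q') else {}))" for j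
    unfolding D_contacts contacts_split[OF F(2) p(8)] outer_contacts_unchanged[OF F(5)]
    by (auto simp: inner_contacts_def)
  have avoid: "y \<noteq> x + of_int m \<and> y \<noteq> x' + of_int m \<and> (x + of_int m < y \<longleftrightarrow> x' + of_int m < y)
      \<and> (y < x + of_int m \<longleftrightarrow> y < x' + of_int m)"
    if arc: "proper_arc D C (i, a, b)" and xx: "x \<in> {a..b}" "x' \<in> {a..b}"
      and y: "y \<in> contacts D (i, t0) j" for a b x x' y j and m :: int
  proof -
    have "y - of_int m \<notin> {a..b}"
    proof
      assume "y - of_int m \<in> {a..b}"
      then have "curve D i (y - of_int m) \<in> C" by (rule proper_arc_in[OF F(3) arc])
      moreover have "curve D i (y - of_int m) = curve D i y"
        using curve_add_int[OF F(1), of i y "- m"] arc by simp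
      ultimately have "pt D (i, y) \<in> C" by (simp add: pt_def)
      then show False using y[unfolded D_contacts] by (simp add: outer_contacts_def)
    qed
    then show ?thesis using xx by auto
  qed
  consider "i1 = i" "j1 \<noteq> i" | "j1 = i" "i1 \<noteq> i" | "i1 = i" "j1 = i" | "i1 \<noteq> i" "j1 \<noteq> i" by blast
  then show ?thesis
  proof cases
    case 1
    obtain m :: int where m: "\<And>t. t \<in> {a1..b1} \<Longrightarrow> t + of_int m \<in> window t0"
      using arc_shift[OF F(3,1) pa(1)[unfolded 1] out(1)] by blast
    have l: "lift1 i t0 (i1, p) = {p + of_int m}" "lift1 i t0 (i1, p') = {p' + of_int m}"
      using m p 1 lift1_eq by simp_all
    show ?thesis
    proof (rule that[of j1 "p + of_int m" "p' + of_int m"])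
      show "contacts D' (i, t0) j = contacts D (i, t0) j \<union> (if j = j1 then {p + of_int m, p' + of_int m} else {})"
        if "j \<noteq> i" for j
        unfolding D'_contacts l using 1 that by auto
    qed (use p avoid[OF pa(1)[unfolded 1] p(1,2)] in auto)
  next
    case 2
    obtain m :: int where m: "\<And>t. t \<in> {c1..d1} \<Longrightarrow> t + of_int m \<in> window t0"
      using arc_shift[OF F(3,1) pa(2)[unfolded 2] out(1)] by blast
    have l: "lift1 i t0 (j1, q) = {q + of_int m}" "lift1 i t0 (j1, q') = {q' + of_int m}"
      using m p 2 lift1_eq by simp_all
    show ?thesis
    proof (rule that[of i1 "q + of_int m" "q' + of_int m"])
      show "contacts D' (i, t0) j = contacts D (i, t0) j \<union> (if j = i1 then {q + of_int m, q' + of_int m} else {})"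
        if "j \<noteq> i" for j
        unfolding D'_contacts l using 2 that by auto
    qed (use p avoid[OF pa(2)[unfolded 2] p(3,4)] in auto)
  next
    case 3
    show ?thesis
    proof (rule that[of i 0 0])
      show "contacts D' (i, t0) j = contacts D (i, t0) j \<union> (if j = i then {0, 0} else {})" if "j \<noteq> i" for j
        unfolding D'_contacts using 3 that by simp
    qed simp_all
  next
    case 4
    show ?thesis
    proof (rule that[of i 0 0])
      show "contacts D' (i, t0) j = contacts D (i, t0) j \<union> (if j = i then {0, 0} else {})" if "j \<noteq> i" for j
        unfolding D'_contacts using 4 that by (simp add: lift1_other)
    qed simp_all
  qed
qed

lemma omega2_inversions:
  assumes R: "reidemeister_move (Omega2 h) C D D'" and out: "pt D (i, t0) \<notin> C" "param D (i, t0)"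
    and ijk: "i \<noteq> j" "i \<noteq> k" "j \<noteq> k"
  shows "even (card (inversions (contacts D' (i, t0) j) (contacts D' (i, t0) k))) =
     even (card (inversions (contacts D (i, t0) j) (contacts D (i, t0) k)))"
proof -
  note F = reidemeister_moveD[OF R]
  obtain c x x' where c: "\<And>j. j \<noteq> i \<Longrightarrow> contacts D' (i, t0) j = contacts D (i, t0) j \<union> (if j = c then {x, x'} else {})"
    "\<And>j y. c \<noteq> i \<Longrightarrow> y \<in> contacts D (i, t0) j \<Longrightarrow> y \<noteq> x \<and> y \<noteq> x' \<and> (x < y \<longleftrightarrow> x' < y) \<and> (y < x \<longleftrightarrow> y < x')"
    "c \<noteq> i \<Longrightarrow> x \<noteq> x'"
    using omega2_contacts[OF R out] by metis
  note fin = finite_contacts[OF F(1)]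
  consider "c = j" | "c = k" | "c \<noteq> j" "c \<noteq> k" by blast
  then show ?thesis
  proof cases
    case 1
    have "even (card (inversions (contacts D (i, t0) j \<union> {x, x'}) (contacts D (i, t0) k))) =
     even (card (inversions (contacts D (i, t0) j) (contacts D (i, t0) k)))"
      using c(2)[of _ j] c(2)[of _ k] c(3) 1 ijk by (intro even_inversions_add_left fin) metis+
    then show ?thesis using c(1)[of j] c(1)[of k] 1 ijk by (simp del: contacts.simps)
  next
    case 2
    have "even (card (inversions (contacts D (i, t0) j) (contacts D (i, t0) k \<union> {x, x'}))) =
     even (card (inversions (contacts D (i, t0) j) (contacts D (i, t0) k)))"
      using c(2)[of _ j] c(2)[of _ k] c(3) 2 ijk by (intro even_inversions_add_right fin) metis+
    then show ?thesis using c(1)[of j] c(1)[of k] 2 ijk by (simp del: contacts.simps)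
  next
    case 3
    then show ?thesis using c(1)[of j] c(1)[of k] ijk by (simp del: contacts.simps)
  qed
qed

text \<open>
  All other contacts lie outside the arc of component \<open>i\<close>, so they compare in the same way with the
  old and the new positions, and only the pair of the two exchanged crossings counts.
\<close>

lemma omega3_inversions:
  assumes U: "link_diagram D" "link_diagram D'" "closed C" "unchanged_outside C D D'"
    and tr: "triangle_arcs e1 e2 e3 D C (i, a, b) (j, c, d) (k, e, f) tm tb mt mb bt bm"
      "triangle_arcs e1 e2 e3 D' C (i, a, b) (j, c, d) (k, e, f) tm' tb' mt' mb' bt' bm'"
    and flip: "tm < tb \<longleftrightarrow> tb' < tm'"
    and ijk: "i \<noteq> j" "i \<noteq> k" "j \<noteq> k" and out: "pt D (i, t0) \<notin> C"
  shows "even (card (inversions (contacts D' (i, t0) j) (contacts D' (i, t0) k))) \<noteq>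
     even (card (inversions (contacts D (i, t0) j) (contacts D (i, t0) k)))"
proof -
  note P = triangle_arcs_passes[OF U(1) tr(1)]
  note P' = triangle_arcs_passes[OF U(2) tr(2)]
  have pa: "proper_arc D C (i, a, b)" using P(7) by (simp add: arcs_in_def)
  obtain m :: int where m: "\<And>t. t \<in> {a..b} \<Longrightarrow> t + of_int m \<in> window t0"
    using arc_shift[OF U(3,1) pa out] by blast
  let ?X = "outer_contacts D C i t0 j" and ?Y = "outer_contacts D C i t0 k"
  have inner: "inner_contacts {((i, tm), (j, mt)), ((j, mb), (k, bm)), ((i, tb), (k, bt))} i t0 j = {tm + of_int m}"
    "inner_contacts {((i, tm), (j, mt)), ((j, mb), (k, bm)), ((i, tb), (k, bt))} i t0 k = {tb + of_int m}"
    if "tm \<in> {a..b}" "tb \<in> {a..b}" for tm mt mb bm tb bt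
    using ijk lift1_eq[OF m[OF that(1)], of i] lift1_eq[OF m[OF that(2)], of i]
    by (auto simp: inner_contacts_def lift1_other)
  have c: "contacts D (i, t0) j = insert (tm + of_int m) ?X" "contacts D (i, t0) k = insert (tb + of_int m) ?Y"
    unfolding contacts_split[OF U(1) P(8)] inner[OF P(1,2)] by simp_all
  have c': "contacts D' (i, t0) j = insert (tm' + of_int m) ?X" "contacts D' (i, t0) k = insert (tb' + of_int m) ?Y"
    unfolding contacts_split[OF U(2) P'(8)] inner[OF P'(1,2)] outer_contacts_unchanged[OF U(4)] by simp_all
  have fin: "finite ?X" "finite ?Y"
    using finite_contacts[OF U(1), of "(i, t0)"] c by (metis finite_insert)+
  have far: "outer_contacts D C i t0 l \<inter> {a + of_int m .. b + of_int m} = {}" for l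
  proof (rule equals0I)
    fix y assume y: "y \<in> outer_contacts D C i t0 l \<inter> {a + of_int m .. b + of_int m}"
    then have "curve D i (y - of_int m) \<in> C" by (intro proper_arc_in[OF U(3) pa]) auto
    moreover have "curve D i (y - of_int m) = curve D i y"
      using curve_add_int[OF U(1), of i y "- m"] pa by simp
    ultimately show False using y by (simp add: pt_def outer_contacts_def)
  qed
  have "tm' \<noteq> tb'"
  proof
    assume eq: "tm' = tb'"
    have 1: "crossing D' (i, tm') (j, mt')" and 2: "crossing D' (i, tb') (k, bt')"
      using tr(2) by simp_all
    have "crossing D' (j, mt') (k, bt')"
      using 1 2 eq ijk by (simp add: crossing_def)
    then show False using no_triple_point[OF U(2) 1 _ 2[folded eq]] by blast
  qed
  then have ne: "tm' < tb' \<longleftrightarrow> \<not> tm < tb" using flip by auto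
  have "card (inversions (contacts D (i, t0) j) (contacts D (i, t0) k)) =
     card (inversions ?X ?Y) + card {z \<in> ?Y. b + of_int m < z} + card {z \<in> ?X. z < a + of_int m} + of_bool (tm < tb)"
    unfolding c using P(1,2) card_inversions_insert[OF fin, of "tm + of_int m" "a + of_int m" "b + of_int m" "tb + of_int m"] far
    by simp
  moreover have "card (inversions (contacts D' (i, t0) j) (contacts D' (i, t0) k)) =
     card (inversions ?X ?Y) + card {z \<in> ?Y. b + of_int m < z} + card {z \<in> ?X. z < a + of_int m} + of_bool (tm' < tb')"
    unfolding c' using P'(1,2) card_inversions_insert[OF fin, of "tm' + of_int m" "a + of_int m" "b + of_int m" "tb' + of_int m"] far
    by simp
  ultimately show ?thesis using ne by (simp del: contacts.simps)
qed

section \<open>Components that meet\<close>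

text \<open>
  Crossings of two different components are created by moves of type 2 only.
\<close>

definition meets :: "diagram \<Rightarrow> nat \<Rightarrow> nat \<Rightarrow> bool" where
  "meets D i j \<longleftrightarrow> (\<exists>s t. crossing D (i, s) (j, t))"

lemma meets_split:
  assumes D: "link_diagram D" and L: "disk_passes D C L"
  shows "meets D i j \<longleftrightarrow> (\<exists>s t. crossing D (i, s) (j, t) \<and> pt D (i, s) \<notin> C) \<or>
     (\<exists>(p, q)\<in>L. fst p = i \<and> fst q = j \<or> fst p = j \<and> fst q = i)"
proof -
  have pass: "overpass D p q \<and> pt D p \<in> C" if "(p, q) \<in> L" for p q
    using L[unfolded disk_passes_def, rule_format, of p q] that same_param_refl by fastforce
  have "(\<exists>(p, q)\<in>L. fst p = i \<and> fst q = j \<or> fst p = j \<and> fst q = i) \<longleftrightarrow>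
     (\<exists>s t. crossing D (i, s) (j, t) \<and> pt D (i, s) \<in> C)" (is "?l = ?r")
  proof
    assume ?l
    then obtain p q where pq: "(p, q) \<in> L" "fst p = i \<and> fst q = j \<or> fst p = j \<and> fst q = i" by blast
    have "crossing D p q" "crossing D q p" "pt D p \<in> C" "pt D q \<in> C"
      using pass[OF pq(1)] crossing_sym crossing_pt[of D p q] by (auto simp: overpass_def)
    then show ?r using pq(2) by (metis prod.collapse)
  next
    assume ?r
    then obtain s t where c: "crossing D (i, s) (j, t)" "pt D (i, s) \<in> C" by blast
    then have c': "pt D (j, t) \<in> C" using crossing_pt by metis
    from c(1) crossing_overpass[OF D] consider "overpass D (i, s) (j, t)" | "overpass D (j, t) (i, s)" by blast
    then obtain p q where "(p, q) \<in> L" "same_param p (i, s) \<and> same_param q (j, t) \<or> same_param p (j, t) \<and> same_param q (i, s)"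
      using L[unfolded disk_passes_def, rule_format, of "(i, s)" "(j, t)"]
        L[unfolded disk_passes_def, rule_format, of "(j, t)" "(i, s)"] c c' by cases blast+
    then show ?l by (intro bexI[of _ "(p, q)"]) (auto simp: same_param_def)
  qed
  then show ?thesis unfolding meets_def by blast
qed

lemma omega1_meets:
  assumes R: "reidemeister_move (Omega1 e r) C D D'" and ij: "i \<noteq> j"
  shows "meets D' i j = meets D i j"
proof -
  note F = reidemeister_moveD[OF R]
  obtain A where A: "plain_arcs D C [A]" "kinked_arc e r D' C A"
    using R unfolding reidemeister_move_def local_move.simps by blast
  obtain k a b where Ak: "A = (k, a, b)" by (metis prod_cases3)
  obtain s u where L: "disk_passes D' C {if over D' (k, s) (k, u) then ((k, s), (k, u)) else ((k, u), (k, s))}"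
    using kinked_arc_passes[OF F(2) A(2)[unfolded Ak]] by metis
  show ?thesis
    unfolding meets_split[OF F(2) L] meets_split[OF F(1) plain_arcs_passes[OF F(1) A(1)]]
    using unchanged_outside_crossing[OF F(5)] ij by auto
qed

lemma omega3_meets:
  assumes R: "reidemeister_move (Omega3 e1 e2 e3) C D D'"
  shows "meets D' i j = meets D i j"
proof -
  note F = reidemeister_moveD[OF R]
  obtain T M B tm tb mt mb bt bm tm' tb' mt' mb' bt' bm' where 
     tr: "triangle_arcs e1 e2 e3 D C T M B tm tb mt mb bt bm"
        "triangle_arcs e1 e2 e3 D' C T M B tm' tb' mt' mb' bt' bm'"
    using R unfolding reidemeister_move_def local_move.simps by blast
  obtain i1 a1 b1 j1 c1 d1 k1 l1 f1 where TMB: "T = (i1, a1, b1)" "M = (j1, c1, d1)" "B = (k1, l1, f1)"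
    by (metis prod_cases3)
  note P = triangle_arcs_passes[OF F(1) tr(1)[unfolded TMB]]
  note P' = triangle_arcs_passes[OF F(2) tr(2)[unfolded TMB]]
  show ?thesis
    unfolding meets_split[OF F(2) P'(8)] meets_split[OF F(1) P(8)]
    using unchanged_outside_crossing[OF F(5)] by auto
qed


section \<open>Reparametrization and isotopy\<close>

definition reparam :: "(nat \<Rightarrow> nat) \<Rightarrow> (nat \<Rightarrow> real \<Rightarrow> real) \<Rightarrow> nat \<times> real \<Rightarrow> nat \<times> real" where
  "reparam \<pi> h p = (\<pi> (fst p), h (fst p) (snd p))"

text \<open>
  Both isotopies and changes of parametrization are equivalences of the Gauss data: crossings,
  over/under information and the cyclic order on the components.
\<close>

definition gauss_equivalent :: "diagram \<Rightarrow> diagram \<Rightarrow> (nat \<Rightarrow> nat) \<Rightarrow> (nat \<Rightarrow> real \<Rightarrow> real) \<Rightarrow> bool" where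
  "gauss_equivalent D D' \<pi> h \<longleftrightarrow> ncomp D' = ncomp D \<and> bij_betw \<pi> {..<ncomp D} {..<ncomp D} \<and>
     (\<forall>i<ncomp D. strict_mono (h i) \<and> surj (h i) \<and> (\<forall>t. h i (t + 1) = h i t + 1)) \<and>
     (\<forall>p q. param D' p \<longrightarrow> param D' q \<longrightarrow> overpass D' p q = overpass D (reparam \<pi> h p) (reparam \<pi> h q))"

lemma gauss_crossing:
  assumes "gauss_equivalent D D' \<pi> h" "link_diagram D" "link_diagram D'" "param D' p" "param D' q"
  shows "crossing D' p q = crossing D (reparam \<pi> h p) (reparam \<pi> h q)"
proof -
  have "overpass D' x y = overpass D (reparam \<pi> h x) (reparam \<pi> h y)" if "param D' x" "param D' y" for x y
    using assms(1) that unfolding gauss_equivalent_def by blast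
  from this[OF assms(4,5)] this[OF assms(5,4)] show ?thesis
    by (simp only: crossing_overpass[OF assms(2)] crossing_overpass[OF assms(3)])
qed

lemma gauss_window:
  assumes G: "gauss_equivalent D D' \<pi> h" and i: "i < ncomp D"
  shows "h i s \<in> window (h i t0) \<longleftrightarrow> s \<in> window t0"
proof -
  have "strict_mono (h i)" "h i (t0 + 1) = h i t0 + 1" using G i by (simp_all add: gauss_equivalent_def)
  then show ?thesis unfolding window_def by (metis greaterThanLessThan_iff strict_mono_less)
qed

lemma gauss_self_passes:
  assumes G: "gauss_equivalent D D' \<pi> h" and i: "i < ncomp D"
  shows "card (self_passes D (reparam \<pi> h (i, t0)) b) = card (self_passes D' (i, t0) b)"
proof -
  have h: "strict_mono (h i)" "surj (h i)" and n: "ncomp D' = ncomp D"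
    using G i by (simp_all add: gauss_equivalent_def)
  have O: "overpass D' (i, s) (i, u) = overpass D (\<pi> i, h i s) (\<pi> i, h i u)" for s u
    using G i by (simp add: gauss_equivalent_def param_def reparam_def)
  have iff: "(h i s, h i u) \<in> self_passes D (\<pi> i, h i t0) b \<longleftrightarrow> (s, u) \<in> self_passes D' (i, t0) b" for s u
    by (simp add: O gauss_window[OF G i] strict_mono_less[OF h(1)])
  have "self_passes D (\<pi> i, h i t0) b = map_prod (h i) (h i) ` self_passes D' (i, t0) b"
  proof (intro set_eqI iffI)
    fix x assume x: "x \<in> self_passes D (\<pi> i, h i t0) b"
    obtain s u where su: "x = (h i s, h i u)" using h(2) by (metis surjD surj_pair)
    then have "(s, u) \<in> self_passes D' (i, t0) b" using x iff by metis
    then show "x \<in> map_prod (h i) (h i) ` self_passes D' (i, t0) b" unfolding su by force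
  next
    fix x assume "x \<in> map_prod (h i) (h i) ` self_passes D' (i, t0) b"
    then obtain s u where "(s, u) \<in> self_passes D' (i, t0) b" "x = (h i s, h i u)" by auto
    then show "x \<in> self_passes D (\<pi> i, h i t0) b" using iff by metis
  qed
  moreover have "inj_on (map_prod (h i) (h i)) A" for A
    using strict_mono_eq[OF h(1)] by (auto simp: inj_on_def)
  ultimately show ?thesis by (simp add: card_image reparam_def del: self_passes.simps)
qed

lemma gauss_contacts:
  assumes G: "gauss_equivalent D D' \<pi> h" and L: "link_diagram D" "link_diagram D'"
    and ij: "i < ncomp D" "j < ncomp D"
  shows "contacts D (reparam \<pi> h (i, t0)) (\<pi> j) = h i ` contacts D' (i, t0) j"
proof -
  have h: "surj (h i)" "surj (h j)" and n: "ncomp D' = ncomp D"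
    using G ij by (simp_all add: gauss_equivalent_def)
  have C: "crossing D' (i, s) (j, t) = crossing D (\<pi> i, h i s) (\<pi> j, h j t)" for s t
    using gauss_crossing[OF G L] n ij by (simp add: param_def reparam_def)
  have ex: "(\<exists>t. crossing D (\<pi> i, h i s) (\<pi> j, t)) \<longleftrightarrow> (\<exists>t. crossing D' (i, s) (j, t))" for s
    unfolding C using h(2) by (metis surjD)
  have iff: "h i s \<in> contacts D (\<pi> i, h i t0) (\<pi> j) \<longleftrightarrow> s \<in> contacts D' (i, t0) j" for s
    using ex gauss_window[OF G ij(1)] by simp
  show ?thesis
    unfolding reparam_def fst_conv snd_conv
  proof (intro set_eqI iffI)
    fix x assume x: "x \<in> contacts D (\<pi> i, h i t0) (\<pi> j)"
    obtain s where s: "x = h i s" using h(1) by (metis surjD)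
    then have "s \<in> contacts D' (i, t0) j" using x iff by metis
    then show "x \<in> h i ` contacts D' (i, t0) j" unfolding s by (rule imageI)
  next
    fix x assume "x \<in> h i ` contacts D' (i, t0) j"
    then obtain s where "s \<in> contacts D' (i, t0) j" "x = h i s" by blast
    then show "x \<in> contacts D (\<pi> i, h i t0) (\<pi> j)" using iff by metis
  qed
qed

lemma card_inversions_image:
  assumes "strict_mono h"
  shows "card (inversions (h ` X) (h ` Y)) = card (inversions X Y)"
proof -
  have "inversions (h ` X) (h ` Y) = map_prod h h ` inversions X Y"
    using strict_mono_less[OF assms] by (force simp: inversions_def)
  moreover have "inj_on (map_prod h h) A" for A
    using strict_mono_eq[OF assms] by (auto simp: inj_on_def)
  ultimately show ?thesis by (simp add: card_image)
qed

lemma gauss_meets: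
  assumes G: "gauss_equivalent D D' \<pi> h" and L: "link_diagram D" "link_diagram D'"
    and ij: "i < ncomp D" "j < ncomp D"
  shows "meets D (\<pi> i) (\<pi> j) = meets D' i j"
proof -
  have h: "surj (h i)" "surj (h j)" and n: "ncomp D' = ncomp D"
    using G ij by (simp_all add: gauss_equivalent_def)
  have "crossing D' (i, s) (j, t) = crossing D (\<pi> i, h i s) (\<pi> j, h j t)" for s t
    using gauss_crossing[OF G L] n ij by (simp add: param_def reparam_def)
  then show ?thesis unfolding meets_def using h by (metis surjD)
qed

lemma translate_int:
  fixes h :: "real \<Rightarrow> real"
  assumes "\<And>t. h (t + 1) = h t + 1"
  shows "h (t + of_int m) = h t + of_int m"
proof -
  interpret periodic_fun_simple' "\<lambda>t. h t - t" by unfold_locales (simp add: assms)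
  show ?thesis using plus_of_int[of t m] by simp
qed

lemma same_diagram_gauss:
  assumes S: "same_diagram D D'" and L: "link_diagram D" "link_diagram D'"
  shows "\<exists>\<pi> h. gauss_equivalent D D' \<pi> h \<and> (\<forall>p. param D' p \<longrightarrow> pt D' p = pt D (reparam \<pi> h p))"
proof -
  obtain \<pi> h where n: "ncomp D' = ncomp D" and pi: "bij_betw \<pi> {..<ncomp D} {..<ncomp D}"
    and h: "\<And>i. i < ncomp D \<Longrightarrow> smooth (h i)" "\<And>i t. i < ncomp D \<Longrightarrow> h i (t + 1) = h i t + 1"
       "\<And>i t. i < ncomp D \<Longrightarrow> deriv (h i) t > 0"
    and c: "\<And>i t. i < ncomp D \<Longrightarrow> curve D' i t = curve D (\<pi> i) (h i t)"
    and o: "\<And>i s j t. crossing D' (i, s) (j, t) \<Longrightarrow>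
          (over D' (i, s) (j, t) \<longleftrightarrow> over D (\<pi> i, h i s) (\<pi> j, h j t))"
    using S unfolding same_diagram_def by blast
  have der: "(h i has_real_derivative deriv (h i) t) (at t)" if "i < ncomp D" for i t
  proof -
    have "h i differentiable (at t)" using h(1)[OF that] by cases auto
    then show ?thesis using DERIV_deriv_iff_real_differentiable by blast
  qed
  have mono: "strict_mono (h i)" if "i < ncomp D" for i
  proof (rule strict_monoI)
    fix x y :: real assume "x < y"
    then show "h i x < h i y"
      by (rule DERIV_pos_imp_increasing) (use der[OF that] h(3)[OF that] in blast)
  qed
  have surj: "surj (h i)" if i: "i < ncomp D" for i
  proof -
    have "\<exists>x. h i x = y" for y
    proof -
      define m where "m = \<lfloor>y - h i 0\<rfloor>"
      have "h i (of_int m) = h i 0 + of_int m" "h i (of_int m + 1) = h i 0 + of_int m + 1"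
        using translate_int[of "h i" 0 m] h(2)[OF i] by simp_all
      then have "h i (of_int m) \<le> y" "y \<le> h i (of_int m + 1)" unfolding m_def by linarith+
      moreover have "continuous_on {of_int m..of_int m + 1} (h i)"
        using der[OF i] DERIV_isCont continuous_at_imp_continuous_on by blast
      ultimately show ?thesis using IVT'[of "h i" "of_int m" y "of_int m + 1"] by auto
    qed
    then show ?thesis by (metis surjI)
  qed
  have pi_less: "\<pi> i < ncomp D" if "i < ncomp D" for i using pi that bij_betwE by blast
  have pi_inj: "\<pi> i = \<pi> j \<longleftrightarrow> i = j" if "i < ncomp D" "j < ncomp D" for i j
    using pi that by (auto simp: bij_betw_def inj_on_def)
  have ints: "h i s - h i t \<in> \<int> \<longleftrightarrow> s - t \<in> \<int>" if i: "i < ncomp D" for i s t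
  proof
    assume "h i s - h i t \<in> \<int>"
    then obtain m where "h i s - h i t = of_int m" by (rule Ints_cases)
    then have "h i s = h i (t + of_int m)" using translate_int[of "h i" t m] h(2)[OF i] by simp
    then have "s = t + of_int m" using strict_mono_eq[OF mono[OF i]] by simp
    then show "s - t \<in> \<int>" by simp
  next
    assume "s - t \<in> \<int>"
    then obtain m where "s - t = of_int m" by (rule Ints_cases)
    then have "s = t + of_int m" by simp
    then show "h i s - h i t \<in> \<int>" using translate_int[of "h i" t m] h(2)[OF i] by simp
  qed
  have cr: "crossing D' p q = crossing D (reparam \<pi> h p) (reparam \<pi> h q)"
    if "param D' p" "param D' q" for p q
  proof (cases p, cases q)
    fix i s j t assume pq: "p = (i, s)" "q = (j, t)"
    have ij: "i < ncomp D" "j < ncomp D" using that pq n by (simp_all add: param_def)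
    have "i = j \<Longrightarrow> h i s - h j t \<in> \<int> \<longleftrightarrow> s - t \<in> \<int>" using ints[OF ij(1)] by simp
    then show ?thesis
      using ij n pi_inj[OF ij] pi_less c
      by (auto simp: crossing_def pq reparam_def pt_def param_def)
  qed
  have ov: "overpass D' p q = overpass D (reparam \<pi> h p) (reparam \<pi> h q)"
    if "param D' p" "param D' q" for p q
    using cr[OF that] o[of "fst p" "snd p" "fst q" "snd q"] by (auto simp: overpass_def reparam_def)
  have "gauss_equivalent D D' \<pi> h"
    unfolding gauss_equivalent_def using n pi mono surj h(2) ov by blast
  moreover have "pt D' p = pt D (reparam \<pi> h p)" if "param D' p" for p
    using c that n by (simp add: pt_def reparam_def param_def)
  ultimately show ?thesis by blast
qed

lemma isotopic_gauss:
  assumes I: "isotopic_in C D D'" and L: "link_diagram D" "link_diagram D'"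
  shows "gauss_equivalent D D' id (\<lambda>i t. t)"
    "param D' p \<Longrightarrow> pt D p \<notin> C \<Longrightarrow> pt D' p = pt D p"
proof -
  obtain \<phi> where n: "ncomp D' = ncomp D" and \<phi>: "ambient_isotopy C \<phi>"
    and c: "\<And>i t. i < ncomp D \<Longrightarrow> curve D' i t = \<phi> 1 (curve D i t)"
    and o: "\<And>p q. crossing D p q \<Longrightarrow> over D' p q = over D p q"
    using I unfolding isotopic_in_def by blast
  have b: "inj (\<phi> 1)" and fix_out: "\<And>z. z \<notin> C \<Longrightarrow> \<phi> 1 z = z"
    using \<phi> unfolding ambient_isotopy_def by (auto simp: bij_def)
  have pt: "pt D' p = \<phi> 1 (pt D p)" if "param D' p" for p
    using c that n by (simp add: pt_def param_def)
  have cr: "crossing D' p q = crossing D p q" for p q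
  proof (cases "param D' p \<and> param D' q")
    case True
    then show ?thesis using pt inj_eq[OF b] n by (simp add: crossing_def param_def)
  next
    case False
    then show ?thesis using n by (auto simp: crossing_def param_def)
  qed
  then have "overpass D' p q = overpass D p q" for p q using o unfolding overpass_def by metis
  then show "gauss_equivalent D D' id (\<lambda>i t. t)"
    using n by (simp add: gauss_equivalent_def reparam_def strict_mono_def)
  show "param D' p \<Longrightarrow> pt D p \<notin> C \<Longrightarrow> pt D' p = pt D p" using pt fix_out by simp
qed

text \<open>
  Base points are only determined modulo 1 by their position, so the invariants have to be
  independent of the choice.
\<close>

lemma shift_gauss:
  assumes D: "link_diagram D"
  shows "gauss_equivalent D D id (\<lambda>i t. t + of_int m)"
proof -
  let ?r = "reparam id (\<lambda>i t. t + of_int m)"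
  have s: "same_param p (?r p)" "same_param (?r p) p" for p by (simp_all add: reparam_def same_param_def)
  have "overpass D p q = overpass D (?r p) (?r q)" for p q
    using overpass_cong[OF D _ s(1) s(1)] overpass_cong[OF D _ s(2) s(2)] by blast
  moreover have "surj (\<lambda>t. t + of_int m :: real)" by (rule surjI[of _ "\<lambda>t. t - of_int m"]) simp
  ultimately show ?thesis by (simp add: gauss_equivalent_def strict_mono_def)
qed

section \<open>Invariants along a sequence of moves\<close>

text \<open>
  A sequence of moves inside \<open>C\<close> keeps the points of the diagram outside \<open>C\<close>.  They mark the
  components and give base points on them, whatever the relabellings on the way.
\<close>

lemma invariant_along_steps:
  fixes \<Phi> :: "diagram \<Rightarrow> (nat \<times> real) list \<Rightarrow> bool"
  assumes steps: "(step_in S C)\<^sup>*\<^sup>* D D'"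
    and gauss: "\<And>E E' \<pi> h ps. gauss_equivalent E E' \<pi> h \<Longrightarrow> link_diagram E \<Longrightarrow> link_diagram E' \<Longrightarrow>
       (\<And>p. p \<in> set ps \<Longrightarrow> param E p) \<Longrightarrow> \<Phi> E (map (reparam \<pi> h) ps) = \<Phi> E' ps"
    and move: "\<And>\<omega> C' E E' ps. \<omega> \<in> S \<Longrightarrow> reidemeister_move \<omega> C' E E' \<Longrightarrow>
       (\<And>p. p \<in> set ps \<Longrightarrow> param E p \<and> pt E p \<notin> C') \<Longrightarrow> \<Phi> E' ps = \<Phi> E ps"
    and ps: "\<And>p. p \<in> set ps \<Longrightarrow> param D p \<and> pt D p \<notin> C"
  shows "\<exists>qs. map (pt D') qs = map (pt D) ps \<and> (\<forall>q\<in>set qs. param D' q) \<and> \<Phi> D' qs = \<Phi> D ps"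
  using steps
proof induction
  case base
  then show ?case using ps by blast
next
  case (step E E')
  from step.IH obtain qs where qs: "map (pt E) qs = map (pt D) ps" "\<forall>q\<in>set qs. param E q" "\<Phi> E qs = \<Phi> D ps"
    by blast
  have out: "pt E q \<notin> C" if "q \<in> set qs" for q
  proof -
    have "pt E q \<in> set (map (pt D) ps)" unfolding qs(1)[symmetric] using that by simp
    then show ?thesis using ps by auto
  qed
  have L: "link_diagram E" "link_diagram E'" using step.hyps(2) by (simp_all add: step_in_def)
  have keep: "?case" if "ncomp E' = ncomp E" "\<And>q. q \<in> set qs \<Longrightarrow> pt E' q = pt E q" "\<Phi> E' qs = \<Phi> E qs"
  proof (intro exI conjI)
    show "map (pt E') qs = map (pt D) ps" unfolding qs(1)[symmetric] using that(2) by simp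
  qed (use that qs in \<open>auto simp: param_def\<close>)
  from step.hyps(2) consider "same_diagram E E'" | "isotopic_in C E E'" 
    | \<omega> C' where "\<omega> \<in> S" "C' \<subseteq> C" "reidemeister_move \<omega> C' E E'"
    | \<omega> C' where "\<omega> \<in> S" "C' \<subseteq> C" "reidemeister_move \<omega> C' E' E"
    unfolding step_in_def by blast
  then show ?case
  proof cases
    case 1
    obtain \<pi> h where G: "gauss_equivalent E E' \<pi> h" and P: "\<And>p. param E' p \<Longrightarrow> pt E' p = pt E (reparam \<pi> h p)"
      using same_diagram_gauss[OF 1 L] by blast
    have "\<exists>q'. param E' q' \<and> reparam \<pi> h q' = q" if "param E q" for q
    proof (cases q)
      case (Pair i t)
      have "bij_betw \<pi> {..<ncomp E} {..<ncomp E}" "i < ncomp E"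
        using G that Pair by (simp_all add: gauss_equivalent_def param_def)
      then obtain i' where i': "i' < ncomp E" "\<pi> i' = i" by (metis bij_betwE bij_betw_imp_surj_on imageE lessThan_iff)
      then have "surj (h i')" using G by (simp add: gauss_equivalent_def)
      then obtain t' where "h i' t' = t" by (metis surjD)
      then show ?thesis using i' G Pair
        by (intro exI[of _ "(i', t')"]) (simp add: reparam_def param_def gauss_equivalent_def)
    qed
    then obtain f where f: "\<And>q. param E q \<Longrightarrow> param E' (f q) \<and> reparam \<pi> h (f q) = q" by metis
    have n: "ncomp E' = ncomp E" using G by (simp add: gauss_equivalent_def)
    have pull: "map (reparam \<pi> h) (map f qs) = qs" using f qs(2) by (simp add: map_idI)
    show ?thesis
    proof (intro exI conjI)
      show "map (pt E') (map f qs) = map (pt D) ps"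
        unfolding qs(1)[symmetric] using f P qs(2) by simp
      show "\<forall>q\<in>set (map f qs). param E' q" using f qs(2) by simp
      show "\<Phi> E' (map f qs) = \<Phi> D ps"
      proof -
        have "param E p" if "p \<in> set (map f qs)" for p
          using that f qs(2) n by (auto simp: param_def)
        then have "\<Phi> E (map (reparam \<pi> h) (map f qs)) = \<Phi> E' (map f qs)" by (rule gauss[OF G L])
        then show ?thesis unfolding pull qs(3) by simp
      qed
    qed
  next
    case 2
    have n: "ncomp E' = ncomp E" using 2 by (simp add: isotopic_in_def)
    have r: "reparam id (\<lambda>i t. t) = (\<lambda>p. p)" by (simp add: reparam_def fun_eq_iff)
    show ?thesis
    proof (rule keep[OF n])
      show "pt E' q = pt E q" if "q \<in> set qs" for q
        using isotopic_gauss(2)[OF 2 L] out[OF that] qs(2) that n by (simp add: param_def)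
      show "\<Phi> E' qs = \<Phi> E qs"
        using gauss[OF isotopic_gauss(1)[OF 2 L] L, of qs] qs(2) by (simp add: r)
    qed
  next
    case 3
    note F = reidemeister_moveD[OF 3(3)]
    show ?thesis
    proof (rule keep[OF F(6)])
      show "pt E' q = pt E q" if "q \<in> set qs" for q
        using F(5) out[OF that] qs(2) that 3(2) interior_subset unfolding unchanged_outside_def by blast
      show "\<Phi> E' qs = \<Phi> E qs"
        using out qs(2) 3(2) by (intro move[OF 3(1,3)]) blast
    qed
  next
    case 4
    note F = reidemeister_moveD[OF 4(3)]
    have p': "param E' q \<and> pt E' q \<notin> C'" if "q \<in> set qs" for q
      using unchanged_outside_disk[OF F(5), of q] qs(2) that 4(2) out[OF that] F(6) by (auto simp: param_def)
    show ?thesis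
    proof (rule keep[OF F(6)[symmetric]])
      show "pt E' q = pt E q" if "q \<in> set qs" for q
        using F(5) p'[OF that] interior_subset[of C'] unfolding unchanged_outside_def by (metis subsetD)
      show "\<Phi> E' qs = \<Phi> E qs"
        using move[OF 4(1,3) p'] by simp
    qed
  qed
qed

text \<open>
  A sequence of moves returns to the same marked points of the plane.  If these are no crossings of
  the final diagram, then they determine their parameters modulo 1, so the invariant at the end of
  the sequence is that of \<open>D'\<close> with its own marks.
\<close>

lemma not_generating:
  fixes \<Phi> :: "diagram \<Rightarrow> (nat \<times> real) list \<Rightarrow> bool"
  assumes S: "generating S" and R: "reidemeister_move \<Omega> C D D'"
    and gauss: "\<And>E E' \<pi> h ps. gauss_equivalent E E' \<pi> h \<Longrightarrow> link_diagram E \<Longrightarrow> link_diagram E' \<Longrightarrow>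
       (\<And>p. p \<in> set ps \<Longrightarrow> param E p) \<Longrightarrow> \<Phi> E (map (reparam \<pi> h) ps) = \<Phi> E' ps"
    and move: "\<And>\<omega> C' E E' ps. \<omega> \<in> S \<Longrightarrow> reidemeister_move \<omega> C' E E' \<Longrightarrow>
       (\<And>p. p \<in> set ps \<Longrightarrow> param E p \<and> pt E p \<notin> C') \<Longrightarrow> \<Phi> E' ps = \<Phi> E ps"
    and cong: "\<And>p p' ps ps'. same_param p p' \<Longrightarrow> map fst ps = map fst ps' \<Longrightarrow> param D' p \<Longrightarrow>
       (\<And>q. q \<in> set ps \<Longrightarrow> param D' q) \<Longrightarrow> \<Phi> D' (p # ps) = \<Phi> D' (p' # ps')"
    and ps: "\<And>p. p \<in> set (p0 # ps) \<Longrightarrow> param D p \<and> pt D p \<notin> C \<and> (\<forall>q. \<not> crossing D' p q)"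
    and ne: "\<Phi> D' (p0 # ps) \<noteq> \<Phi> D (p0 # ps)"
  shows False
proof -
  note F = reidemeister_moveD[OF R]
  have "(step_in S C)\<^sup>*\<^sup>* D D'" using S R unfolding generating_def by blast
  then have "\<exists>qs. map (pt D') qs = map (pt D) (p0 # ps) \<and> (\<forall>q\<in>set qs. param D' q) \<and> \<Phi> D' qs = \<Phi> D (p0 # ps)"
    by (rule invariant_along_steps[OF _ gauss move]) (use ps in blast)+
  then obtain qs where qs: "map (pt D') qs = map (pt D) (p0 # ps)" "\<forall>q\<in>set qs. param D' q" "\<Phi> D' qs = \<Phi> D (p0 # ps)"
    by blast
  then obtain q0 rs where q: "qs = q0 # rs" by (cases qs) auto
  have same: "same_param p q" if "p \<in> set (p0 # ps)" "param D' q" "pt D' q = pt D p" for p q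
  proof -
    have p: "param D p" "pt D p \<notin> C" using ps[OF that(1)] by auto
    then have "pt D' p = pt D p" "param D' p"
      using F(5,6) interior_subset[of C] unfolding unchanged_outside_def param_def by (metis subsetD)+
    moreover have "\<not> crossing D' p q" using ps[OF that(1)] by blast
    ultimately show ?thesis using that by (simp add: crossing_def)
  qed
  have "map fst ps = map fst rs"
  proof (rule nth_equalityI)
    have len: "length rs = length ps" using qs(1) q by (metis length_map length_Cons nat.inject)
    then show "length (map fst ps) = length (map fst rs)" by simp
    fix k assume "k < length (map fst ps)"
    then have k: "k < length ps" "k < length rs" using len by simp_all
    have "map (pt D') rs ! k = map (pt D) ps ! k" using qs(1) q by simp
    then have "pt D' (rs ! k) = pt D (ps ! k)" using k by simp
    then have "same_param (ps ! k) (rs ! k)" using k qs(2) q by (intro same) auto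
    then show "map fst ps ! k = map fst rs ! k" using k by (simp add: same_param_def)
  qed
  moreover have "same_param p0 q0" using qs(1,2) q by (intro same) auto
  ultimately have "\<Phi> D' (p0 # ps) = \<Phi> D' qs"
    unfolding q using ps F(6) by (intro cong) (auto simp: param_def)
  then show False using ne qs(3) by simp
qed


section \<open>Explicit smooth curves\<close>

text \<open>
  These functions are the products of \<open>exp (- 1 / x)\<close> with powers of \<open>1 / x\<close>, extended by zero; the
  derivatives of \<open>exp (- 1 / x)\<close> are combinations of them.
\<close>

definition flat :: "nat \<Rightarrow> real \<Rightarrow> real" where
  "flat k x = (if x > 0 then exp (- 1 / x) / x ^ k else 0)"

lemma flat_tendsto_0: "(flat k \<longlongrightarrow> 0) (at_right 0)"
proof -
  have "((\<lambda>x. inverse x ^ k / exp (inverse x :: real)) \<longlongrightarrow> 0) (at_right 0)"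
    by (rule filterlim_compose[OF tendsto_power_div_exp_0 filterlim_inverse_at_top_right])
  moreover have "eventually (\<lambda>x. inverse x ^ k / exp (inverse x) = flat k x) (at_right (0::real))"
    using eventually_at_right_less[of 0]
    by eventually_elim (simp add: flat_def exp_minus field_simps)
  ultimately show ?thesis by (rule Lim_transform_eventually)
qed

lemma flat_derivative:
  "(flat k has_real_derivative flat (k + 2) x - of_nat k * flat (k + 1) x) (at x)"
proof -
  consider "x > 0" | "x < 0" | "x = 0" by linarith
  then show ?thesis
  proof cases
    case 1
    have "((\<lambda>x. exp (- 1 / x) / x ^ k) has_real_derivative flat (k + 2) x - of_nat k * flat (k + 1) x) (at x)"
      using 1 by (auto intro!: derivative_eq_intros simp: flat_def field_simps power2_eq_square)
        (cases k; simp add: field_simps)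
    moreover have "eventually (\<lambda>y. exp (- 1 / y) / y ^ k = flat k y) (nhds x)"
      using eventually_nhds_in_open[of "{0<..}" x] 1 by (auto elim!: eventually_mono simp: flat_def)
    ultimately show ?thesis by (subst (asm) DERIV_cong_ev) auto
  next
    case 2
    have "((\<lambda>x. 0) has_real_derivative flat (k + 2) x - of_nat k * flat (k + 1) x) (at x)"
      using 2 by (simp add: flat_def)
    moreover have "eventually (\<lambda>y. 0 = flat k y) (nhds x)"
      using eventually_nhds_in_open[of "{..<0}" x] 2 by (auto elim!: eventually_mono simp: flat_def)
    ultimately show ?thesis by (subst (asm) DERIV_cong_ev) auto
  next
    case 3
    have "((\<lambda>h. (flat k (0 + h) - flat k 0) / h) \<longlongrightarrow> 0) (at 0)"
    proof (rule filterlim_split_at)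
      have "eventually (\<lambda>h. 0 = (flat k (0 + h) - flat k 0) / h) (at_left 0)"
        by (auto simp: eventually_at_filter flat_def)
      then show "((\<lambda>h. (flat k (0 + h) - flat k 0) / h) \<longlongrightarrow> 0) (at_left 0)"
        by (rule Lim_transform_eventually[OF tendsto_const])
      have "eventually (\<lambda>h. flat (k + 1) h = (flat k (0 + h) - flat k 0) / h) (at_right 0)"
        using eventually_at_right_less[of 0] by eventually_elim (simp add: flat_def)
      then show "((\<lambda>h. (flat k (0 + h) - flat k 0) / h) \<longlongrightarrow> 0) (at_right 0)"
        by (rule Lim_transform_eventually[OF flat_tendsto_0])
    qed
    then show ?thesis using 3 by (simp add: DERIV_def flat_def)
  qed
qed

text \<open>
  An algebra of 1-periodic functions that is closed under differentiation and contains functions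
  vanishing on a half-circle.
\<close>

inductive_set flat_trig :: "(real \<Rightarrow> real) set" where
  const: "(\<lambda>t. c) \<in> flat_trig"
| sin: "(\<lambda>t. sin (2 * pi * t)) \<in> flat_trig"
| cos: "(\<lambda>t. cos (2 * pi * t)) \<in> flat_trig"
| flat: "(\<lambda>t. flat k (cos (2 * pi * t))) \<in> flat_trig"
| add: "f \<in> flat_trig \<Longrightarrow> g \<in> flat_trig \<Longrightarrow> (\<lambda>t. f t + g t) \<in> flat_trig"
| mult: "f \<in> flat_trig \<Longrightarrow> g \<in> flat_trig \<Longrightarrow> (\<lambda>t. f t * g t) \<in> flat_trig"

lemma flat_trig_diff: "f \<in> flat_trig \<Longrightarrow> g \<in> flat_trig \<Longrightarrow> (\<lambda>t. f t - g t) \<in> flat_trig"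
  using flat_trig.add[OF _ flat_trig.mult[OF flat_trig.const[of "-1"]], of f g] by simp

lemma flat_trig_minus: "f \<in> flat_trig \<Longrightarrow> (\<lambda>t. - f t) \<in> flat_trig"
  using flat_trig.mult[OF flat_trig.const[of "-1"], of f] by simp

lemma flat_trig_derivative:
  assumes "f \<in> flat_trig"
  shows "\<exists>f'\<in>flat_trig. \<forall>t. (f has_real_derivative f' t) (at t)"
  using assms
proof induction
  case (const c)
  show ?case by (rule bexI[OF _ flat_trig.const[of 0]]) simp
next
  case sin
  show ?case
    by (rule bexI[OF _ flat_trig.mult[OF flat_trig.const[of "2 * pi"] flat_trig.cos]])
      (auto intro!: derivative_eq_intros)
next
  case cos
  show ?case
    by (rule bexI[OF _ flat_trig.mult[OF flat_trig.const[of "- 2 * pi"] flat_trig.sin]])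
      (auto intro!: derivative_eq_intros)
next
  case (flat k)
  define f' where "f' = (\<lambda>t. (flat (k + 2) (cos (2 * pi * t)) - of_nat k * flat (k + 1) (cos (2 * pi * t)))
     * (- 2 * pi * sin (2 * pi * t)))"
  have "f' \<in> flat_trig"
    unfolding f'_def by (intro flat_trig.intros flat_trig_diff)
  moreover have "((\<lambda>t. flat k (cos (2 * pi * t))) has_real_derivative f' t) (at t)" for t
    unfolding f'_def by (rule DERIV_chain2[OF flat_derivative]) (auto intro!: derivative_eq_intros)
  ultimately show ?case by (intro bexI[of _ f'] allI)
next
  case (add f g)
  then obtain f' g' where d: "f' \<in> flat_trig" "g' \<in> flat_trig"
    "\<And>t. (f has_real_derivative f' t) (at t)" "\<And>t. (g has_real_derivative g' t) (at t)" by blast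
  show ?case
    by (rule bexI[OF _ flat_trig.add[OF d(1,2)]]) (auto intro!: derivative_eq_intros d)
next
  case (mult f g)
  then obtain f' g' where d: "f' \<in> flat_trig" "g' \<in> flat_trig"
    "\<And>t. (f has_real_derivative f' t) (at t)" "\<And>t. (g has_real_derivative g' t) (at t)" by blast
  show ?case
    by (rule bexI[OF _ flat_trig.add[OF flat_trig.mult[OF d(1) mult.hyps(2)] flat_trig.mult[OF mult.hyps(1) d(2)]]])
      (auto intro!: derivative_eq_intros d)
qed

lemma Complex_derivative:
  assumes "(f has_real_derivative a) (at t)" "(g has_real_derivative b) (at t)"
  shows "((\<lambda>t. Complex (f t) (g t)) has_vector_derivative Complex a b) (at t)"
  using has_vector_derivative_complex_iff[of "\<lambda>t. Complex (f t) (g t)" "Complex a b"] assms by simp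

lemma smooth_flat_trig:
  assumes "f \<in> flat_trig" "g \<in> flat_trig"
  shows "smooth (\<lambda>t. Complex (f t) (g t))"
proof -
  define X :: "(real \<Rightarrow> complex) \<Rightarrow> bool" where
    "X h \<longleftrightarrow> (\<exists>f\<in>flat_trig. \<exists>g\<in>flat_trig. h = (\<lambda>t. Complex (f t) (g t)))" for h
  have "X (\<lambda>t. Complex (f t) (g t))" using assms by (auto simp: X_def)
  then show ?thesis
  proof (coinduct rule: smooth.coinduct)
    case (smooth h)
    then obtain f g where fg: "f \<in> flat_trig" "g \<in> flat_trig" "h = (\<lambda>t. Complex (f t) (g t))"
      by (auto simp: X_def)
    obtain f' where f': "f' \<in> flat_trig" "\<And>t. (f has_real_derivative f' t) (at t)"
      using flat_trig_derivative[OF fg(1)] by blast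
    obtain g' where g': "g' \<in> flat_trig" "\<And>t. (g has_real_derivative g' t) (at t)"
      using flat_trig_derivative[OF fg(2)] by blast
    have d: "(h has_derivative (\<lambda>v. v *\<^sub>R Complex (f' t) (g' t))) (at t)" for t
      using Complex_derivative[OF f'(2) g'(2)] by (simp add: fg(3) has_vector_derivative_def)
    have "X (\<lambda>t. frechet_derivative h (at t) v)" for v
    proof -
      have "frechet_derivative h (at t) v = Complex (v * f' t) (v * g' t)" for t
        using frechet_derivative_at[OF d[of t]] by (metis complex_scaleR)
      then have "(\<lambda>t. frechet_derivative h (at t) v) = (\<lambda>t. Complex (v * f' t) (v * g' t))" by simp
      then show ?thesis unfolding X_def
        by (intro bexI[of _ "\<lambda>t. v * g' t"] bexI[of _ "\<lambda>t. v * f' t"] flat_trig.mult flat_trig.const f' g')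
    qed
    moreover have "h differentiable at t" for t using d differentiableI by blast
    ultimately show ?case by blast
  qed
qed

lemma smooth_affine: "smooth (\<lambda>z :: complex. a + b * z)"
proof -
  define X :: "(complex \<Rightarrow> complex) \<Rightarrow> bool" where "X h \<longleftrightarrow> (\<exists>a b. \<forall>z. h z = a + b * z)" for h
  define f where "f z = a + b * z" for z
  have "X f" unfolding X_def by (rule exI[of _ a], rule exI[of _ b]) (simp add: f_def)
  then have "smooth f"
  proof (coinduct rule: smooth.coinduct)
    case (smooth h)
    then obtain a' b' where h: "\<And>z. h z = a' + b' * z" unfolding X_def by blast
    have d: "(h has_derivative (\<lambda>v. b' * v)) (at z)" for z
    proof -
      have "((\<lambda>z. a' + b' * z) has_derivative (\<lambda>v. b' * v)) (at z)"
        by (auto intro!: derivative_eq_intros)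
      moreover have "h = (\<lambda>z. a' + b' * z)" using h by (rule ext)
      ultimately show ?thesis by (simp only:)
    qed
    have "X (\<lambda>z. frechet_derivative h (at z) v)" for v
    proof -
      have "frechet_derivative h (at z) v = b' * v + 0 * z" for z
        unfolding frechet_derivative_at[OF d[of z], symmetric] by simp
      then show ?thesis unfolding X_def by blast
    qed
    moreover have "h differentiable at z" for z using d differentiableI by blast
    ultimately show ?case by blast
  qed
  then show ?thesis by (simp add: f_def[abs_def])
qed

section \<open>Round disks\<close>

lemma round_changing_disk:
  assumes r: "r > 0"
    and T: "\<And>p. param D p \<Longrightarrow> dist c (pt D p) = r \<Longrightarrow> (pt D p - c) \<bullet> tangent D p \<noteq> 0"
  shows "changing_disk (cball c r) D"
  unfolding changing_disk_def
proof (intro exI[of _ "\<lambda>z. c + of_real r * z"] conjI ballI allI impI)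
  show "smooth (\<lambda>z. c + of_real r * z)" by (rule smooth_affine)
  show "inj_on (\<lambda>z. c + of_real r * z) (cball 0 1)" using r by (auto simp: inj_on_def)
  have d: "frechet_derivative (\<lambda>z. c + of_real r * z) (at z) = (\<lambda>v. of_real r * v)" for z
  proof -
    have "((\<lambda>z. c + of_real r * z) has_derivative (\<lambda>v. of_real r * v)) (at z)"
      by (auto intro!: derivative_eq_intros)
    then show ?thesis by (metis frechet_derivative_at)
  qed
  show "inj (frechet_derivative (\<lambda>z. c + of_real r * z) (at z))" for z
    unfolding d using r by (auto simp: inj_on_def)
  show "cball c r = (\<lambda>z. c + of_real r * z) ` cball 0 1"
  proof (intro set_eqI iffI)
    fix w assume "w \<in> cball c r"
    then have "cmod ((w - c) / of_real r) \<le> 1" using r by (simp add: dist_norm norm_divide norm_minus_commute)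
    moreover have "w = c + of_real r * ((w - c) / of_real r)" using r by simp
    ultimately show "w \<in> (\<lambda>z. c + of_real r * z) ` cball 0 1" by (intro image_eqI[of _ _ "(w - c) / of_real r"]) auto
  next
    fix w assume "w \<in> (\<lambda>z. c + of_real r * z) ` cball 0 1"
    then show "w \<in> cball c r" using r by (auto simp: dist_norm norm_mult mult_left_le)
  qed
  fix p z assume *: "param D p \<and> cmod z = 1 \<and> pt D p = c + of_real r * z"
  then have "dist c (pt D p) = r" using r by (simp add: dist_norm norm_mult)
  then have "(pt D p - c) \<bullet> tangent D p \<noteq> 0" using T * by blast
  then show "det2 (frechet_derivative (\<lambda>z. c + of_real r * z) (at z) (\<i> * z)) (tangent D p) \<noteq> 0"
    unfolding d using * by (simp add: det2_def inner_complex_def algebra_simps)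
qed

definition half_angle :: "real \<Rightarrow> real" where
  "half_angle c = arccos c / (2 * pi)"

lemma half_angle_bounds: "- 1 < c \<Longrightarrow> c < 1 \<Longrightarrow> 0 < half_angle c \<and> half_angle c < 1 / 2"
  using arccos_lt_bounded[of c] by (simp add: half_angle_def field_simps)

lemma cos_half_angle_iff:
  assumes "- 1 < c" "c < 1" "\<bar>t\<bar> \<le> 1 / 2"
  shows "c \<le> cos (2 * pi * t) \<longleftrightarrow> \<bar>t\<bar> \<le> half_angle c" "c < cos (2 * pi * t) \<longleftrightarrow> \<bar>t\<bar> < half_angle c"
    "cos (2 * pi * t) = c \<longleftrightarrow> \<bar>t\<bar> = half_angle c"
proof -
  have "cos (2 * pi * t) = cos \<bar>2 * pi * t\<bar>" by simp
  also have "\<bar>2 * pi * t\<bar> = 2 * pi * \<bar>t\<bar>" by (simp add: abs_mult)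
  finally have 1: "cos (2 * pi * t) = cos (2 * pi * \<bar>t\<bar>)" .
  have c: "c = cos (2 * pi * half_angle c)" using assms by (simp add: half_angle_def)
  have b: "0 \<le> 2 * pi * \<bar>t\<bar>" "2 * pi * \<bar>t\<bar> \<le> pi" "0 \<le> 2 * pi * half_angle c" "2 * pi * half_angle c \<le> pi"
    using assms half_angle_bounds[of c] by (auto simp: field_simps)
  have 2: "cos (2 * pi * half_angle c) \<le> cos (2 * pi * \<bar>t\<bar>) \<longleftrightarrow> \<bar>t\<bar> \<le> half_angle c"
    "cos (2 * pi * half_angle c) < cos (2 * pi * \<bar>t\<bar>) \<longleftrightarrow> \<bar>t\<bar> < half_angle c"
    using cos_mono_le_eq[OF b(3,4,1,2)] cos_mono_less_eq[OF b(3,4,1,2)] by simp_all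
  then show "c \<le> cos (2 * pi * t) \<longleftrightarrow> \<bar>t\<bar> \<le> half_angle c" "c < cos (2 * pi * t) \<longleftrightarrow> \<bar>t\<bar> < half_angle c"
    unfolding 1 by (subst c; simp)+
  then show "cos (2 * pi * t) = c \<longleftrightarrow> \<bar>t\<bar> = half_angle c" by auto
qed

lemma cos_shift_int [simp]:
  "cos (2 * pi * (t + of_int m)) = cos (2 * pi * t)" "sin (2 * pi * (t + of_int m)) = sin (2 * pi * t)"
proof -
  have "2 * pi * (t + of_int m) = 2 * pi * t + 2 * pi * of_int m" by (simp add: algebra_simps)
  then show "cos (2 * pi * (t + of_int m)) = cos (2 * pi * t)" "sin (2 * pi * (t + of_int m)) = sin (2 * pi * t)"
    by (simp_all add: cos_add sin_add)
qed

lemma sin_cos_same_iff: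
  "sin (2 * pi * s) = sin (2 * pi * t) \<and> cos (2 * pi * s) = cos (2 * pi * t) \<longleftrightarrow> s - t \<in> \<int>"
proof
  assume "sin (2 * pi * s) = sin (2 * pi * t) \<and> cos (2 * pi * s) = cos (2 * pi * t)"
  then obtain n :: int where "2 * pi * s = 2 * pi * t + 2 * pi * of_int n"
    unfolding sin_cos_eq_iff by (auto simp: mult_ac)
  then have "2 * pi * s = 2 * pi * (t + of_int n)" by (simp add: algebra_simps)
  then have "s = t + of_int n" by simp
  then show "s - t \<in> \<int>" by simp
next
  assume "s - t \<in> \<int>"
  then obtain n where "s - t = of_int n" by (rule Ints_cases)
  then have "s = t + of_int n" by simp
  then show "sin (2 * pi * s) = sin (2 * pi * t) \<and> cos (2 * pi * s) = cos (2 * pi * t)" by simp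
qed

text \<open>
  Every component lies in the disk where the cosine of its parameter is at least \<open>\<kappa>\<close>, which is a
  single arc around parameter 0.
\<close>

lemma round_arcs_in:
  assumes per: "\<And>i t. i < n \<Longrightarrow> curve D i (t + 1) = curve D i t" and n: "ncomp D = n"
    and k: "\<And>i. i < n \<Longrightarrow> - 1 < \<kappa> i \<and> \<kappa> i < 1"
    and less: "\<And>i t. i < n \<Longrightarrow> dist c (curve D i t) < r \<longleftrightarrow> \<kappa> i < cos (2 * pi * t)"
    and eq: "\<And>i t. i < n \<Longrightarrow> dist c (curve D i t) = r \<longleftrightarrow> \<kappa> i = cos (2 * pi * t)"
    and r: "r > 0"
  shows "arcs_in D (cball c r) (map (\<lambda>i. (i, - half_angle (\<kappa> i), half_angle (\<kappa> i))) [0..<n])"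
proof -
  have "proper_arc D (cball c r) (i, - half_angle (\<kappa> i), half_angle (\<kappa> i))" if i: "i < n" for i
  proof -
    note h = half_angle_bounds[of "\<kappa> i"] k[OF i]
    have "dist c (curve D i t) = r" if "\<bar>t\<bar> = half_angle (\<kappa> i)" for t
      using cos_half_angle_iff(3)[of "\<kappa> i" t] eq[OF i, of t] h that by auto
    moreover have "dist c (curve D i t) < r" if "\<bar>t\<bar> < half_angle (\<kappa> i)" for t
      using cos_half_angle_iff(2)[of "\<kappa> i" t] less[OF i, of t] h that by auto
    ultimately show ?thesis using h i n r by (auto simp: frontier_cball abs_less_iff)
  qed
  moreover have "\<exists>!k. k < n \<and> on_arc p (k, - half_angle (\<kappa> k), half_angle (\<kappa> k))"
    if p: "param D p" "pt D p \<in> cball c r" for p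
  proof -
    obtain i t where it: "p = (i, t)" by (cases p)
    have i: "i < n" using p it n by (simp add: param_def)
    have le: "\<kappa> i \<le> cos (2 * pi * t)" using p less[OF i, of t] eq[OF i, of t] by (auto simp: it pt_def)
    define s where "s = t + of_int (- round t)"
    have "\<bar>s\<bar> \<le> 1 / 2" using of_int_round_abs_le[of t] by (simp add: s_def abs_minus_commute)
    moreover have "cos (2 * pi * s) = cos (2 * pi * t)" unfolding s_def by (rule cos_shift_int)
    ultimately have "\<bar>s\<bar> \<le> half_angle (\<kappa> i)" using cos_half_angle_iff(1)[of "\<kappa> i" s] k[OF i] le by simp
    then have "on_arc p (i, - half_angle (\<kappa> i), half_angle (\<kappa> i))"
      by (auto simp: it s_def abs_le_iff intro!: exI[of _ "- round t"])
    then show ?thesis using i it by auto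
  qed
  moreover have "(k < length (map (\<lambda>i. (i, - half_angle (\<kappa> i), half_angle (\<kappa> i))) [0..<n]) \<and>
      on_arc p (map (\<lambda>i. (i, - half_angle (\<kappa> i), half_angle (\<kappa> i))) [0..<n] ! k)) \<longleftrightarrow>
      (k < n \<and> on_arc p (k, - half_angle (\<kappa> k), half_angle (\<kappa> k)))" for k p
    by (cases "k < n") (simp_all del: on_arc.simps)
  ultimately show ?thesis unfolding arcs_in_def by (simp del: on_arc.simps proper_arc.simps add: Ball_def image_iff)
qed

section \<open>A bump vanishing on a half-line\<close>

text \<open>
  Normalized to the value 1 at 1.
\<close>

definition bump :: "real \<Rightarrow> real" where "bump x = exp 1 * flat 0 x"

definition bump' :: "real \<Rightarrow> real" where "bump' x = exp 1 * flat 2 x"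

lemma bump_pos_eq: "x > 0 \<Longrightarrow> bump x = exp (1 - 1 / x)"
  by (simp add: bump_def flat_def flip: exp_add)

lemma bump_nonpos [simp]: "x \<le> 0 \<Longrightarrow> bump x = 0" "x \<le> 0 \<Longrightarrow> bump' x = 0"
  by (simp_all add: bump_def bump'_def flat_def)

lemma bump_1 [simp]: "bump 1 = 1"
  by (simp add: bump_pos_eq)

lemma bump'_pos: "x > 0 \<Longrightarrow> bump' x > 0"
  by (simp add: bump'_def flat_def)

lemma bump'_nonneg: "bump' x \<ge> 0"
  by (simp add: bump'_def flat_def)

lemma bump_nonneg: "bump x \<ge> 0"
  by (simp add: bump_def flat_def)

lemma bump_le: "0 \<le> x \<Longrightarrow> bump x \<le> x"
proof (cases "x > 0")
  case True
  have "1 - 1 / x \<le> ln x" using ln_le_minus_one[of "1 / x"] True by (simp add: ln_div)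
  then have "exp (1 - 1 / x) \<le> exp (ln x)" by simp
  then show ?thesis using True by (simp add: bump_pos_eq)
qed simp

lemma bump_strict: "0 < y \<Longrightarrow> x < y \<Longrightarrow> bump x < bump y"
proof (cases "x > 0")
  case True
  assume "x < y"
  then have "1 / y < 1 / x" using True by (simp add: field_simps)
  then show ?thesis using True \<open>x < y\<close> by (simp add: bump_pos_eq)
qed (simp add: bump_pos_eq)

lemma bump_mono: "x \<le> y \<Longrightarrow> bump x \<le> bump y"
  using bump_strict[of y x] by (cases "0 < y"; cases "x = y") auto

lemma bump_derivative: "(bump has_real_derivative bump' x) (at x)"
  unfolding bump_def bump'_def using DERIV_cmult[OF flat_derivative[of 0 x], of "exp 1"]
  by (simp add: numeral_2_eq_2)

lemma bump_cos_derivative: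
  "((\<lambda>t. bump (cos (2 * pi * t))) has_real_derivative - 2 * pi * sin (2 * pi * t) * bump' (cos (2 * pi * t))) (at t)"
proof -
  have "((\<lambda>t. bump (cos (2 * pi * t))) has_real_derivative bump' (cos (2 * pi * t)) * (- 2 * pi * sin (2 * pi * t))) (at t)"
    by (rule DERIV_chain2[OF bump_derivative]) (auto intro!: derivative_eq_intros)
  then show ?thesis by (simp add: mult_ac)
qed

lemma flat_trig_bump: "(\<lambda>t. bump (cos (2 * pi * t))) \<in> flat_trig"
  unfolding bump_def by (intro flat_trig.intros)

lemmas flat_trig_rules = flat_trig.const flat_trig.sin flat_trig.cos flat_trig_bump
  flat_trig.add flat_trig.mult flat_trig_diff flat_trig_minus

abbreviation sn :: "real \<Rightarrow> real" where "sn t \<equiv> sin (2 * pi * t)"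
abbreviation cs :: "real \<Rightarrow> real" where "cs t \<equiv> cos (2 * pi * t)"

lemma period_1 [simp]: "cs (t + 1) = cs t" "sn (t + 1) = sn t"
  using cos_shift_int[of t 1] by simp_all

lemma sn_cs: "(sn t)\<^sup>2 + (cs t)\<^sup>2 = 1" by simp

lemma sn_sq: "(sn t)\<^sup>2 = 1 - (cs t)\<^sup>2" using sn_cs[of t] by linarith

lemma sn_same_param: "same_param p q \<Longrightarrow> sn (snd p) = sn (snd q)" "same_param p q \<Longrightarrow> cs (snd p) = cs (snd q)"
  using sin_cos_same_iff[of "snd p" "snd q"] by (simp_all add: same_param_def)

lemma sn_derivative: "(sn has_real_derivative 2 * pi * cs t) (at t)"
  by (auto intro!: derivative_eq_intros)

lemma cs_derivative: "(cs has_real_derivative - 2 * pi * sn t) (at t)"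
  by (auto intro!: derivative_eq_intros)


section \<open>A kink of each kind\<close>

text \<open>
  Two parameters of the circle with the same cosine are opposite, so the curve
  \<open>(sin * q cos, cos)\<close> crosses itself exactly where \<open>q\<close> vanishes.  For \<open>c = 0\<close> it is the circle,
  for \<open>c = 3/2\<close> the upper half of the circle is twisted into a kink.
\<close>

definition twist :: "real \<Rightarrow> bool \<Rightarrow> diagram" where
  "twist c b = \<lparr>ncomp = 1, curve = (\<lambda>i t. Complex (sn t * (1 - c * bump (cs t))) (cs t)),
     over = (\<lambda>p q. (sn (snd p) > 0) = b)\<rparr>"

lemma twist_sel [simp]: "ncomp (twist c b) = 1"
  "curve (twist c b) i t = Complex (sn t * (1 - c * bump (cs t))) (cs t)"
  "over (twist c b) p q \<longleftrightarrow> (sn (snd p) > 0) = b"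
  by (simp_all add: twist_def)

lemma twist_tangent:
  "tangent (twist c b) p = Complex (2 * pi * (cs (snd p) * (1 - c * bump (cs (snd p))) + (sn (snd p))\<^sup>2 * (c * bump' (cs (snd p)))))
     (- 2 * pi * sn (snd p))"
proof -
  have "((\<lambda>t. sn t * (1 - c * bump (cs t))) has_real_derivative
     2 * pi * (cs t * (1 - c * bump (cs t)) + (sn t)\<^sup>2 * (c * bump' (cs t)))) (at t)" for t
  proof -
    have "(sn has_real_derivative 2 * pi * cs t) (at t)" by (auto intro!: derivative_eq_intros)
    from DERIV_mult[OF this DERIV_diff[OF DERIV_const[of 1] DERIV_cmult[OF bump_cos_derivative[of t], of c]]]
    show ?thesis by (rule DERIV_cong) (simp add: power2_eq_square algebra_simps)
  qed
  moreover have "(cs has_real_derivative - 2 * pi * sn t) (at t)" for t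
    by (auto intro!: derivative_eq_intros)
  ultimately show ?thesis
    unfolding tangent_def twist_def by (simp add: vector_derivative_at[OF Complex_derivative])
qed

lemma twist_crossing:
  "crossing (twist c b) p q \<longleftrightarrow> fst p = 0 \<and> fst q = 0 \<and> cs (snd p) = cs (snd q) \<and>
     sn (snd p) = - sn (snd q) \<and> sn (snd p) \<noteq> 0 \<and> c * bump (cs (snd p)) = 1" (is "?l \<longleftrightarrow> ?r")
proof
  assume l: ?l
  let ?s = "snd p" and ?u = "snd q"
  have *: "fst p = 0" "fst q = 0" "cs ?s = cs ?u" "sn ?s * (1 - c * bump (cs ?s)) = sn ?u * (1 - c * bump (cs ?u))"
  proof -
    have p: "param (twist c b) p" "param (twist c b) q" "pt (twist c b) p = pt (twist c b) q"
      using l unfolding crossing_def by blast+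
    then show "fst p = 0" "fst q = 0" by (simp_all add: param_def)
    from p(3) show "cs ?s = cs ?u" "sn ?s * (1 - c * bump (cs ?s)) = sn ?u * (1 - c * bump (cs ?u))"
      unfolding pt_def twist_sel complex.inject by blast+
  qed
  have "?s - ?u \<notin> \<int>" using l * by (simp add: crossing_def same_param_def)
  then have ne: "sn ?s \<noteq> sn ?u" using sin_cos_same_iff[of ?s ?u] *(3) by blast
  have "(sn ?s)\<^sup>2 = (sn ?u)\<^sup>2" by (simp only: sn_sq *(3))
  then have opp: "sn ?s = - sn ?u" using ne by (simp add: power2_eq_iff)
  have "sn ?s * (1 - c * bump (cs ?s)) = sn ?u * (1 - c * bump (cs ?s))" using *(3,4) by metis
  then have "1 - c * bump (cs ?s) = 0" using ne mult_right_cancel by blast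
  then have "c * bump (cs ?s) = 1" by linarith
  then show ?r using * opp ne by simp
next
  assume r: ?r
  then have "sn (snd p) \<noteq> sn (snd q)" by simp
  then have "snd p - snd q \<notin> \<int>" using sin_cos_same_iff[of "snd p" "snd q"] by blast
  moreover have "fst p = 0" "fst q = 0" and e: "cs (snd p) = cs (snd q)" "c * bump (cs (snd p)) = 1"
    using r by blast+
  moreover from this have "c * bump (cs (snd q)) = 1" by metis
  ultimately show ?l unfolding crossing_def param_def pt_def same_param_def twist_sel by simp
qed

lemma bump_level_unique: "c * bump x = 1 \<Longrightarrow> c * bump y = 1 \<Longrightarrow> x = y"
proof (rule ccontr)
  assume c: "c * bump x = 1" "c * bump y = 1" and "x \<noteq> y"
  have "c \<noteq> 0" "bump x \<noteq> 0" "bump y \<noteq> 0" using c by auto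
  then have "x > 0" "y > 0" using bump_nonpos(1) by (meson linorder_not_le)+
  then have "bump x \<noteq> bump y" using bump_strict \<open>x \<noteq> y\<close> by (metis less_irrefl linorder_neqE_linordered_idom)
  then show False using c \<open>c \<noteq> 0\<close> by (metis mult_left_cancel)
qed

lemma twist_link_diagram:
  assumes c: "c = 0 \<or> c = 3 / 2"
  shows "link_diagram (twist c b)"
  unfolding link_diagram_def
proof (intro conjI allI impI)
  fix i assume "i < ncomp (twist c b)"
  have "smooth (\<lambda>t. Complex (sn t * (1 - c * bump (cs t))) (cs t))"
    by (intro smooth_flat_trig flat_trig_rules)
  then show "smooth (curve (twist c b) i)" by (simp add: twist_def)
  show "curve (twist c b) i (t + 1) = curve (twist c b) i t" for t by simp
next
  fix p
  show "tangent (twist c b) p \<noteq> 0"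
  proof (cases "sn (snd p) = 0")
    case True
    then have "cs (snd p) = 1 \<or> cs (snd p) = - 1" using sn_cs[of "snd p"] by (simp add: power2_eq_1_iff)
    then have "cs (snd p) * (1 - c * bump (cs (snd p))) \<noteq> 0" using c by auto
    then show ?thesis using True by (simp add: twist_tangent complex_eq_iff)
  next
    case False
    then show ?thesis by (simp add: twist_tangent complex_eq_iff)
  qed
next
  have "double_points (twist c b) \<subseteq> Complex 0 ` {k. c * bump k = 1}"
    by (auto simp: double_points_def twist_crossing pt_def)
  moreover have "finite {k. c * bump k = 1}"
  proof (cases "{k. c * bump k = 1} = {}")
    case False
    then obtain k where "c * bump k = 1" by blast
    then have "{k. c * bump k = 1} \<subseteq> {k}" using bump_level_unique by blast
    then show ?thesis using finite_subset by blast
  qed (simp only: finite.emptyI)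
  ultimately show "finite (double_points (twist c b))" by (meson finite_imageI finite_subset)
next
  fix p q assume "crossing (twist c b) p q"
  then have *: "cs (snd p) = cs (snd q)" "sn (snd p) = - sn (snd q)" "sn (snd q) \<noteq> 0" "c * bump (cs (snd q)) = 1"
    unfolding twist_crossing by auto
  have "cs (snd q) > 0"
  proof (rule ccontr)
    assume "\<not> ?thesis"
    then show False using *(4) bump_nonpos(1)[of "cs (snd q)"] by simp
  qed
  then have "bump' (cs (snd q)) > 0" "c > 0" using bump'_pos c *(4) by auto
  then have "(sn (snd q))\<^sup>2 * (c * bump' (cs (snd q))) \<noteq> 0" using *(3) by simp
  then show "det2 (tangent (twist c b) p) (tangent (twist c b) q) \<noteq> 0"
    using * by (simp add: det2_def twist_tangent)
  show "over (twist c b) p q = (\<not> over (twist c b) q p)" using * by auto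
next
  show "\<nexists>p q r. crossing (twist c b) p q \<and> crossing (twist c b) q r \<and> crossing (twist c b) p r"
    unfolding twist_crossing by (metis add.inverse_inverse neg_equal_zero)
next
  fix p q p' q' assume "crossing (twist c b) p q \<and> same_param p p' \<and> same_param q q'"
  then show "over (twist c b) p q = over (twist c b) p' q'" using sn_same_param(1)[of p p'] by simp
qed

lemma twist_dist:
  assumes c: "c = 0 \<or> c = 3 / 2"
  shows "dist \<i> (curve (twist c b) i t) < sqrt 2 \<longleftrightarrow> 0 < cs t"
    "dist \<i> (curve (twist c b) i t) = sqrt 2 \<longleftrightarrow> 0 = cs t"
proof -
  let ?x = "1 - c * bump (cs t)"
  have d: "dist \<i> (curve (twist c b) i t) = sqrt ((sn t * ?x)\<^sup>2 + (cs t - 1)\<^sup>2)"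
    by (simp add: dist_norm cmod_def power2_commute)
  have sq: "(sn t)\<^sup>2 + (cs t - 1)\<^sup>2 = 2 - 2 * cs t"
    using sn_cs[of t] by (simp add: power2_eq_square algebra_simps)
  have le: "(sn t * ?x)\<^sup>2 \<le> (sn t)\<^sup>2"
  proof -
    have "0 \<le> bump (cs t)" "bump (cs t) \<le> bump 1" by (rule bump_nonneg) (rule bump_mono, simp)
    moreover have "\<bar>1 - c' * y\<bar> \<le> 1" if "0 \<le> y" "y \<le> 1" "c' = 0 \<or> c' = 3 / 2" for c' y :: real
      using that by (elim disjE; hypsubst; simp add: abs_le_iff)
    ultimately have "\<bar>?x\<bar> \<le> 1" using c by simp
    then have "?x\<^sup>2 \<le> 1" by (simp add: abs_square_le_1)
    then show ?thesis by (simp add: power_mult_distrib mult_left_le)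
  qed
  have "(sn t * ?x)\<^sup>2 + (cs t - 1)\<^sup>2 < 2" if "cs t > 0" using le sq that by linarith
  moreover have "(sn t * ?x)\<^sup>2 + (cs t - 1)\<^sup>2 = 2 - 2 * cs t" if "cs t \<le> 0" using sq that by simp
  ultimately have 1: "(sn t * ?x)\<^sup>2 + (cs t - 1)\<^sup>2 < 2 \<longleftrightarrow> 0 < cs t"
    "(sn t * ?x)\<^sup>2 + (cs t - 1)\<^sup>2 = 2 \<longleftrightarrow> 0 = cs t"
    by (cases "cs t > 0"; force)+
  then show "dist \<i> (curve (twist c b) i t) < sqrt 2 \<longleftrightarrow> 0 < cs t"
    "dist \<i> (curve (twist c b) i t) = sqrt 2 \<longleftrightarrow> 0 = cs t" unfolding d by simp_all
qed

text \<open>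
  The same twisted curve serves for both values of \<open>o1\<close>, with the heights at its crossing exchanged.
\<close>

lemma kink_example:
  obtains e r D D' C s u where "reidemeister_move (Omega1 e r) C D D'"
    "plain_arcs D C [(0, - half_angle 0, half_angle 0)]" "arcs_in D' C [(0, - half_angle 0, half_angle 0)]"
    "- half_angle 0 \<le> s" "s < u" "u \<le> half_angle 0" 
    "disk_passes D' C {if o1 then ((0, s), (0, u)) else ((0, u), (0, s))}"
    "pt D (0, 1 / 2) \<notin> C" "param D (0, 1 / 2)" "\<And>q. \<not> crossing D' (0, 1 / 2) q"
proof -
  let ?D = "twist 0 (\<not> o1)" and ?D' = "twist (3 / 2) (\<not> o1)" and ?C = "cball \<i> (sqrt 2)"
  let ?A = "(0 :: nat, - half_angle 0, half_angle 0)"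
  \<comment> \<open>the cosine at the crossing, where \<open>bump\<close> has the value 2/3\<close>
  define k where "k = 1 / (1 - ln (2 / 3) :: real)"
  have ln: "ln (2 / 3 :: real) < 0" by simp
  then have "1 < 1 - ln (2 / 3 :: real)" by linarith
  then have k: "0 < k" "k < 1" by (simp_all add: k_def del: ln_less_zero_iff)
  have "bump k = 2 / 3" using k(1) ln by (simp add: bump_pos_eq) (simp add: k_def)
  then have bk: "3 / 2 * bump k = 1" by simp
  define t1 where "t1 = half_angle k"
  have t1: "0 < t1" "t1 < 1 / 2" "cs t1 = k" using half_angle_bounds[of k] k by (simp_all add: t1_def half_angle_def)
  have h0: "half_angle 0 = 1 / 4" by (simp add: half_angle_def)
  have t1q: "t1 < 1 / 4" using cos_half_angle_iff(2)[of 0 t1] t1 k h0 by auto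
  have sn1: "sn t1 > 0" using t1 by (intro sin_gt_zero) (auto simp: field_simps)
  have L: "link_diagram ?D" "link_diagram ?D'" by (simp_all add: twist_link_diagram)
  have arcs: "arcs_in (twist c (\<not> o1)) ?C [?A]" if "c = 0 \<or> c = 3 / 2" for c
    using round_arcs_in[of 1 "twist c (\<not> o1)" "\<lambda>i. 0" \<i> "sqrt 2"] twist_dist[OF that] by simp
  have none: "\<not> crossing ?D p q" for p q by (simp add: twist_crossing)
  have disk: "changing_disk ?C ?D"
  proof (rule round_changing_disk)
    fix p assume p: "param ?D p" "dist \<i> (pt ?D p) = sqrt 2"
    then have "cs (snd p) = 0" using twist_dist(2)[of 0 "\<not> o1"] by (simp add: pt_def del: twist_sel)
    moreover from this have "sn (snd p) \<noteq> 0" using sn_cs[of "snd p"] by auto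
    ultimately show "(pt ?D p - \<i>) \<bullet> tangent ?D p \<noteq> 0"
      by (simp add: pt_def twist_tangent inner_complex_def)
  qed simp
  have unch: "unchanged_outside ?C ?D ?D'"
    unfolding unchanged_outside_def
  proof (intro conjI allI impI)
    fix p assume "param ?D p"
    have in1: "pt (twist c (\<not> o1)) p \<in> interior ?C \<longleftrightarrow> 0 < cs (snd p)" if "c = 0 \<or> c = 3 / 2" for c
      using twist_dist(1)[OF that, of "\<not> o1" "fst p" "snd p"] by (simp add: pt_def del: twist_sel)
    show "pt ?D p \<in> interior ?C \<longleftrightarrow> pt ?D' p \<in> interior ?C" using in1[of 0] in1[of "3 / 2"] by simp
    assume "pt ?D p \<notin> interior ?C"
    then have "cs (snd p) \<le> 0" using in1[of 0] by simp
    then show "pt ?D' p = pt ?D p" by (simp add: pt_def)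
  qed simp_all
  have cr: "crossing ?D' (0, - t1) (0, t1)" using t1 bk sn1 by (simp add: twist_crossing)
  have K: "Complex 0 k = curve ?D' 0 (- t1)" using t1 bk by simp
  have dp: "double_points ?D' \<inter> ?C = {curve ?D' 0 (- t1)}"
  proof
    have "z = Complex 0 k" if z: "z \<in> double_points ?D'" for z
    proof -
      obtain p q where "crossing ?D' p q" "z = pt ?D' p" using z by (auto simp: double_points_def simp del: twist_sel)
      then have "3 / 2 * bump (cs (snd p)) = 1" "z = Complex (sn (snd p) * (1 - 3 / 2 * bump (cs (snd p)))) (cs (snd p))"
        unfolding twist_crossing pt_def twist_sel by blast+
      then show ?thesis using bump_level_unique[OF _ bk, of "cs (snd p)"] by simp
    qed
    then show "double_points ?D' \<inter> ?C \<subseteq> {curve ?D' 0 (- t1)}" unfolding K[symmetric] by blast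
    have "pt ?D' (0, - t1) \<in> double_points ?D'" using cr unfolding double_points_def by blast
    then have "curve ?D' 0 (- t1) \<in> double_points ?D'" by (simp only: pt_def fst_conv snd_conv)
    moreover have "dist \<i> (curve ?D' 0 (- t1)) < sqrt 2"
      using twist_dist(1)[of "3 / 2" "\<not> o1" 0 "- t1"] t1 k by simp
    ultimately show "{curve ?D' 0 (- t1)} \<subseteq> double_points ?D' \<inter> ?C" by simp
  qed
  have simple: "simple_path (subpath (- t1) t1 (curve ?D' 0))"
    unfolding simple_path_subpath_eq
  proof (intro conjI allI impI)
    have "continuous_on {- t1..t1} (curve ?D' 0)" by (rule curve_continuous[OF L(2)]) simp
    then show "path (subpath (- t1) t1 (curve ?D' 0))" by (rule path_subpath_interval) (use t1 in simp)
    show "- t1 \<noteq> t1" using t1 by simp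
    fix x y assume xy: "x \<in> closed_segment (- t1) t1 \<and> y \<in> closed_segment (- t1) t1 \<and> curve ?D' 0 x = curve ?D' 0 y"
    then have b: "\<bar>x\<bar> \<le> t1" "\<bar>y\<bar> \<le> t1" using t1 by (auto simp: closed_segment_eq_real_ivl)
    show "x = y \<or> x = - t1 \<and> y = t1 \<or> x = t1 \<and> y = - t1"
    proof (cases "x = y")
      case False
      have "x - y \<notin> \<int>"
      proof
        assume "x - y \<in> \<int>"
        then obtain m where m: "x - y = of_int m" by (rule Ints_cases)
        then have "\<bar>real_of_int m\<bar> < 1" using b t1q by linarith
        then have "m = 0" by linarith
        then show False using m False by simp
      qed
      then have "crossing ?D' (0, x) (0, y)" using xy by (simp add: crossing_def param_def pt_def del: twist_sel(2))
      then have "3 / 2 * bump (cs x) = 1" "cs x = cs y" unfolding twist_crossing fst_conv snd_conv by blast+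
      then have "cs x = k" "cs y = k" using bump_level_unique[OF _ bk, of "cs x"] by simp_all
      then have "\<bar>x\<bar> = t1" "\<bar>y\<bar> = t1"
        using cos_half_angle_iff(3)[of k x] cos_half_angle_iff(3)[of k y] k b t1 by (auto simp: t1_def)
      then show ?thesis using False by (auto simp: abs_if split: if_splits)
    qed simp
  qed
  have "\<exists>r. loop_rotates r (subpath (- t1) t1 (curve ?D' 0))"
    using simple_closed_path_winding_number_inside[OF simple] loop_rotates.simps by metis
  then obtain r where r: "loop_rotates r (subpath (- t1) t1 (curve ?D' 0))" ..
  have kink: "kinked_arc (crossing_sign ?D' (0, - t1) (0, t1)) r ?D' ?C ?A"
    unfolding kinked_arc.simps
  proof
    show "arcs_in ?D' ?C [?A]" by (rule arcs) simp
    show "\<exists>s u. - half_angle 0 < s \<and> s < u \<and> u < half_angle 0 \<and> crossing ?D' (0, s) (0, u) \<and>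
      double_points ?D' \<inter> ?C = {curve ?D' 0 s} \<and>
      crossing_sign ?D' (0, s) (0, u) = crossing_sign ?D' (0, - t1) (0, t1) \<and>
      loop_rotates r (subpath s u (curve ?D' 0))"
      using cr dp r t1 t1q h0
      by - (rule exI[of _ "- t1"], rule exI[of _ t1], simp del: twist_sel)
  qed
  have plain: "plain_arcs ?D ?C [?A]" using arcs[of 0] none by (simp add: plain_arcs_def double_points_def)
  have R: "reidemeister_move (Omega1 (crossing_sign ?D' (0, - t1) (0, t1)) r) ?C ?D ?D'"
    unfolding reidemeister_move_def local_move.simps using L disk unch plain kink by blast
  have passes: "disk_passes ?D' ?C {if o1 then ((0, - t1), (0, t1)) else ((0, t1), (0, - t1))}"
  proof (rule disk_passesI[OF L(2)])
    show "overpass ?D' p q" if "(p, q) \<in> {if o1 then ((0, - t1), (0, t1)) else ((0, t1), (0, - t1))}" for p q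
      using that cr crossing_sym[OF cr] sn1 by (auto simp: overpass_def split: if_splits)
    show "double_points ?D' \<inter> ?C = (\<lambda>(p, q). pt ?D' p) ` {if o1 then ((0, - t1), (0, t1)) else ((0, t1), (0, - t1))}"
      unfolding dp using t1 bk by (simp add: pt_def)
  qed
  show ?thesis
  proof (rule that[OF R plain arcs _ _ _ passes])
    show "pt ?D (0, 1 / 2) \<notin> ?C" using twist_dist[of 0 "\<not> o1" 0 "1 / 2"] by (simp add: pt_def)
    show "\<not> crossing ?D' (0, 1 / 2) q" for q by (simp add: twist_crossing)
  qed (use t1 t1q h0 in \<open>simp_all add: param_def\<close>)
qed


section \<open>A component pushed over its mirror image\<close>

text \<open>
  Component 1 is the mirror image of component 0 in the real axis, so they meet exactly where
  component 0 meets the axis.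
\<close>

definition height :: "real \<Rightarrow> real \<Rightarrow> real" where
  "height c k = k - 2 + c * bump k"

definition mirror_sign :: "nat \<Rightarrow> real" where
  "mirror_sign i = (if i = 0 then 1 else - 1)"

definition overlap :: "real \<Rightarrow> diagram" where
  "overlap c = \<lparr>ncomp = 2, curve = (\<lambda>i t. Complex (sn t) (mirror_sign i * height c (cs t))),
     over = (\<lambda>p q. fst p < fst q)\<rparr>"

lemma overlap_sel [simp]: "ncomp (overlap c) = 2"
  "curve (overlap c) i t = Complex (sn t) (mirror_sign i * height c (cs t))"
  "over (overlap c) p q \<longleftrightarrow> fst p < fst q"
  by (simp_all add: overlap_def)

lemma overlap_tangent:
  "tangent (overlap c) p = Complex (2 * pi * cs (snd p))
     (mirror_sign (fst p) * (- 2 * pi * sn (snd p) * (1 + c * bump' (cs (snd p)))))"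
proof -
  have "((\<lambda>t. mirror_sign i * height c (cs t)) has_real_derivative
     mirror_sign i * (- 2 * pi * sn t * (1 + c * bump' (cs t)))) (at t)" for i t
    unfolding height_def
    by (rule DERIV_cmult)
      (rule DERIV_cong[OF DERIV_add[OF DERIV_diff[OF cs_derivative DERIV_const] DERIV_cmult[OF bump_cos_derivative]]],
       simp add: algebra_simps)
  then show ?thesis
    unfolding tangent_def overlap_def by (simp add: vector_derivative_at[OF Complex_derivative] sn_derivative)
qed

lemma height_strict: "0 \<le> c \<Longrightarrow> x < y \<Longrightarrow> height c x < height c y"
  using mult_left_mono[OF bump_mono[of x y], of c] by (simp add: height_def)

lemma height_mono: "0 \<le> c \<Longrightarrow> x \<le> y \<Longrightarrow> height c x \<le> height c y"
  using height_strict[of c x y] by (cases "x = y") auto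

lemma height_inj: "0 \<le> c \<Longrightarrow> height c x = height c y \<longleftrightarrow> x = y"
  using height_strict[of c x y] height_strict[of c y x] by (cases x y rule: linorder_cases) auto

lemma height_opposite:
  assumes "0 \<le> c" "c \<le> 2" "\<bar>k\<bar> \<le> 1"
  shows "height c k + height c (- k) < 0"
proof -
  have b: "c * bump \<bar>k\<bar> \<le> 2 * bump 1"
    using assms bump_mono[of "\<bar>k\<bar>" 1] bump_nonneg by (intro mult_mono) auto
  have "bump k + bump (- k) = bump \<bar>k\<bar>" by (cases "k \<ge> 0") auto
  then have "c * bump k + c * bump (- k) = c * bump \<bar>k\<bar>" by (metis distrib_left)
  then show ?thesis using b by (simp add: height_def)
qed

lemma overlap_crossing:
  assumes c: "0 \<le> c" "c \<le> 2"
  shows "crossing (overlap c) p q \<longleftrightarrow> fst p < 2 \<and> fst q < 2 \<and> fst p \<noteq> fst q \<and> sn (snd p) = sn (snd q) \<and>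
     cs (snd p) = cs (snd q) \<and> height c (cs (snd p)) = 0" (is "?l \<longleftrightarrow> ?r")
proof
  assume l: ?l
  let ?s = "snd p" and ?u = "snd q"
  have p: "param (overlap c) p" "param (overlap c) q" "pt (overlap c) p = pt (overlap c) q" "\<not> same_param p q"
    using l unfolding crossing_def by blast+
  have f: "fst p < 2" "fst q < 2" using p(1,2) by (simp_all add: param_def)
  have e: "sn ?s = sn ?u" "mirror_sign (fst p) * height c (cs ?s) = mirror_sign (fst q) * height c (cs ?u)"
    using p(3) unfolding pt_def overlap_sel complex.inject by blast+
  have "(cs ?s)\<^sup>2 = (cs ?u)\<^sup>2" using sn_sq[of ?s] sn_sq[of ?u] unfolding e(1) by linarith
  then have pm: "cs ?s = cs ?u \<or> cs ?s = - cs ?u" by (simp add: power2_eq_iff)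
  have ne: "fst p \<noteq> fst q"
  proof
    assume eq: "fst p = fst q"
    then have "height c (cs ?s) = height c (cs ?u)" using e(2) by (simp add: mirror_sign_def split: if_splits)
    then have "cs ?s = cs ?u" using height_inj[OF c(1)] by blast
    then have "same_param p q" using e(1) eq sin_cos_same_iff[of ?s ?u] by (simp add: same_param_def)
    then show False using p(4) by blast
  qed
  then have opp: "height c (cs ?s) = - height c (cs ?u)"
    using e(2) f by (simp add: mirror_sign_def split: if_splits) 
  have "cs ?s = cs ?u"
  proof (rule ccontr)
    assume "cs ?s \<noteq> cs ?u"
    then have "cs ?s = - cs ?u" using pm by blast
    then have "height c (cs ?u) + height c (- cs ?u) = 0" using opp by (metis add.right_inverse)
    then show False using height_opposite[OF c, of "cs ?u"] by simp
  qed
  moreover from this opp have "height c (cs ?s) = 0" by (metis equal_neg_zero)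
  ultimately show ?r using f ne e(1) by blast
next
  assume ?r
  then have *: "fst p < 2" "fst q < 2" "fst p \<noteq> fst q" "sn (snd p) = sn (snd q)" "height c (cs (snd p)) = 0"
    "cs (snd p) = cs (snd q)" by blast+
  then have "height c (cs (snd q)) = 0" by metis
  then show ?l unfolding crossing_def param_def pt_def same_param_def overlap_sel using * by simp
qed

lemma height_zero:
  assumes "c = 0 \<or> c = 2" "height c k = 0" "\<bar>k\<bar> \<le> 1"
  shows "0 < k" "k < 1"
proof -
  show "0 < k"
  proof (rule ccontr)
    assume "\<not> ?thesis"
    then show False using assms(2) by (simp add: height_def)
  qed
  have "height c 1 \<noteq> 0" using assms(1) by (auto simp: height_def)
  then show "k < 1" using assms(2,3) by (cases "k = 1") auto
qed

lemma overlap_det: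
  assumes "fst p \<noteq> fst q" "fst p < 2" "fst q < 2" "sn (snd p) = sn (snd q)" "cs (snd p) = cs (snd q)"
  shows "det2 (tangent (overlap c) p) (tangent (overlap c) q) =
    mirror_sign (fst p) * (8 * pi\<^sup>2 * cs (snd q) * sn (snd q) * (1 + c * bump' (cs (snd q))))"
proof -
  have m: "mirror_sign (fst q) = - mirror_sign (fst p)" using assms(1-3) by (auto simp: mirror_sign_def)
  show ?thesis unfolding overlap_tangent det2_def complex.sel m assms(4,5)
    by (simp add: power2_eq_square algebra_simps)
qed

lemma overlap_link_diagram:
  assumes c: "c = 0 \<or> c = 2"
  shows "link_diagram (overlap c)"
  unfolding link_diagram_def
proof (intro conjI allI impI)
  fix i assume "i < ncomp (overlap c)"
  have "smooth (\<lambda>t. Complex (sn t) (mirror_sign i * (cs t - 2 + c * bump (cs t))))"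
    by (intro smooth_flat_trig flat_trig_rules)
  then show "smooth (curve (overlap c) i)" by (simp add: overlap_def height_def)
  show "curve (overlap c) i (t + 1) = curve (overlap c) i t" for t by simp
next
  fix p :: "nat \<times> real"
  have "1 + c * bump' (cs (snd p)) \<noteq> 0" using c bump'_nonneg[of "cs (snd p)"] by auto
  then have "tangent (overlap c) p = 0 \<Longrightarrow> cs (snd p) = 0 \<and> sn (snd p) = 0"
    by (simp add: overlap_tangent complex_eq_iff mirror_sign_def split: if_splits)
  then show "tangent (overlap c) p \<noteq> 0" using sn_sq[of "snd p"] by auto
next
  have c': "0 \<le> c" "c \<le> 2" using c by auto
  show "finite (double_points (overlap c))"
  proof (cases "\<exists>k. height c k = 0")
    case True
    then obtain k where k: "height c k = 0" by blast
    have "double_points (overlap c) \<subseteq> {Complex (sqrt (1 - k\<^sup>2)) 0, Complex (- sqrt (1 - k\<^sup>2)) 0}"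
    proof
      fix z assume "z \<in> double_points (overlap c)"
      then obtain p q where "crossing (overlap c) p q" "z = pt (overlap c) p" unfolding double_points_def by blast
      then have h: "height c (cs (snd p)) = 0" and z: "z = Complex (sn (snd p)) (mirror_sign (fst p) * height c (cs (snd p)))"
        unfolding overlap_crossing[OF c'] pt_def overlap_sel by blast+
      have "cs (snd p) = k" using height_inj[OF c'(1)] h k by metis
      then have "(sn (snd p))\<^sup>2 = 1 - k\<^sup>2" using sn_sq by metis
      then have "\<bar>sn (snd p)\<bar> = sqrt (1 - k\<^sup>2)" by (metis real_sqrt_abs)
      then have "sn (snd p) = sqrt (1 - k\<^sup>2) \<or> sn (snd p) = - sqrt (1 - k\<^sup>2)" by linarith
      then show "z \<in> {Complex (sqrt (1 - k\<^sup>2)) 0, Complex (- sqrt (1 - k\<^sup>2)) 0}" using z h by auto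
    qed
    then show ?thesis by (rule finite_subset) simp
  next
    case False
    then have "\<not> crossing (overlap c) p q" for p q using overlap_crossing[OF c'] by blast
    then show ?thesis by (simp add: double_points_def)
  qed
  fix p q assume cr: "crossing (overlap c) p q"
  then have *: "fst p \<noteq> fst q" "fst p < 2" "fst q < 2" "sn (snd p) = sn (snd q)" "cs (snd p) = cs (snd q)"
     "height c (cs (snd q)) = 0"
    unfolding overlap_crossing[OF c'] by metis+
  have k: "0 < cs (snd q)" "cs (snd q) < 1" using height_zero[OF c *(6)] by simp_all
  have "(cs (snd q))\<^sup>2 < 1" using k by (simp add: power_less_one_iff abs_square_less_1)
  then have "sn (snd q) \<noteq> 0" using sn_sq[of "snd q"] by auto
  moreover have "1 + c * bump' (cs (snd q)) > 0" using c bump'_nonneg[of "cs (snd q)"] by auto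
  ultimately show "det2 (tangent (overlap c) p) (tangent (overlap c) q) \<noteq> 0"
    unfolding overlap_det[OF *(1-5)] using k by (simp add: mirror_sign_def)
  show "over (overlap c) p q = (\<not> over (overlap c) q p)" using * by auto
next
  have c': "0 \<le> c" "c \<le> 2" using c by auto
  show "\<nexists>p q r. crossing (overlap c) p q \<and> crossing (overlap c) q r \<and> crossing (overlap c) p r"
  proof (intro notI, elim exE conjE)
    fix p q r assume "crossing (overlap c) p q" "crossing (overlap c) q r" "crossing (overlap c) p r"
    then have "fst p < 2" "fst q < 2" "fst r < 2" "fst p \<noteq> fst q" "fst q \<noteq> fst r" "fst p \<noteq> fst r"
      unfolding overlap_crossing[OF c'] by blast+
    then show False by linarith
  qed
next
  fix p q p' q' assume "crossing (overlap c) p q \<and> same_param p p' \<and> same_param q q'"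
  then show "over (overlap c) p q = over (overlap c) p' q'" by (simp add: same_param_def)
qed

lemma overlap_dist:
  assumes c: "c = 0 \<or> c = 2"
  shows "dist 0 (curve (overlap c) i t) < sqrt 5 \<longleftrightarrow> 0 < cs t"
    "dist 0 (curve (overlap c) i t) = sqrt 5 \<longleftrightarrow> 0 = cs t"
proof -
  have c': "0 \<le> c" "c \<le> 2" using c by auto
  have "(mirror_sign i * height c (cs t))\<^sup>2 = (height c (cs t))\<^sup>2"
    by (simp add: mirror_sign_def power_mult_distrib)
  then have d: "dist 0 (curve (overlap c) i t) = sqrt ((sn t)\<^sup>2 + (height c (cs t))\<^sup>2)"
    by (simp add: dist_norm cmod_def)
  have "(sn t)\<^sup>2 + (height c (cs t))\<^sup>2 < 5" if pos: "cs t > 0"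
  proof -
    have "height c 0 < height c (cs t)" by (rule height_strict[OF c'(1) pos])
    moreover have "height c (cs t) \<le> height c 1" by (rule height_mono[OF c'(1)]) simp
    moreover have "height c 0 = - 2" "height c 1 \<le> 1" using c' by (simp_all add: height_def)
    ultimately have "\<bar>height c (cs t)\<bar> < 2" by linarith
    then have "(height c (cs t))\<^sup>2 < 2\<^sup>2" by (metis abs_ge_zero power2_abs power_strict_mono zero_less_numeral)
    moreover have "(sn t)\<^sup>2 \<le> 1" by (simp add: abs_square_le_1)
    ultimately show ?thesis by simp
  qed
  moreover have "(sn t)\<^sup>2 + (height c (cs t))\<^sup>2 = 5 - 4 * cs t" if "cs t \<le> 0"
    using that sn_sq[of t] by (simp add: height_def power2_eq_square algebra_simps)
  ultimately have 1: "(sn t)\<^sup>2 + (height c (cs t))\<^sup>2 < 5 \<longleftrightarrow> 0 < cs t"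
    "(sn t)\<^sup>2 + (height c (cs t))\<^sup>2 = 5 \<longleftrightarrow> 0 = cs t"
    by (cases "cs t > 0"; force)+
  then show "dist 0 (curve (overlap c) i t) < sqrt 5 \<longleftrightarrow> 0 < cs t"
    "dist 0 (curve (overlap c) i t) = sqrt 5 \<longleftrightarrow> 0 = cs t" unfolding d by simp_all
qed

lemma overlap_example:
  obtains h C D D' where "reidemeister_move (Omega2 h) C D D'" "\<not> meets D 0 1" "meets D' 0 1"
    "\<And>p. p \<in> {(0, 1 / 2), (1, 1 / 2)} \<Longrightarrow> param D p \<and> pt D p \<notin> C \<and> (\<forall>q. \<not> crossing D' p q)"
proof -
  let ?D = "overlap 0" and ?D' = "overlap 2" and ?C = "cball (0 :: complex) (sqrt 5)"
  let ?A = "(0 :: nat, - half_angle 0, half_angle 0)" and ?B = "(1 :: nat, - half_angle 0, half_angle 0)"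
  have cr': "crossing ?D' p q \<longleftrightarrow> fst p < 2 \<and> fst q < 2 \<and> fst p \<noteq> fst q \<and> sn (snd p) = sn (snd q) \<and>
     cs (snd p) = cs (snd q) \<and> height 2 (cs (snd p)) = 0" for p q
    by (rule overlap_crossing) auto
  have "height 0 k < 0" if "\<bar>k\<bar> \<le> 1" for k using that by (simp add: height_def)
  then have none: "\<not> crossing ?D p q" for p q
    using overlap_crossing[of 0 p q] by (metis abs_cos_le_one less_irrefl order_refl zero_le_numeral)
  have "continuous_on {0..1} (height 2)"
    unfolding height_def using DERIV_isCont[OF bump_derivative]
    by (intro continuous_intros continuous_at_imp_continuous_on) auto
  moreover have "height 2 0 \<le> 0" "0 \<le> height 2 1" by (simp_all add: height_def)
  ultimately obtain k where k0: "height 2 k = 0" "0 \<le> k" "k \<le> 1" using IVT'[of "height 2" 0 0 1] by auto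
  then have k: "0 < k" "k < 1" using height_zero[of 2 k] by auto
  have k_unique: "x = k" if "height 2 x = 0" for x using height_inj[of 2 x k] that k0 by simp
  define t1 where "t1 = half_angle k"
  have t1: "0 < t1" "t1 < 1 / 2" "cs t1 = k" using half_angle_bounds[of k] k by (simp_all add: t1_def half_angle_def)
  have h0: "half_angle 0 = 1 / 4" by (simp add: half_angle_def)
  have t1q: "t1 < 1 / 4" using cos_half_angle_iff(2)[of 0 t1] t1 k h0 by auto
  have sn1: "sn t1 > 0" using t1 by (intro sin_gt_zero) (auto simp: field_simps)
  have L: "link_diagram ?D" "link_diagram ?D'" by (simp_all add: overlap_link_diagram)
  have arcs: "arcs_in (overlap c) ?C [?A, ?B]" if "c = 0 \<or> c = 2" for c
  proof -
    have "[0..<2] = [0, 1 :: nat]" by (simp add: numeral_2_eq_2)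
    then show ?thesis using round_arcs_in[of 2 "overlap c" "\<lambda>i. 0" 0 "sqrt 5"] overlap_dist[OF that] by simp
  qed
  have disk: "changing_disk ?C ?D"
  proof (rule round_changing_disk)
    fix p assume p: "param ?D p" "dist 0 (pt ?D p) = sqrt 5"
    then have c0: "cs (snd p) = 0" using overlap_dist(2)[of 0] by (simp add: pt_def del: overlap_sel)
    then have "sn (snd p) \<noteq> 0" using sn_cs[of "snd p"] by auto
    then show "(pt ?D p - 0) \<bullet> tangent ?D p \<noteq> 0"
      using c0 by (simp add: pt_def overlap_tangent inner_complex_def height_def mirror_sign_def)
  qed simp
  have unch: "unchanged_outside ?C ?D ?D'"
    unfolding unchanged_outside_def
  proof (intro conjI allI impI)
    fix p assume "param ?D p"
    have in1: "pt (overlap c) p \<in> interior ?C \<longleftrightarrow> 0 < cs (snd p)" if "c = 0 \<or> c = 2" for c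
      using overlap_dist(1)[OF that, of "fst p" "snd p"] by (simp add: pt_def del: overlap_sel)
    show "pt ?D p \<in> interior ?C \<longleftrightarrow> pt ?D' p \<in> interior ?C" using in1[of 0] in1[of 2] by simp
    assume "pt ?D p \<notin> interior ?C"
    then have "cs (snd p) \<le> 0" using in1[of 0] by simp
    then show "pt ?D' p = pt ?D p" by (simp add: pt_def height_def)
  qed simp_all
  have K: "curve ?D' i t1 = Complex (sn t1) 0" "curve ?D' i (- t1) = Complex (- sn t1) 0" for i
    using t1 k0 by simp_all
  have cross: "crossing ?D' (0, t1) (1, t1)" "crossing ?D' (0, - t1) (1, - t1)"
    using t1 k0 unfolding cr' by simp_all
  have dp: "double_points ?D' \<inter> ?C = {curve ?D' 0 t1, curve ?D' 0 (- t1)}"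
  proof
    have "z \<in> {Complex (sn t1) 0, Complex (- sn t1) 0}" if z: "z \<in> double_points ?D'" for z
    proof -
      obtain p q where "crossing ?D' p q" "z = pt ?D' p" using z unfolding double_points_def by blast
      then have h: "height 2 (cs (snd p)) = 0" and z: "z = Complex (sn (snd p)) (mirror_sign (fst p) * height 2 (cs (snd p)))"
        unfolding cr' pt_def overlap_sel by blast+
      have "cs (snd p) = cs t1" using k_unique[OF h] t1 by simp
      then have "(sn (snd p))\<^sup>2 = (sn t1)\<^sup>2" by (simp only: sn_sq)
      then have "sn (snd p) = sn t1 \<or> sn (snd p) = - sn t1" by (simp add: power2_eq_iff)
      then show ?thesis using z h by auto
    qed
    then show "double_points ?D' \<inter> ?C \<subseteq> {curve ?D' 0 t1, curve ?D' 0 (- t1)}" unfolding K by blast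
    have "pt ?D' (0, t1) \<in> double_points ?D'" "pt ?D' (0, - t1) \<in> double_points ?D'"
      using cross unfolding double_points_def by blast+
    moreover have "dist 0 (curve ?D' 0 t1) < sqrt 5" "dist 0 (curve ?D' 0 (- t1)) < sqrt 5"
      using overlap_dist(1)[of 2 0 t1] overlap_dist(1)[of 2 0 "- t1"] t1 k by simp_all
    ultimately show "{curve ?D' 0 t1, curve ?D' 0 (- t1)} \<subseteq> double_points ?D' \<inter> ?C"
      by (simp add: pt_def del: overlap_sel)
  qed
  have signs: "crossing_sign ?D' (0, t1) (1, t1) = Pos" "crossing_sign ?D' (0, - t1) (1, - t1) = Neg"
  proof -
    have b: "1 + 2 * bump' k > 0" using bump'_nonneg[of k] by linarith
    have d1: "det2 (tangent ?D' (0, t1)) (tangent ?D' (1, t1)) = 8 * pi\<^sup>2 * k * sn t1 * (1 + 2 * bump' k)"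
      using overlap_det[of "(0, t1)" "(1, t1)" 2] t1 by (simp add: mirror_sign_def)
    have d2: "det2 (tangent ?D' (0, - t1)) (tangent ?D' (1, - t1)) = - (8 * pi\<^sup>2 * k * sn t1 * (1 + 2 * bump' k))"
      using overlap_det[of "(0, - t1)" "(1, - t1)" 2] t1 by (simp add: mirror_sign_def)
    have "8 * pi\<^sup>2 * k * sn t1 * (1 + 2 * bump' k) > 0" using b k sn1 by simp
    then show "crossing_sign ?D' (0, t1) (1, t1) = Pos" "crossing_sign ?D' (0, - t1) (1, - t1) = Neg"
      unfolding crossing_sign_def Let_def d1 d2 by simp_all
  qed
  let ?K = "curve ?D' 0 ` closed_segment t1 (- t1) \<union> curve ?D' 1 ` closed_segment t1 (- t1)"
  \<comment> \<open>the bigon lies in the box, which contains nothing else of the diagram\<close>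
  let ?box = "cbox (Complex (- sn t1) (- 1)) (Complex (sn t1) 1)"
  have seg: "closed_segment t1 (- t1) = {- t1..t1}" using t1 by (simp add: closed_segment_eq_real_ivl)
  have cs_seg: "k \<le> cs t \<longleftrightarrow> t \<in> {- t1..t1}" if "\<bar>t\<bar> \<le> 1 / 2" for t
    using cos_half_angle_iff(1)[of k t] that k unfolding t1_def by auto
  have sn_le: "\<bar>sn t\<bar> \<le> sn t1 \<longleftrightarrow> k\<^sup>2 \<le> (cs t)\<^sup>2" for t
  proof -
    have "\<bar>sn t\<bar> \<le> sn t1 \<longleftrightarrow> (sn t)\<^sup>2 \<le> (sn t1)\<^sup>2" using sn1 by (metis abs_le_square_iff abs_of_pos)
    then show ?thesis using t1(3) sn_sq[of t] sn_sq[of t1] by simp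
  qed
  have K_box: "?K \<subseteq> ?box"
  proof -
    have "curve ?D' i t \<in> ?box" if "t \<in> {- t1..t1}" for i t
    proof -
      have "k \<le> cs t" using cs_seg[of t] that t1q by auto
      then have "k\<^sup>2 \<le> (cs t)\<^sup>2" using k by (intro power_mono) auto
      then have "\<bar>sn t\<bar> \<le> sn t1" using sn_le by blast
      moreover have "height 2 k \<le> height 2 (cs t)" "height 2 (cs t) \<le> height 2 1"
        using \<open>k \<le> cs t\<close> by (simp_all add: height_mono)
      moreover have "height 2 1 = 1" by (simp add: height_def)
      ultimately show ?thesis using k0 by (auto simp: in_cbox_complex_iff mirror_sign_def)
    qed
    then show ?thesis unfolding seg by blast
  qed
  have outside: "pt ?D' x \<notin> inside ?K" if "param ?D' x" for x
  proof
    assume ins: "pt ?D' x \<in> inside ?K"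
    have "inside ?K \<subseteq> ?box" using outside_subset_convex[OF convex_box(1) K_box] inside_Int_outside[of ?K] by blast
    then have box: "pt ?D' x \<in> ?box" using ins by blast
    have notK: "pt ?D' x \<notin> ?K" using ins inside_no_overlap by blast
    obtain i t where x: "x = (i, t)" by (cases x)
    have i: "i = 0 \<or> i = 1" using that x by (auto simp: param_def)
    have b: "\<bar>sn t\<bar> \<le> sn t1" "\<bar>height 2 (cs t)\<bar> \<le> 1"
      using box i by (auto simp: x pt_def in_cbox_complex_iff mirror_sign_def)
    have "\<not> cs t \<le> 0" using b(2) by (auto simp: height_def)
    moreover have "k\<^sup>2 \<le> (cs t)\<^sup>2" using sn_le b(1) by blast
    ultimately have "k \<le> cs t" using k by (metis abs_le_square_iff abs_of_pos not_le)
    define s where "s = t + of_int (- round t)"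
    have "\<bar>s\<bar> \<le> 1 / 2" using of_int_round_abs_le[of t] by (simp add: s_def abs_minus_commute)
    moreover have eq: "cs s = cs t" "sn s = sn t" unfolding s_def by (rule cos_shift_int)+
    ultimately have "s \<in> {- t1..t1}" using cs_seg \<open>k \<le> cs t\<close> by metis
    moreover have "curve ?D' i s = pt ?D' x" by (simp add: x pt_def eq)
    ultimately have "pt ?D' x \<in> ?K" unfolding seg using i by (metis UnCI imageI)
    then show False using notK by blast
  qed
  have bigon: "bigon_arcs Same_Order_Neg_First ?D' ?C ?A ?B"
    unfolding bigon_arcs.simps
  proof (intro conjI)
    show "arcs_in ?D' ?C [?A, ?B]" by (rule arcs) simp
    have in_arc: "t1 \<in> {- half_angle 0<..<half_angle 0}" "- t1 \<in> {- half_angle 0<..<half_angle 0}"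
      using t1 t1q h0 by auto
    have "crossing_order Same_Order_Neg_First t1 (- t1) t1 (- t1)" using t1 by simp
    moreover have "over ?D' (0, t1) (1, t1)" "over ?D' (0, - t1) (1, - t1)" by simp_all
    ultimately show "\<exists>p p' q q'. p \<in> {- half_angle 0<..<half_angle 0} \<and> p' \<in> {- half_angle 0<..<half_angle 0} \<and>
        q \<in> {- half_angle 0<..<half_angle 0} \<and> q' \<in> {- half_angle 0<..<half_angle 0} \<and>
        crossing ?D' (0, p) (1, q) \<and> crossing ?D' (0, p') (1, q') \<and>
        double_points ?D' \<inter> ?C = {curve ?D' 0 p, curve ?D' 0 p'} \<and>
        over ?D' (0, p) (1, q) \<and> over ?D' (0, p') (1, q') \<and>
        crossing_sign ?D' (0, p) (1, q) = Pos \<and> crossing_sign ?D' (0, p') (1, q') = Neg \<and>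
        crossing_order Same_Order_Neg_First p p' q q' \<and>
        (\<forall>x. param ?D' x \<longrightarrow>
           pt ?D' x \<notin> inside (curve ?D' 0 ` closed_segment p p' \<union> curve ?D' 1 ` closed_segment q q'))"
      using in_arc cross dp signs outside by blast
  qed
  have plain: "plain_arcs ?D ?C [?A, ?B]" using arcs[of 0] none by (simp add: plain_arcs_def double_points_def)
  have R: "reidemeister_move (Omega2 Same_Order_Neg_First) ?C ?D ?D'"
    unfolding reidemeister_move_def local_move.simps using L disk unch plain bigon by blast
  show ?thesis
  proof (rule that[OF R])
    show "\<not> meets ?D 0 1" using none by (simp add: meets_def)
    show "meets ?D' 0 1" unfolding meets_def using cross(1) by blast
    fix p :: "nat \<times> real" assume p: "p \<in> {(0, 1 / 2), (1, 1 / 2)}"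
    then have f: "fst p < 2" "snd p = 1 / 2" by auto
    have "height 2 (cs (1 / 2)) \<noteq> 0" by (simp add: height_def)
    then have "\<not> crossing ?D' p q" for q unfolding cr' f(2) by blast
    moreover have "pt ?D p \<notin> ?C" using overlap_dist[of 0 "fst p" "1 / 2"] by (auto simp: pt_def f simp del: overlap_sel)
    ultimately show "param ?D p \<and> pt ?D p \<notin> ?C \<and> (\<forall>q. \<not> crossing ?D' p q)" using f by (simp add: param_def)
  qed
qed


section \<open>A strand moved across the crossing of two circles\<close>

text \<open>
  Components 1 and 2 are the circles \<open>\<bar>z \<mp> 1\<bar>\<^sup>2 = 2\<close>, which cross at \<open>\<i>\<close> and \<open>- \<i>\<close>.  Component 0
  is a closed curve around the origin, in polar coordinates.  For \<open>c = 0\<close> it is a circle passing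
  below \<open>\<i>\<close>, and for \<open>c = 1/2\<close> its upper half is inflated so as to pass above \<open>\<i>\<close>.
\<close>

definition rad :: "real \<Rightarrow> real \<Rightarrow> real" where "rad c k = 3 / 4 + c * bump k"

definition side :: "nat \<Rightarrow> real" where "side i = (if i = 1 then 1 else - 1)"

definition triangle :: "real \<Rightarrow> diagram" where
  "triangle c = \<lparr>ncomp = 3,
     curve = (\<lambda>i t. if i = 0 then Complex (rad c (cs t) * sn t) (rad c (cs t) * cs t)
       else Complex (side i * (1 - cs t - sn t)) (cs t - sn t)),
     over = (\<lambda>p q. fst p < fst q)\<rparr>"

text \<open>The equation of the circle \<open>i\<close> along component 0, with \<open>e = side i\<close>.\<close>

definition gap :: "real \<Rightarrow> real \<Rightarrow> real \<Rightarrow> real" where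
  "gap c e t = (rad c (cs t))\<^sup>2 - 1 - 2 * e * rad c (cs t) * sn t"

lemma triangle_sel [simp]: "ncomp (triangle c) = 3" "over (triangle c) p q \<longleftrightarrow> fst p < fst q"
  by (simp_all add: triangle_def)

lemma triangle_0: "curve (triangle c) 0 t = Complex (rad c (cs t) * sn t) (rad c (cs t) * cs t)"
  by (simp add: triangle_def)

lemma triangle_circle: "i \<noteq> 0 \<Longrightarrow> curve (triangle c) i t = Complex (side i * (1 - cs t - sn t)) (cs t - sn t)"
  by (simp add: triangle_def)

lemma side_square: "side i * side i = 1" by (simp add: side_def)

lemma rad_ge: "0 \<le> c \<Longrightarrow> 3 / 4 \<le> rad c k"
  using bump_nonneg[of k] by (simp add: rad_def)

lemma rad_nonpos: "k \<le> 0 \<Longrightarrow> rad c k = 3 / 4"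
  by (simp add: rad_def)

lemma rad_mono: "0 \<le> c \<Longrightarrow> x \<le> y \<Longrightarrow> rad c x \<le> rad c y"
  using mult_left_mono[OF bump_mono[of x y], of c] by (simp add: rad_def)

lemma rad_derivative: "((\<lambda>t. rad c (cs t)) has_real_derivative - 2 * pi * sn t * (c * bump' (cs t))) (at t)"
  unfolding rad_def
  by (rule DERIV_cong[OF DERIV_add[OF DERIV_const DERIV_cmult[OF bump_cos_derivative]]]) simp

lemma triangle_tangent_0:
  "tangent (triangle c) (0, t) = Complex
     (- 2 * pi * sn t * (c * bump' (cs t)) * sn t + 2 * pi * cs t * rad c (cs t))
     (- 2 * pi * sn t * (c * bump' (cs t)) * cs t - 2 * pi * sn t * rad c (cs t))"
proof -
  have "((\<lambda>t. Complex (rad c (cs t) * sn t) (rad c (cs t) * cs t)) has_vector_derivative Complex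
     (- 2 * pi * sn t * (c * bump' (cs t)) * sn t + 2 * pi * cs t * rad c (cs t))
     (- 2 * pi * sn t * (c * bump' (cs t)) * cs t + - 2 * pi * sn t * rad c (cs t))) (at t)"
    by (rule Complex_derivative[OF DERIV_mult[OF rad_derivative sn_derivative] DERIV_mult[OF rad_derivative cs_derivative]])
  then show ?thesis unfolding tangent_def by (simp add: triangle_def vector_derivative_at)
qed

lemma triangle_tangent_circle:
  assumes "i \<noteq> 0"
  shows "tangent (triangle c) (i, t) = Complex (side i * (2 * pi * (sn t - cs t))) (2 * pi * (- sn t - cs t))"
proof -
  have "((\<lambda>t. Complex (side i * (1 - cs t - sn t)) (cs t - sn t)) has_vector_derivative
     Complex (side i * (0 - - 2 * pi * sn t - 2 * pi * cs t)) (- 2 * pi * sn t - 2 * pi * cs t)) (at t)"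
    by (rule Complex_derivative[OF DERIV_cmult[OF DERIV_diff[OF DERIV_diff[OF DERIV_const cs_derivative] sn_derivative]]
          DERIV_diff[OF cs_derivative sn_derivative]])
  then show ?thesis using assms unfolding tangent_def by (simp add: triangle_def vector_derivative_at algebra_simps)
qed

lemma polar_norm: "(r * sn t)\<^sup>2 + (r * cs t)\<^sup>2 = r\<^sup>2"
proof -
  have "(r * sn t)\<^sup>2 + (r * cs t)\<^sup>2 = r\<^sup>2 * ((sn t)\<^sup>2 + (cs t)\<^sup>2)"
    by (simp only: power_mult_distrib algebra_simps)
  then show ?thesis unfolding sn_cs by simp
qed

lemma triangle_same:
  assumes c: "0 \<le> c" and eq: "curve (triangle c) i s = curve (triangle c) i u"
  shows "s - u \<in> \<int>"
proof -
  have "sn s = sn u \<and> cs s = cs u"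
  proof (cases "i = 0")
    case True
    let ?R = "rad c (cs s)" and ?R' = "rad c (cs u)"
    have e: "?R * sn s = ?R' * sn u" "?R * cs s = ?R' * cs u"
      using eq unfolding True triangle_0 complex.inject by blast+
    have pos: "?R > 0" "?R' > 0" using rad_ge[OF c, of "cs s"] rad_ge[OF c, of "cs u"] by linarith+
    have "?R\<^sup>2 = (?R * sn s)\<^sup>2 + (?R * cs s)\<^sup>2" by (rule polar_norm[symmetric])
    also have "\<dots> = ?R'\<^sup>2" unfolding e by (rule polar_norm)
    finally have "?R = ?R'" using pos by (metis less_eq_real_def power2_eq_imp_eq)
    then show ?thesis using e pos by (metis less_irrefl mult_left_cancel)
  next
    case False
    have "side i \<noteq> 0" by (simp add: side_def)
    then have "1 - cs s - sn s = 1 - cs u - sn u" "cs s - sn s = cs u - sn u"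
      using eq unfolding triangle_circle[OF False] complex.inject by (metis mult_left_cancel)+
    then show ?thesis by linarith
  qed
  then show ?thesis using sin_cos_same_iff by blast
qed

lemma circle_equation:
  assumes "i \<noteq> 0" "curve (triangle c) i t = Complex x y"
  shows "x\<^sup>2 + y\<^sup>2 - 2 * side i * x - 1 = 0"
proof -
  have xy: "x = side i * (1 - cs t - sn t)" "y = cs t - sn t"
    using assms(2) unfolding triangle_circle[OF assms(1)] by simp_all
  have "x\<^sup>2 = (1 - cs t - sn t)\<^sup>2" unfolding xy by (simp add: side_def power_mult_distrib)
  moreover have "side i * x = 1 - cs t - sn t" unfolding xy by (simp add: side_def)
  ultimately have "x\<^sup>2 + y\<^sup>2 - 2 * side i * x - 1 = (1 - cs t - sn t)\<^sup>2 + (cs t - sn t)\<^sup>2 - 2 * (1 - cs t - sn t) - 1"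
    using xy(2) by simp
  also have "\<dots> = 2 * ((sn t)\<^sup>2 + (cs t)\<^sup>2) - 2" by (simp only: power2_eq_square algebra_simps)
  finally show ?thesis unfolding sn_cs by simp
qed

lemma triangle_cross_0:
  assumes "i \<noteq> 0" "curve (triangle c) 0 s = curve (triangle c) i u"
  shows "gap c (side i) s = 0"
proof -
  have "(rad c (cs s) * sn s)\<^sup>2 + (rad c (cs s) * cs s)\<^sup>2 - 2 * side i * (rad c (cs s) * sn s) - 1 = 0"
    by (rule circle_equation[OF assms(1), of c u]) (simp add: assms(2)[symmetric] triangle_0)
  moreover have "(rad c (cs s) * sn s)\<^sup>2 + (rad c (cs s) * cs s)\<^sup>2 = (rad c (cs s))\<^sup>2"
    by (rule polar_norm)
  ultimately show ?thesis by (simp add: gap_def algebra_simps)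
qed

lemma triangle_cross_circles:
  assumes "curve (triangle c) 1 s = curve (triangle c) 2 u"
  shows "cs s = cs u" "sn s = sn u" "cs u + sn u = 1"
proof -
  have e: "1 - cs s - sn s = - (1 - cs u - sn u)" "cs s - sn s = cs u - sn u"
    using assms by (simp_all add: triangle_circle side_def)
  have sq: "(cs t + sn t)\<^sup>2 + (cs t - sn t)\<^sup>2 = 2" for t
  proof -
    have "(cs t + sn t)\<^sup>2 + (cs t - sn t)\<^sup>2 = 2 * ((sn t)\<^sup>2 + (cs t)\<^sup>2)"
      by (simp only: power2_eq_square algebra_simps)
    then show ?thesis unfolding sn_cs by simp
  qed
  have "(cs s + sn s)\<^sup>2 = (cs u + sn u)\<^sup>2" using sq[of s] sq[of u] unfolding e(2) by linarith
  then have "cs s + sn s = cs u + sn u \<or> cs s + sn s = - (cs u + sn u)" by (simp add: power2_eq_iff)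
  then have "cs s + sn s = cs u + sn u" using e(1) by linarith
  then show "cs s = cs u" "sn s = sn u" "cs u + sn u = 1" using e by linarith+
qed

lemma sum_one_cases:
  assumes "cs u + sn u = 1"
  shows "cs u = 1 \<and> sn u = 0 \<or> cs u = 0 \<and> sn u = 1"
proof -
  have s: "sn u = 1 - cs u" using assms by linarith
  have "(sn u)\<^sup>2 = 1 - (cs u)\<^sup>2" by (rule sn_sq)
  then have "cs u * (1 - cs u) = 0" unfolding s by (simp add: power2_eq_square algebra_simps)
  then show ?thesis using s by auto
qed

subsection \<open>Zeros of the gap\<close>

lemma gap_eq: "gap c e t = 0 \<Longrightarrow> (rad c (cs t))\<^sup>2 - 1 = 2 * rad c (cs t) * (e * sn t)"
  by (simp add: gap_def)

lemma e_sn_sq: "e * e = (1::real) \<Longrightarrow> (e * sn t)\<^sup>2 = 1 - (cs t)\<^sup>2"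
  by (simp add: power_mult_distrib power2_eq_square[of e] sn_sq)

lemma gap_cs_nonzero:
  assumes e: "e * e = 1" and g: "gap c e t = 0"
  shows "cs t \<noteq> 0"
proof
  assume z: "cs t = 0"
  have "e * sn t = - 7 / 24" using gap_eq[OF g] rad_nonpos[of 0 c] by (simp add: z power2_eq_square)
  then have "(- 7 / 24 :: real)\<^sup>2 = 1" using e_sn_sq[OF e, of t] z by simp
  then show False by (simp add: power2_eq_square)
qed

text \<open>
  If \<open>e * sn t\<close> were not positive, the radius would be at most 1, so \<open>bump\<close> at most 1/2, which keeps the
  cosine away from 1 and makes \<open>\<bar>sn t\<bar>\<close> too large for a radius of at least 3/4.
\<close>

lemma gap_positive_side:
  assumes e: "e * e = 1" and g: "gap (1 / 2) e t = 0" and k: "cs t > 0"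
  shows "e * sn t > 0"
proof (rule ccontr)
  let ?R = "rad (1 / 2) (cs t)"
  assume "\<not> ?thesis"
  then have neg: "e * sn t \<le> 0" by simp
  have R: "?R \<ge> 3 / 4" by (rule rad_ge) simp
  note E = gap_eq[OF g]
  have "2 * ?R * (e * sn t) \<le> 0" using R neg by (simp add: mult_nonneg_nonpos)
  then have "?R\<^sup>2 \<le> 1" using E by linarith
  then have "?R \<le> 1" using power2_le_imp_le[of ?R 1] by simp
  then have "bump (cs t) \<le> 1 / 2" by (simp add: rad_def)
  moreover have "2 - 1 / cs t \<le> bump (cs t)"
    using exp_ge_add_one_self[of "1 - 1 / cs t"] k by (simp add: bump_pos_eq)
  ultimately have "3 / 2 \<le> 1 / cs t" by linarith
  then have "cs t \<le> 2 / 3" using k by (simp add: field_simps)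
  then have "(cs t)\<^sup>2 \<le> (2 / 3)\<^sup>2" using k by (intro power_mono) auto
  then have "(1 / 2)\<^sup>2 \<le> (e * sn t)\<^sup>2" unfolding e_sn_sq[OF e] by (simp add: power2_eq_square)
  then have "\<bar>1 / 2\<bar> \<le> \<bar>e * sn t\<bar>" by (simp only: abs_le_square_iff)
  then have "e * sn t \<le> - 1 / 2" using neg by simp
  then have "?R * (e * sn t) \<le> ?R * (- 1 / 2)" using R by (intro mult_left_mono) auto
  then have "?R\<^sup>2 - 1 \<le> - ?R" using E by linarith
  moreover have "(3 / 4)\<^sup>2 \<le> ?R\<^sup>2" using R by (intro power_mono) auto
  ultimately show False using R by (simp add: power2_eq_square)
qed

text \<open>
  For radius 3/4 the equation determines \<open>e * sn t\<close>.  On the inflated half, the larger of two values of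
  the cosine would have the larger radius \<open>r\<close>, hence the larger \<open>r - 1 / r = 2 * (e * sn t)\<close>, although
  its sine is smaller.
\<close>

lemma gap_unique:
  assumes c: "c = 0 \<or> c = 1 / 2" and e: "e * e = 1" and g: "gap c e s = 0" "gap c e t = 0"
    and k: "cs s > 0 \<and> cs t > 0 \<or> cs s < 0 \<and> cs t < 0"
  shows "sn s = sn t \<and> cs s = cs t"
proof -
  have main: "e * sn s = e * sn t \<and> cs s = cs t"
  proof (cases "cs s < 0 \<or> c = 0")
    case True
    have v: "e * sn u = - 7 / 24" if "gap c e u = 0" "rad c (cs u) = 3 / 4" for u
      using gap_eq[OF that(1)] that(2) by (simp add: power2_eq_square)
    have "rad c (cs u) = 3 / 4" if "u = s \<or> u = t" for u
      using True that k rad_nonpos[of "cs u" c] by (auto simp: rad_def)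
    then have "e * sn s = - 7 / 24" "e * sn t = - 7 / 24" using v g by blast+
    moreover from this have "(cs s)\<^sup>2 = (cs t)\<^sup>2" using e_sn_sq[OF e, of s] e_sn_sq[OF e, of t] by simp
    then have "cs s = cs t" using k by (auto simp: power2_eq_iff)
    ultimately show ?thesis by simp
  next
    case False
    then have c: "c = 1 / 2" and k: "cs s > 0" "cs t > 0" using c k by auto
    have less: False if *: "gap c e s = 0" "gap c e t = 0" "0 < cs s" "cs s < cs t" for s t
    proof -
      let ?R = "rad c (cs s)" and ?R' = "rad c (cs t)"
      have c0: "0 \<le> c" using c by simp
      have R: "3 / 4 \<le> ?R" "?R \<le> ?R'" using *(4) by (intro rad_ge[OF c0] rad_mono[OF c0]; simp)+
      have pos: "e * sn s > 0" "e * sn t > 0" using gap_positive_side[OF e] * c by auto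
      have "(cs s)\<^sup>2 < (cs t)\<^sup>2" using * by (intro power_strict_mono) auto
      then have "(e * sn t)\<^sup>2 < (e * sn s)\<^sup>2" unfolding e_sn_sq[OF e] by linarith
      then have lt: "e * sn t < e * sn s" using pos by (meson less_eq_real_def power2_less_imp_less)
      have q: "x - 1 / x = 2 * y" if "x\<^sup>2 - 1 = 2 * x * y" "x > 0" for x y :: real
        using that by (simp add: field_simps power2_eq_square)
      have "?R - 1 / ?R = 2 * (e * sn s)" "?R' - 1 / ?R' = 2 * (e * sn t)"
        using q gap_eq[OF *(1)] gap_eq[OF *(2)] R by simp_all
      moreover have "1 / ?R' \<le> 1 / ?R" using R by (intro divide_left_mono) auto
      ultimately show False using lt R by linarith
    qed
    have "cs s = cs t" using less[OF g(1,2)] less[OF g(2,1)] k by (metis linorder_neqE_linordered_idom)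
    moreover from this have "2 * rad c (cs t) * (e * sn s) = 2 * rad c (cs t) * (e * sn t)"
      using gap_eq[OF g(1)] gap_eq[OF g(2)] by metis
    then have "e * sn s = e * sn t" using rad_ge[of c "cs t"] c by simp
    ultimately show ?thesis by blast
  qed
  have "e \<noteq> 0" using e by auto
  then show ?thesis using main by (metis mult_left_cancel)
qed

lemma det_algebra:
  fixes p b x y r e :: real
  assumes "e * e = 1" "x\<^sup>2 + y\<^sup>2 = 1"
  shows "(- 2 * p * x * b * x + 2 * p * y * r) * (2 * p * (e * (r * x) - 1))
     - (- 2 * p * x * b * y - 2 * p * x * r) * (e * (2 * p * - (r * y))) =
     - 4 * p\<^sup>2 * (r * y + b * (e * x) * (r - e * x))"
  using assms by algebra

lemma triangle_det:
  assumes i: "i \<noteq> 0" and eq: "curve (triangle c) 0 s = curve (triangle c) i u"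
  shows "det2 (tangent (triangle c) (0, s)) (tangent (triangle c) (i, u)) =
    - 4 * pi\<^sup>2 * (rad c (cs s) * cs s + c * bump' (cs s) * (side i * sn s) * (rad c (cs s) - side i * sn s))"
proof -
  let ?R = "rad c (cs s)" and ?e = "side i" and ?b = "c * bump' (cs s)"
  have x: "?R * sn s = ?e * (1 - cs u - sn u)" and y: "?R * cs s = cs u - sn u"
    using eq unfolding triangle_0 triangle_circle[OF i] complex.inject by blast+
  have "?e * (?R * sn s) = 1 - cs u - sn u" unfolding x by (simp add: side_def)
  then have x': "- sn u - cs u = ?e * (?R * sn s) - 1" by linarith
  have y': "sn u - cs u = - (?R * cs s)" using y by linarith
  have "det2 (tangent (triangle c) (0, s)) (tangent (triangle c) (i, u)) =
     (- 2 * pi * sn s * ?b * sn s + 2 * pi * cs s * ?R) * (2 * pi * (?e * (?R * sn s) - 1))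
     - (- 2 * pi * sn s * ?b * cs s - 2 * pi * sn s * ?R) * (?e * (2 * pi * - (?R * cs s)))"
    unfolding det2_def triangle_tangent_0 triangle_tangent_circle[OF i] complex.sel x' y' ..
  also have "\<dots> = - 4 * pi\<^sup>2 * (?R * cs s + ?b * (?e * sn s) * (?R - ?e * sn s))"
    by (rule det_algebra[OF side_square sn_cs])
  finally show ?thesis .
qed

text \<open>
  By \<open>triangle_det\<close> this expression is the determinant of the two tangents, up to a negative factor.
\<close>

lemma gap_transversal:
  assumes c: "c = 0 \<or> c = 1 / 2" and e: "e * e = 1" and g: "gap c e s = 0"
  shows "cs s > 0 \<Longrightarrow> rad c (cs s) * cs s + c * bump' (cs s) * (e * sn s) * (rad c (cs s) - e * sn s) > 0"
    "cs s < 0 \<Longrightarrow> rad c (cs s) * cs s + c * bump' (cs s) * (e * sn s) * (rad c (cs s) - e * sn s) < 0"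
proof -
  let ?R = "rad c (cs s)"
  have R: "?R > 0" using rad_ge[of c "cs s"] c by auto
  show "?R * cs s + c * bump' (cs s) * (e * sn s) * (?R - e * sn s) > 0" if k: "cs s > 0"
  proof (cases "c = 0")
    case False
    then have c: "c = 1 / 2" using c by blast
    have s: "e * sn s > 0" using gap_positive_side[OF e] g k c by simp
    have "2 * ?R * (?R - e * sn s) = ?R\<^sup>2 + 1" using gap_eq[OF g] by (simp add: power2_eq_square algebra_simps)
    then have "0 < 2 * ?R * (?R - e * sn s)" by (simp add: add_nonneg_pos)
    then have "?R - e * sn s > 0" using R by (simp add: zero_less_mult_iff)
    then have "0 < c * bump' (cs s) * (e * sn s) * (?R - e * sn s)" 
      using s bump'_pos[OF k] c mult_pos_pos by (metis half_gt_zero_iff zero_less_one)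
    moreover have "0 < ?R * cs s" using R k by simp
    ultimately show ?thesis by linarith
  qed (use R k in simp)
  show "?R * cs s + c * bump' (cs s) * (e * sn s) * (?R - e * sn s) < 0" if k: "cs s < 0"
    using R k by (simp add: mult_pos_neg)
qed

lemma circles_det:
  "det2 (tangent (triangle c) (1, s)) (tangent (triangle c) (2, u)) =
     4 * pi\<^sup>2 * ((sn s - cs s) * (- sn u - cs u) + (- sn s - cs s) * (sn u - cs u))"
  by (simp add: det2_def triangle_tangent_circle side_def power2_eq_square algebra_simps)

lemma finite_if_unique:
  assumes "\<And>x y. x \<in> A \<Longrightarrow> y \<in> A \<Longrightarrow> x = y"
  shows "finite A"
proof (cases "A = {}")
  case False
  then obtain x where "x \<in> A" by blast
  then have "A \<subseteq> {x}" using assms by blast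
  then show ?thesis by (rule finite_subset) simp
qed (simp only: finite.emptyI)

subsection \<open>The crossings\<close>

lemma triangle_crossingD:
  assumes c: "c = 0 \<or> c = 1 / 2" and cr: "crossing (triangle c) (i, s) (j, u)"
  shows "i < 3" "j < 3" "i \<noteq> j" "curve (triangle c) i s = curve (triangle c) j u"
proof -
  show "i < 3" "j < 3" and e: "curve (triangle c) i s = curve (triangle c) j u"
    using cr by (simp_all add: crossing_def param_def pt_def)
  show "i \<noteq> j"
  proof
    assume "i = j"
    then have "s - u \<in> \<int>" using triangle_same[of c i s u] e c by auto
    then show False using cr \<open>i = j\<close> by (simp add: crossing_def)
  qed
qed

lemma triangle_crossing_cases:
  assumes c: "c = 0 \<or> c = 1 / 2" and cr: "crossing (triangle c) p q"
  obtains i s u where "i \<noteq> 0" "{p, q} = {(0, s), (i, u)}" "curve (triangle c) 0 s = curve (triangle c) i u" "i < 3"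
  | s u where "{p, q} = {(1, s), (2, u)}" "curve (triangle c) 1 s = curve (triangle c) 2 u"
proof -
  obtain i s j u where pq: "p = (i, s)" "q = (j, u)" by (cases p; cases q)
  note D = triangle_crossingD[OF c cr[unfolded pq]]
  consider "i = 0" "j \<noteq> 0" | "j = 0" "i \<noteq> 0" | "i = 1" "j = 2" | "i = 2" "j = 1" using D(1-3) by linarith
  then show ?thesis
  proof cases
    case 1 then show ?thesis using that(1)[of j s u] D pq by simp
  next
    case 2 then show ?thesis using that(1)[of i u s] D pq by (simp add: insert_commute)
  next
    case 3 then show ?thesis using that(2)[of s u] D pq by simp
  next
    case 4 then show ?thesis using that(2)[of u s] D pq by (simp add: insert_commute)
  qed
qed

lemma triangle_double_points:
  assumes c: "c = 0 \<or> c = 1 / 2" and z: "z \<in> double_points (triangle c)"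
  obtains e s where "e = 1 \<or> e = - 1" "gap c e s = 0" "z = curve (triangle c) 0 s"
  | "z = \<i>" | "z = - \<i>"
proof -
  obtain p q where cr: "crossing (triangle c) p q" and zp: "z = pt (triangle c) p" using z unfolding double_points_def by blast
  have zq: "z = pt (triangle c) q" using cr zp by (simp add: crossing_def)
  show ?thesis
    using c cr
  proof (cases rule: triangle_crossing_cases)
    case (1 i s u)
    have "p = (0, s) \<or> q = (0, s)" using 1(2) by (metis doubleton_eq_iff)
    then have "z = curve (triangle c) 0 s" using zp zq by (auto simp: pt_def)
    moreover have "side i = 1 \<or> side i = - 1" by (simp add: side_def)
    ultimately show ?thesis using that(1) triangle_cross_0[OF 1(1,3)] by blast
  next
    case (2 s u)
    have "p = (2, u) \<or> q = (2, u)" using 2(1) by (metis doubleton_eq_iff)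
    then have "z = curve (triangle c) 2 u" using zp zq by (auto simp: pt_def)
    then have "z = Complex (- (1 - cs u - sn u)) (cs u - sn u)" by (simp add: triangle_circle side_def)
    then show ?thesis using sum_one_cases[OF triangle_cross_circles(3)[OF 2(2)]] that(2,3)
      by (auto simp: complex_eq_iff)
  qed
qed

lemma triangle_link_diagram:
  assumes c: "c = 0 \<or> c = 1 / 2"
  shows "link_diagram (triangle c)"
  unfolding link_diagram_def
proof (intro conjI allI impI)
  fix i assume "i < ncomp (triangle c)"
  have s0: "smooth (\<lambda>t. Complex ((3 / 4 + c * bump (cs t)) * sn t) ((3 / 4 + c * bump (cs t)) * cs t))"
    by (intro smooth_flat_trig flat_trig_rules)
  have s1: "smooth (\<lambda>t. Complex (side i * (1 - cs t - sn t)) (cs t - sn t))"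
    by (intro smooth_flat_trig flat_trig_rules)
  show "smooth (curve (triangle c) i)"
    using s0 s1 by (cases "i = 0") (simp_all add: triangle_def rad_def)
  show "curve (triangle c) i (t + 1) = curve (triangle c) i t" for t by (simp add: triangle_def)
next
  fix p :: "nat \<times> real"
  obtain i t where p: "p = (i, t)" by (cases p)
  show "tangent (triangle c) p \<noteq> 0"
  proof
    assume z: "tangent (triangle c) p = 0"
    show False
    proof (cases "i = 0")
      case True
      have R: "rad c (cs t) > 0" using rad_ge[of c "cs t"] c by auto
      have "0 = Re (tangent (triangle c) p) * cs t - Im (tangent (triangle c) p) * sn t" using z by simp
      also have "\<dots> = 2 * pi * rad c (cs t) * ((sn t)\<^sup>2 + (cs t)\<^sup>2)"
        unfolding p True triangle_tangent_0 complex.sel by (simp only: power2_eq_square algebra_simps)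
      finally show False using R unfolding sn_cs by simp
    next
      case False
      then have "sn t - cs t = 0" "- sn t - cs t = 0"
        using z unfolding p triangle_tangent_circle[OF False] by (simp_all add: complex_eq_iff side_def split: if_splits)
      then have "sn t = 0" "cs t = 0" by linarith+
      then show False using sn_sq[of t] by simp
    qed
  qed
next
  let ?A = "\<lambda>e b. {z. \<exists>s. gap c e s = 0 \<and> (cs s > 0 \<longleftrightarrow> b) \<and> z = curve (triangle c) 0 s}"
  have fin: "finite (?A e b)" if e: "e = 1 \<or> e = - 1" for e b
  proof (rule finite_if_unique)
    fix x y assume "x \<in> ?A e b" "y \<in> ?A e b"
    then obtain s t where s: "gap c e s = 0" "cs s > 0 \<longleftrightarrow> b" "x = curve (triangle c) 0 s"
      and t: "gap c e t = 0" "cs t > 0 \<longleftrightarrow> b" "y = curve (triangle c) 0 t" by blast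
    have ee: "e * e = 1" using e by auto
    have "cs s > 0 \<and> cs t > 0 \<or> cs s < 0 \<and> cs t < 0"
      using s t gap_cs_nonzero[OF ee s(1)] gap_cs_nonzero[OF ee t(1)] by auto
    then have "sn s = sn t \<and> cs s = cs t" by (rule gap_unique[OF c ee s(1) t(1)])
    then show "x = y" unfolding s(3) t(3) triangle_0 by simp
  qed
  have "double_points (triangle c) \<subseteq> (?A 1 True \<union> ?A 1 False) \<union> (?A (- 1) True \<union> ?A (- 1) False) \<union> {\<i>, - \<i>}"
  proof
    fix z assume "z \<in> double_points (triangle c)"
    then show "z \<in> (?A 1 True \<union> ?A 1 False) \<union> (?A (- 1) True \<union> ?A (- 1) False) \<union> {\<i>, - \<i>}"
      by (rule triangle_double_points[OF c]) blast+
  qed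
  then show "finite (double_points (triangle c))"
    by (rule finite_subset) (intro finite_UnI fin; simp)
next
  fix p q assume cr: "crossing (triangle c) p q"
  have flip: "det2 v w \<noteq> 0 \<longleftrightarrow> det2 w v \<noteq> 0" for v w
  proof -
    have "det2 w v = - det2 v w" by (simp add: det2_def)
    then show ?thesis by simp
  qed
  have d: "det2 (tangent (triangle c) x) (tangent (triangle c) y) \<noteq> 0 \<Longrightarrow> {p, q} = {x, y} \<Longrightarrow>
     det2 (tangent (triangle c) p) (tangent (triangle c) q) \<noteq> 0" for x y
    unfolding doubleton_eq_iff using flip by metis
  show "det2 (tangent (triangle c) p) (tangent (triangle c) q) \<noteq> 0"
    using c cr
  proof (cases rule: triangle_crossing_cases)
    case (1 i s u)
    have g: "gap c (side i) s = 0" by (rule triangle_cross_0[OF 1(1,3)])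
    have "cs s > 0 \<or> cs s < 0" using gap_cs_nonzero[OF side_square g] by linarith
    then have "det2 (tangent (triangle c) (0, s)) (tangent (triangle c) (i, u)) \<noteq> 0"
      unfolding triangle_det[OF 1(1,3)] using gap_transversal[OF c side_square g] by auto
    then show ?thesis by (rule d[OF _ 1(2)])
  next
    case (2 s u)
    note E = triangle_cross_circles[OF 2(2)]
    have "det2 (tangent (triangle c) (1, s)) (tangent (triangle c) (2, u)) \<noteq> 0"
      unfolding circles_det E(1,2) using sum_one_cases[OF E(3)] by auto
    then show ?thesis by (rule d[OF _ 2(1)])
  qed
  obtain i s j u where pq: "p = (i, s)" "q = (j, u)" by (cases p; cases q)
  show "over (triangle c) p q = (\<not> over (triangle c) q p)"
    using triangle_crossingD(3)[OF c cr[unfolded pq]] pq by auto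
next
  show "\<nexists>p q r. crossing (triangle c) p q \<and> crossing (triangle c) q r \<and> crossing (triangle c) p r"
  proof (intro notI, elim exE conjE)
    fix p q r assume cr: "crossing (triangle c) p q" "crossing (triangle c) q r" "crossing (triangle c) p r"
    obtain i s j u k v where pq: "p = (i, s)" "q = (j, u)" "r = (k, v)" by (cases p; cases q; cases r)
    note D = triangle_crossingD[OF c cr(1)[unfolded pq]] triangle_crossingD[OF c cr(2)[unfolded pq]]
      triangle_crossingD[OF c cr(3)[unfolded pq]]
    have no: False if eq: "curve (triangle c) 0 a = curve (triangle c) 1 b" "curve (triangle c) 1 b = curve (triangle c) 2 d" for a b d
    proof -
      have g: "gap c (side 1) a = 0" by (rule triangle_cross_0[OF _ eq(1)]) simp
      note E = triangle_cross_circles[OF eq(2)]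
      have "rad c (cs a) * sn a = 1 - cs b - sn b"
        using eq(1) by (simp add: triangle_0 triangle_circle side_def)
      then have "rad c (cs a) * sn a = 0" using E by simp
      moreover have R: "3 / 4 \<le> rad c (cs a)" using rad_ge[of c] c by auto
      ultimately have s: "sn a = 0" by auto
      then have "(cs a)\<^sup>2 = 1" using sn_sq[of a] by simp
      then have "cs a = 1 \<or> cs a = - 1" by (simp add: power2_eq_1_iff)
      then have "rad c (cs a) = 3 / 4 \<or> rad c (cs a) = 5 / 4" using c by (auto simp: rad_def)
      then have "(rad c (cs a))\<^sup>2 = (3 / 4)\<^sup>2 \<or> (rad c (cs a))\<^sup>2 = (5 / 4)\<^sup>2" by metis
      then have "(rad c (cs a))\<^sup>2 \<noteq> 1" by (auto simp: power_divide)
      then show False using g s by (simp add: gap_def)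
    qed
    have "i = 0 \<or> i = 1 \<or> i = 2" "j = 0 \<or> j = 1 \<or> j = 2" "k = 0 \<or> k = 1 \<or> k = 2"
      using D(1,2,6) by linarith+
    then show False
      using D(3,4,7,8,11,12) by (elim disjE; hypsubst) (use no in metis)+
  qed
next
  fix p q p' q' assume "crossing (triangle c) p q \<and> same_param p p' \<and> same_param q q'"
  then show "over (triangle c) p q = over (triangle c) p' q'" by (simp add: same_param_def)
qed


lemma cs_pos: "\<bar>t\<bar> < 1 / 4 \<Longrightarrow> cs t > 0"
  using cos_half_angle_iff(2)[of 0 t] by (simp add: half_angle_def)

subsection \<open>The disk\<close>

definition level :: "nat \<Rightarrow> real" where "level i = (if i = 0 then 0 else 39 / 64)"

lemma triangle_dist:
  assumes c: "c = 0 \<or> c = 1 / 2"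
  shows "dist \<i> (curve (triangle c) i t) < 5 / 4 \<longleftrightarrow> level i < cs t"
    "dist \<i> (curve (triangle c) i t) = 5 / 4 \<longleftrightarrow> level i = cs t"
proof -
  have sq: "dist \<i> z < 5 / 4 \<longleftrightarrow> (Re z)\<^sup>2 + (Im z - 1)\<^sup>2 < 25 / 16"
    "dist \<i> z = 5 / 4 \<longleftrightarrow> (Re z)\<^sup>2 + (Im z - 1)\<^sup>2 = 25 / 16" for z
  proof -
    have d: "dist \<i> z = sqrt ((Re z)\<^sup>2 + (Im z - 1)\<^sup>2)" by (simp add: dist_norm cmod_def power2_commute)
    have q: "5 / 4 = sqrt (25 / 16)" by (simp add: real_sqrt_divide)
    show "dist \<i> z < 5 / 4 \<longleftrightarrow> (Re z)\<^sup>2 + (Im z - 1)\<^sup>2 < 25 / 16"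
      "dist \<i> z = 5 / 4 \<longleftrightarrow> (Re z)\<^sup>2 + (Im z - 1)\<^sup>2 = 25 / 16"
      unfolding d q by (rule real_sqrt_less_iff, rule real_sqrt_eq_iff)
  qed
  have "(dist \<i> (curve (triangle c) i t) < 5 / 4 \<longleftrightarrow> level i < cs t) \<and>
    (dist \<i> (curve (triangle c) i t) = 5 / 4 \<longleftrightarrow> level i = cs t)"
  proof (cases "i = 0")
    case True
    let ?R = "rad c (cs t)"
    have "(?R * sn t)\<^sup>2 + (?R * cs t - 1)\<^sup>2 = ((?R * sn t)\<^sup>2 + (?R * cs t)\<^sup>2) - 2 * (?R * cs t) + 1"
      by (simp add: power2_eq_square algebra_simps)
    then have E: "(?R * sn t)\<^sup>2 + (?R * cs t - 1)\<^sup>2 = ?R\<^sup>2 - 2 * (?R * cs t) + 1" unfolding polar_norm .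
    have "?R\<^sup>2 - 2 * (?R * cs t) + 1 < 25 / 16" if k: "cs t > 0"
    proof -
      have c0: "0 \<le> c" using c by auto
      have R: "3 / 4 \<le> ?R" by (rule rad_ge[OF c0])
      have "c * bump (cs t) \<le> 1 / 2 * cs t"
        using c bump_le[of "cs t"] bump_nonneg k by (intro mult_mono) auto
      then have "?R - 3 / 4 \<le> 1 / 2 * cs t" by (simp add: rad_def)
      then have "(?R - 3 / 4) * (?R + 3 / 4) \<le> (1 / 2 * cs t) * (2 * ?R)" using R k by (intro mult_mono) auto
      moreover have "0 < ?R * cs t" using R k by simp
      ultimately show ?thesis by (simp add: power2_eq_square algebra_simps)
    qed
    moreover have "?R\<^sup>2 - 2 * (?R * cs t) + 1 = 25 / 16 - 3 / 2 * cs t" if "cs t \<le> 0"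
      by (simp add: rad_nonpos[OF that] power2_eq_square)
    ultimately show ?thesis unfolding sq True triangle_0 complex.sel E level_def
      by (cases "cs t > 0"; force)
  next
    case False
    have "(side i * (1 - cs t - sn t))\<^sup>2 = (1 - cs t - sn t)\<^sup>2" by (simp add: side_def power2_commute)
    then have "(side i * (1 - cs t - sn t))\<^sup>2 + (cs t - sn t - 1)\<^sup>2 = 2 * ((sn t)\<^sup>2 + (cs t)\<^sup>2) + 2 - 4 * cs t"
      by (simp only: power2_eq_square algebra_simps)
    then show ?thesis unfolding sq triangle_circle[OF False] complex.sel sn_cs
      using False by (auto simp: level_def)
  qed
  then show "dist \<i> (curve (triangle c) i t) < 5 / 4 \<longleftrightarrow> level i < cs t"
    "dist \<i> (curve (triangle c) i t) = 5 / 4 \<longleftrightarrow> level i = cs t" by blast+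
qed

lemma triangle_arcs_in:
  assumes c: "c = 0 \<or> c = 1 / 2"
  shows "arcs_in (triangle c) (cball \<i> (5 / 4)) [(0, - half_angle 0, half_angle 0),
     (1, - half_angle (39 / 64), half_angle (39 / 64)), (2, - half_angle (39 / 64), half_angle (39 / 64))]"
proof -
  have "[0..<3] = [0, 1, 2 :: nat]" by (simp add: numeral_3_eq_3 numeral_2_eq_2)
  moreover have "arcs_in (triangle c) (cball \<i> (5 / 4)) (map (\<lambda>i. (i, - half_angle (level i), half_angle (level i))) [0..<3])"
  proof (rule round_arcs_in)
    show "curve (triangle c) i (t + 1) = curve (triangle c) i t" for i t by (simp add: triangle_def)
    show "dist \<i> (curve (triangle c) i t) < 5 / 4 \<longleftrightarrow> level i < cos (2 * pi * t)"
      "dist \<i> (curve (triangle c) i t) = 5 / 4 \<longleftrightarrow> level i = cos (2 * pi * t)" for i t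
      by (rule triangle_dist[OF c])+
  qed (simp_all add: level_def)
  ultimately show ?thesis by (simp add: level_def)
qed

lemma triangle_changing_disk: "changing_disk (cball \<i> (5 / 4)) (triangle 0)"
proof (rule round_changing_disk)
  fix p assume p: "param (triangle 0) p" "dist \<i> (pt (triangle 0) p) = 5 / 4"
  obtain i t where it: "p = (i, t)" by (cases p)
  have k: "level i = cs t" using p(2) triangle_dist(2)[of 0 i t] by (simp add: it pt_def)
  have "(level i)\<^sup>2 \<noteq> 1" by (simp add: level_def power_divide)
  then have "(cs t)\<^sup>2 \<noteq> 1" unfolding k .
  then have s: "sn t \<noteq> 0" using sn_sq[of t] by auto
  have "(pt (triangle 0) p - \<i>) \<bullet> tangent (triangle 0) p = (if i = 0 then 3 / 2 * pi * sn t else 4 * pi * sn t)"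
  proof (cases "i = 0")
    case True
    have "cs t = 0" using k True by (simp add: level_def)
    then show ?thesis
      using True by (simp add: it pt_def triangle_0 triangle_tangent_0 inner_complex_def rad_def)
  next
    case False
    have "Complex (side i * x) y \<bullet> Complex (side i * x') y' = x * x' + y * y'" for x y x' y'
      by (cases "i = 1") (simp_all add: side_def inner_complex_def)
    moreover have "pt (triangle 0) p - \<i> = Complex (side i * (1 - cs t - sn t)) (cs t - sn t - 1)"
      by (simp add: it pt_def triangle_circle[OF False] complex_eq_iff)
    ultimately have "(pt (triangle 0) p - \<i>) \<bullet> tangent (triangle 0) p =
       (1 - cs t - sn t) * (2 * pi * (sn t - cs t)) + (cs t - sn t - 1) * (2 * pi * (- sn t - cs t))"
      unfolding it triangle_tangent_circle[OF False] by metis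
    also have "\<dots> = 4 * pi * sn t" by (simp add: algebra_simps)
    finally show ?thesis using False by simp
  qed
  then show "(pt (triangle 0) p - \<i>) \<bullet> tangent (triangle 0) p \<noteq> 0" using s by simp
qed simp

lemma triangle_unchanged: "unchanged_outside (cball \<i> (5 / 4)) (triangle 0) (triangle (1 / 2))"
  unfolding unchanged_outside_def
proof (intro conjI allI impI)
  fix p
  have in1: "pt (triangle c) p \<in> interior (cball \<i> (5 / 4)) \<longleftrightarrow> level (fst p) < cs (snd p)" if "c = 0 \<or> c = 1 / 2" for c
    using triangle_dist(1)[OF that, of "fst p" "snd p"] by (simp add: pt_def)
  show "pt (triangle 0) p \<in> interior (cball \<i> (5 / 4)) \<longleftrightarrow> pt (triangle (1 / 2)) p \<in> interior (cball \<i> (5 / 4))"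
    using in1[of 0] in1[of "1 / 2"] by simp
  assume "pt (triangle 0) p \<notin> interior (cball \<i> (5 / 4))"
  then have "fst p = 0 \<Longrightarrow> cs (snd p) \<le> 0" using in1[of 0] by (simp add: level_def)
  then show "pt (triangle (1 / 2)) p = pt (triangle 0) p" by (simp add: pt_def triangle_def rad_def)
qed simp_all

lemma sn_pos_iff: "\<bar>u\<bar> < 1 / 2 \<Longrightarrow> sn u > 0 \<longleftrightarrow> u > 0"
proof -
  have pos: "0 < v \<Longrightarrow> v < 1 / 2 \<Longrightarrow> sn v > 0" for v
    by (intro sin_gt_zero) (auto simp: field_simps)
  assume "\<bar>u\<bar> < 1 / 2"
  then show ?thesis using pos[of u] pos[of "- u"] by (cases u "0 :: real" rule: linorder_cases) auto
qed

text \<open>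
  Near \<open>\<i>\<close> the circles have the slopes \<open>\<plusminus>1\<close>, so on each of them the crossing with component 0
  comes before or after \<open>\<i>\<close> according to the side of the imaginary axis.
\<close>

lemma circle_parameter:
  assumes c: "c = 0 \<or> c = 1 / 2" and g: "gap c 1 t = 0" and t: "\<bar>t\<bar> < 1 / 4" "t \<noteq> 0"
  obtains u where "\<bar>u\<bar> < half_angle (39 / 64)" "curve (triangle c) 0 t = curve (triangle c) 1 u"
    "curve (triangle c) 0 (- t) = curve (triangle c) 2 u" "u \<noteq> 0" "0 < u \<longleftrightarrow> t < 0"
proof -
  let ?R = "rad c (cs t)"
  define K where "K = (1 - ?R * sn t + ?R * cs t) / 2"
  define S where "S = (1 - ?R * sn t - ?R * cs t) / 2"
  have "K\<^sup>2 + S\<^sup>2 = ((1 - ?R * sn t)\<^sup>2 + (?R * cs t)\<^sup>2) / 2"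
    by (simp add: K_def S_def power2_eq_square field_simps)
  also have "\<dots> = (1 - 2 * ?R * sn t + ((?R * sn t)\<^sup>2 + (?R * cs t)\<^sup>2)) / 2"
    by (simp add: power2_eq_square algebra_simps)
  also have "\<dots> = 1" unfolding polar_norm using g by (simp add: gap_def)
  finally obtain \<theta> where \<theta>: "K = cos \<theta>" "S = sin \<theta>" using sincos_total_2pi by metis
  define u where "u = \<theta> / (2 * pi) + of_int (- round (\<theta> / (2 * pi)))"
  have "cs u = cs (\<theta> / (2 * pi))" "sn u = sn (\<theta> / (2 * pi))" unfolding u_def by (rule cos_shift_int)+
  then have u: "cs u = K" "sn u = S" using \<theta> by simp_all
  have half: "\<bar>u\<bar> \<le> 1 / 2" unfolding u_def using of_int_round_abs_le[of "\<theta> / (2 * pi)"] by (simp add: abs_minus_commute)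
  have K: "1 - cs u - sn u = ?R * sn t" "cs u - sn u = ?R * cs t"
    unfolding u by (simp_all add: K_def S_def field_simps)
  have e1: "curve (triangle c) 0 t = curve (triangle c) 1 u"
    using K by (simp add: triangle_0 triangle_circle side_def)
  have e2: "curve (triangle c) 0 (- t) = curve (triangle c) 2 u"
    using K by (simp add: triangle_0 triangle_circle side_def)
  have "cs t > 0" by (rule cs_pos[OF t(1)])
  then have "dist \<i> (curve (triangle c) 1 u) < 5 / 4"
    using triangle_dist(1)[OF c, of 0 t] e1 by (simp add: level_def)
  then have k: "39 / 64 < cs u" using triangle_dist(1)[OF c, of 1 u] by (simp add: level_def)
  then have ua: "\<bar>u\<bar> < half_angle (39 / 64)" using cos_half_angle_iff(2)[of "39 / 64" u] half by simp
  have u2: "\<bar>u\<bar> < 1 / 2" using ua half_angle_bounds[of "39 / 64"] by simp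
  have R: "?R > 0" using rad_ge[of c "cs t"] c by auto
  have sn_t: "sn t > 0 \<longleftrightarrow> t > 0" "sn (- t) > 0 \<longleftrightarrow> - t > 0" using sn_pos_iff[of t] sn_pos_iff[of "- t"] t by simp_all
  have prod: "(cs u + sn u)\<^sup>2 = 1 + 2 * (cs u * sn u)"
  proof -
    have "(cs u + sn u)\<^sup>2 = ((sn u)\<^sup>2 + (cs u)\<^sup>2) + 2 * (cs u * sn u)"
      by (simp only: power2_eq_square algebra_simps)
    then show ?thesis unfolding sn_cs .
  qed
  have pos: "t < 0" if "sn u > 0"
  proof -
    have "0 < cs u * sn u" using that k by simp
    then have "1\<^sup>2 < (cs u + sn u)\<^sup>2" using prod by simp
    then have "1 < cs u + sn u" using that k by (meson add_pos_pos less_eq_real_def less_trans power2_less_imp_less zero_less_divide_iff zero_less_numeral)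
    then have "?R * sn t < 0" using K(1) by linarith
    then have "sn t < 0" using R by (simp add: mult_less_0_iff)
    then show ?thesis using sn_t(2) by simp
  qed
  have neg: "t > 0" if "sn u < 0"
  proof -
    have "cs u * sn u < 0" using that k by (simp add: mult_pos_neg)
    then have "(cs u + sn u)\<^sup>2 < 1\<^sup>2" using prod by simp
    then have "cs u + sn u < 1" by (rule power2_less_imp_less) simp
    then have "?R * sn t > 0" using K(1) by linarith
    then have "sn t > 0" using R by (simp add: zero_less_mult_iff)
    then show ?thesis using sn_t(1) by simp
  qed
  have nz: "sn u \<noteq> 0"
  proof
    assume z: "sn u = 0"
    then have "(cs u)\<^sup>2 = 1" using sn_sq[of u] by simp
    then have "cs u = 1" using k by (simp add: power2_eq_1_iff)
    then have "?R * sn t = 0" using K(1) z by simp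
    then have "sn t = 0" using R by simp
    then show False using sn_t t by (metis linorder_neqE_linordered_idom neg_0_less_iff_less sin_minus mult_minus_right neg_equal_0_iff_equal less_irrefl)
  qed
  have "0 < u \<longleftrightarrow> t < 0" using pos neg nz sn_pos_iff[OF u2] by (metis less_asym linorder_neqE_linordered_idom)
  moreover have "u \<noteq> 0" using nz by auto
  ultimately show ?thesis using that[OF ua e1 e2] by blast
qed

lemma triangle_config:
  assumes c: "c = 0 \<or> c = 1 / 2" and g: "gap c 1 t = 0" and t: "\<bar>t\<bar> < 1 / 4" "t \<noteq> 0"
  obtains u where "triangle_arcs Neg Pos Neg (triangle c) (cball \<i> (5 / 4)) (0, - half_angle 0, half_angle 0)
     (1, - half_angle (39 / 64), half_angle (39 / 64)) (2, - half_angle (39 / 64), half_angle (39 / 64)) t (- t) u 0 u 0"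
    "u \<noteq> 0" "0 < u \<longleftrightarrow> t < 0"
proof -
  let ?D = "triangle c" and ?C = "cball \<i> (5 / 4)"
  obtain u where u: "\<bar>u\<bar> < half_angle (39 / 64)" "curve ?D 0 t = curve ?D 1 u"
    "curve ?D 0 (- t) = curve ?D 2 u" "u \<noteq> 0" "0 < u \<longleftrightarrow> t < 0"
    using circle_parameter[OF c g t] by metis
  have h0: "half_angle 0 = 1 / 4" by (simp add: half_angle_def)
  have kt: "cs t > 0" by (rule cs_pos[OF t(1)])
  have g': "gap c (- 1) (- t) = 0" using g by (simp add: gap_def)
  have I: "curve ?D 1 0 = \<i>" "curve ?D 2 0 = \<i>" by (simp_all add: triangle_circle complex_eq_iff)
  have cr: "crossing ?D (0, t) (1, u)" "crossing ?D (1, 0) (2, 0)" "crossing ?D (0, - t) (2, u)"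
    using u I by (simp_all add: crossing_def param_def pt_def)
  have dp: "double_points ?D \<inter> ?C = {curve ?D 0 t, curve ?D 1 0, curve ?D 0 (- t)}"
  proof
    show "double_points ?D \<inter> ?C \<subseteq> {curve ?D 0 t, curve ?D 1 0, curve ?D 0 (- t)}"
    proof
      fix z assume "z \<in> double_points ?D \<inter> ?C"
      then have z: "z \<in> double_points ?D" "z \<in> ?C" by blast+
      from c z(1) show "z \<in> {curve ?D 0 t, curve ?D 1 0, curve ?D 0 (- t)}"
      proof (cases rule: triangle_double_points)
        case (1 e s)
        have ee: "e * e = 1" using 1(1) by auto
        have "dist \<i> (curve ?D 0 s) \<le> 5 / 4" using z(2) 1(3) by simp
        then have "0 \<le> cs s" using triangle_dist[OF c, of 0 s] by (auto simp: level_def le_less)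
        then have ks: "0 < cs s" using gap_cs_nonzero[OF ee 1(2)] by linarith
        show ?thesis
        proof (cases "e = 1")
          case True
          have "sn s = sn t \<and> cs s = cs t" using gap_unique[OF c ee 1(2)] g kt ks True by blast
          then show ?thesis unfolding 1(3) triangle_0 by simp
        next
          case False
          then have e: "e = - 1" using 1(1) by blast
          have "cs (- t) > 0" using kt by simp
          then have "sn s = sn (- t) \<and> cs s = cs (- t)" using gap_unique[OF c ee 1(2)] g' ks e by blast
          then show ?thesis unfolding 1(3) triangle_0 by (simp del: mult_minus_right)
        qed
      next
        case 2
        then show ?thesis using I by simp
      next
        case 3
        have "dist \<i> (- \<i>) = cmod (2 * \<i>)" by (simp add: dist_norm)
        then have "dist \<i> (- \<i>) = 2" by (simp add: norm_mult)
        then show ?thesis using z(2) 3 by simp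
      qed
    qed
    have "pt ?D (0, t) \<in> double_points ?D" "pt ?D (1, 0) \<in> double_points ?D" "pt ?D (0, - t) \<in> double_points ?D"
      using cr unfolding double_points_def by blast+
    moreover have "dist \<i> (curve ?D 0 t) < 5 / 4" "dist \<i> (curve ?D 0 (- t)) < 5 / 4"
      using triangle_dist(1)[OF c, of 0 t] triangle_dist(1)[OF c, of 0 "- t"] kt by (simp_all add: level_def)
    ultimately show "{curve ?D 0 t, curve ?D 1 0, curve ?D 0 (- t)} \<subseteq> double_points ?D \<inter> ?C"
      using I by (simp add: pt_def)
  qed
  have s1: "crossing_sign ?D (0, t) (1, u) = Neg"
  proof -
    have e: "side 1 * side 1 = 1" "side 1 = 1" by (simp_all add: side_def)
    have "det2 (tangent ?D (0, t)) (tangent ?D (1, u)) < 0"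
      unfolding triangle_det[OF one_neq_zero u(2)]
      using gap_transversal(1)[OF c e(1), of t] g kt e(2) by simp
    then show ?thesis by (simp add: crossing_sign_def)
  qed
  have s3: "crossing_sign ?D (0, - t) (2, u) = Neg"
  proof -
    have e: "side 2 * side 2 = 1" "side 2 = - 1" "(2::nat) \<noteq> 0" by (simp_all add: side_def)
    have g2: "gap c (side 2) (- t) = 0" using g' e(2) by simp
    have k2: "cs (- t) > 0" using kt by simp
    have "0 < 4 * pi\<^sup>2 * (rad c (cs (- t)) * cs (- t) + c * bump' (cs (- t)) * (side 2 * sn (- t)) * (rad c (cs (- t)) - side 2 * sn (- t)))"
      using gap_transversal(1)[OF c e(1) g2 k2] by (intro mult_pos_pos) auto
    then have "det2 (tangent ?D (0, - t)) (tangent ?D (2, u)) < 0"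
      unfolding triangle_det[OF e(3) u(3)] by (simp only: mult_minus_left neg_less_0_iff_less)
    then show ?thesis by (simp add: crossing_sign_def)
  qed
  have s2: "crossing_sign ?D (1, 0) (2, 0) = Pos"
  proof -
    have "det2 (tangent ?D (1, 0)) (tangent ?D (2, 0)) > 0" unfolding circles_det by simp
    then show ?thesis by (simp add: crossing_sign_def Let_def del: One_nat_def)
  qed
  have arcs: "arcs_in ?D ?C [(0, - half_angle 0, half_angle 0),
     (1, - half_angle (39 / 64), half_angle (39 / 64)), (2, - half_angle (39 / 64), half_angle (39 / 64))]"
    by (rule triangle_arcs_in[OF c])
  have rng: "t \<in> {- half_angle 0<..<half_angle 0}" "- t \<in> {- half_angle 0<..<half_angle 0}"
    "u \<in> {- half_angle (39 / 64)<..<half_angle (39 / 64)}" "0 \<in> {- half_angle (39 / 64)<..<half_angle (39 / 64)}"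
    using t(1) u(1) h0 half_angle_bounds[of "39 / 64"] by (auto simp: abs_less_iff)
  have ov: "over ?D (0, t) (1, u)" "over ?D (1, 0) (2, 0)" "over ?D (0, - t) (2, u)" by simp_all
  have "triangle_arcs Neg Pos Neg ?D ?C (0, - half_angle 0, half_angle 0)
     (1, - half_angle (39 / 64), half_angle (39 / 64)) (2, - half_angle (39 / 64), half_angle (39 / 64)) t (- t) u 0 u 0"
    unfolding triangle_arcs.simps
    using arcs cr dp s1 s2 s3 rng ov by blast
  then show ?thesis using that u(4,5) by blast
qed

lemma gap_continuous: "continuous_on A (gap c e)"
proof -
  have "isCont (\<lambda>t. rad c (cs t)) t" for t by (rule DERIV_isCont[OF rad_derivative])
  then have "continuous_on A (\<lambda>t. rad c (cs t))" by (simp add: continuous_at_imp_continuous_on)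
  then show ?thesis unfolding gap_def by (intro continuous_intros)
qed

lemma triangle_example:
  obtains C D D' T M B tm tb mt mb bt bm tm' tb' mt' mb' bt' bm'
  where "reidemeister_move (Omega3 Neg Pos Neg) C D D'"
    "triangle_arcs Neg Pos Neg D C (0, T) (1, M) (2, B) tm tb mt mb bt bm"
    "triangle_arcs Neg Pos Neg D' C (0, T) (1, M) (2, B) tm' tb' mt' mb' bt' bm'"
    "tm < tb \<longleftrightarrow> tb' < tm'"
    "\<And>p. p \<in> {(0, 1 / 2), (1, 1 / 2), (2, 1 / 2)} \<Longrightarrow> param D p \<and> pt D p \<notin> C \<and> (\<forall>q. \<not> crossing D' p q)"
proof -
  let ?C = "cball \<i> (5 / 4)" and ?D = "triangle 0" and ?D' = "triangle (1 / 2)"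
  let ?T = "(- half_angle 0, half_angle 0)" and ?M = "(- half_angle (39 / 64), half_angle (39 / 64))"
  have g: "gap 0 1 (- (1 / 4)) = 17 / 16" "gap 0 1 0 = - 7 / 16" "gap (1 / 2) 1 0 = 9 / 16" "gap (1 / 2) 1 (1 / 4) = - 31 / 16"
    by (simp_all add: gap_def rad_def power2_eq_square)
  have "\<exists>t. - (1 / 4) \<le> t \<and> t \<le> 0 \<and> gap 0 1 t = 0"
    by (rule IVT2') (simp_all add: g gap_continuous)
  then obtain t where t0: "- (1 / 4) \<le> t" "t \<le> 0" "gap 0 1 t = 0" by blast
  have g0: "gap 0 1 (- (1 / 4)) \<noteq> 0" "gap 0 1 0 \<noteq> 0" "gap (1 / 2) 1 0 \<noteq> 0" "gap (1 / 2) 1 (1 / 4) \<noteq> 0"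
    unfolding g by simp_all
  have "t \<noteq> - (1 / 4)" "t \<noteq> 0" using t0(3) g0 by metis+
  then have t: "\<bar>t\<bar> < 1 / 4" "t \<noteq> 0" "t < 0" using t0 by auto
  have "\<exists>t. 0 \<le> t \<and> t \<le> 1 / 4 \<and> gap (1 / 2) 1 t = 0"
    by (rule IVT2') (simp_all add: g gap_continuous)
  then obtain t' where t0': "0 \<le> t'" "t' \<le> 1 / 4" "gap (1 / 2) 1 t' = 0" by blast
  have "t' \<noteq> 1 / 4" "t' \<noteq> 0" using t0'(3) g0 by metis+
  then have t': "\<bar>t'\<bar> < 1 / 4" "t' \<noteq> 0" "t' > 0" using t0' by auto
  obtain u where u: "triangle_arcs Neg Pos Neg ?D ?C (0, ?T) (1, ?M) (2, ?M) t (- t) u 0 u 0" "u \<noteq> 0" "0 < u \<longleftrightarrow> t < 0"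
    using triangle_config[of 0 t] t0(3) t by auto
  obtain u' where u': "triangle_arcs Neg Pos Neg ?D' ?C (0, ?T) (1, ?M) (2, ?M) t' (- t') u' 0 u' 0" "u' \<noteq> 0" "0 < u' \<longleftrightarrow> t' < 0"
    using triangle_config[of "1 / 2" t'] t0'(3) t' by auto
  have order: "t < - t \<longleftrightarrow> - t' < t'" "u < 0 \<longleftrightarrow> 0 < u'" using t t' u(2,3) u'(2,3) by auto
  have L: "link_diagram ?D" "link_diagram ?D'" by (simp_all add: triangle_link_diagram)
  have R: "reidemeister_move (Omega3 Neg Pos Neg) ?C ?D ?D'"
    unfolding reidemeister_move_def local_move.simps
    using L triangle_changing_disk triangle_unchanged u(1) u'(1) order by blast
  show ?thesis
  proof (rule that[OF R u(1) u'(1) order(1)])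
    fix p :: "nat \<times> real" assume p: "p \<in> {(0, 1 / 2), (1, 1 / 2), (2, 1 / 2)}"
    then have f: "fst p < 3" "snd p = 1 / 2" "p = (fst p, 1 / 2)" by auto
    have out: "pt ?D p \<notin> ?C"
      using triangle_dist[of 0 "fst p" "1 / 2"] by (auto simp: pt_def f(2) level_def split: if_splits)
    have n0: "gap (1 / 2) e (1 / 2) \<noteq> 0" for e by (simp add: gap_def rad_def power2_eq_square)
    have n1: "curve ?D' 0 s \<noteq> curve ?D' i (1 / 2)" if i: "i \<noteq> 0" for s i
    proof
      assume eq: "curve ?D' 0 s = curve ?D' i (1 / 2)"
      let ?R = "rad (1 / 2) (cs s)"
      have "?R * sn s = side i * 2" "?R * cs s = - 1"
        using eq unfolding triangle_0 triangle_circle[OF i] by simp_all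
      then have "?R\<^sup>2 = (side i * 2)\<^sup>2 + (- 1)\<^sup>2" using polar_norm[of ?R s] by simp
      then have "?R\<^sup>2 = 5" by (simp add: side_def)
      moreover have "?R \<le> 5 / 4" "3 / 4 \<le> ?R"
        using rad_mono[of "1 / 2" "cs s" 1] rad_ge[of "1 / 2" "cs s"] by (simp_all add: rad_def)
      then have "?R\<^sup>2 \<le> (5 / 4)\<^sup>2" by (intro power_mono) auto
      ultimately show False by (simp add: power2_eq_square)
    qed
    have "\<not> crossing ?D' p q" for q
    proof
      assume cr: "crossing ?D' p q"
      have h: "1 / 2 = 0 \<or> 1 / 2 = (1 / 2 :: real)" by simp
      from h cr show False
      proof (cases rule: triangle_crossing_cases)
        case (1 i s u)
        have "p = (0, s) \<or> p = (i, u)" using 1(2) by (metis doubleton_eq_iff)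
        then consider "s = 1 / 2" | "u = 1 / 2" using f(3) by (metis prod.inject)
        then show False
        proof cases
          case 1
          then show False using triangle_cross_0[OF \<open>i \<noteq> 0\<close> \<open>curve ?D' 0 s = curve ?D' i u\<close>] n0 by metis
        next
          case 2
          then show False using n1[OF \<open>i \<noteq> 0\<close>] \<open>curve ?D' 0 s = curve ?D' i u\<close> by metis
        qed
      next
        case (2 s u)
        note E = triangle_cross_circles[OF 2(2)]
        have "p = (1, s) \<or> p = (2, u)" using 2(1) by (metis doubleton_eq_iff)
        then consider "s = 1 / 2" | "u = 1 / 2" using f(3) by (metis prod.inject)
        then show False using E by cases auto
      qed
    qed
    then show "param ?D p \<and> pt ?D p \<notin> ?C \<and> (\<forall>q. \<not> crossing ?D' p q)"
      using f(1) out by (simp add: param_def)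
  qed
qed


section \<open>The moves that every generating set contains\<close>

text \<open>
  The sign of (first tangent, second tangent) is opposite to the rotation of the loop, and it agrees
  with the sign of the crossing exactly if the first passage is the upper one.
\<close>

lemma omega1_kind:
  assumes R: "reidemeister_move (Omega1 e r) C D D'" and out: "pt D (i, t0) \<notin> C" "param D (i, t0)"
    and b: "b \<noteq> ((e = Pos) = (r = Clockwise))"
  shows "card (self_passes D' (i, t0) b) = card (self_passes D (i, t0) b)"
proof -
  note F = reidemeister_moveD[OF R]
  have disk: "changing_disk C D" using R by (simp add: reidemeister_move_def)
  obtain A where A: "plain_arcs D C [A]" "kinked_arc e r D' C A"
    using R unfolding reidemeister_move_def local_move.simps by blast
  obtain k a b' where Ak: "A = (k, a, b')" by (metis prod_cases3)
  obtain s u where K: "a < s" "s < u" "u < b'" "crossing D' (k, s) (k, u)" "arcs_in D' C [(k, a, b')]"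
    "crossing_sign D' (k, s) (k, u) = e" "double_points D' \<inter> C = {curve D' k s}"
    "loop_rotates r (subpath s u (curve D' k))"
    "disk_passes D' C {if over D' (k, s) (k, u) then ((k, s), (k, u)) else ((k, u), (k, s))}"
    by (rule kinked_arc_passes[OF F(2) A(2)[unfolded Ak]])
  let ?d = "det2 (tangent D' (k, s)) (tangent D' (k, u))"
  have pos: "?d > 0 \<longleftrightarrow> r = Clockwise"
    by (rule kink_orientation[OF F(2) disk K(5) K(1-4) K(7,8)])
  have "?d \<noteq> 0" using F(2) K(4) unfolding link_diagram_def by blast
  moreover have "det2 (tangent D' (k, u)) (tangent D' (k, s)) = - ?d" by (simp add: det2_def)
  ultimately have "over D' (k, s) (k, u) \<longleftrightarrow> ((e = Pos) = (r = Clockwise))"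
    unfolding K(6)[symmetric] pos[symmetric] crossing_sign_def Let_def by auto
  then have "b \<noteq> over D' (k, s) (k, u)" using b by simp
  then show ?thesis
    using omega1_self_passes[OF F(1,2,3,5) A(1)[unfolded Ak] K(5) _ K(2) _ K(9) out, of b] K(1,3) by simp
qed

lemma shift_base:
  assumes D: "link_diagram D" and p: "same_param p p'" "param D p"
  shows "card (self_passes D p' b) = card (self_passes D p b)"
    "j < ncomp D \<Longrightarrow> k < ncomp D \<Longrightarrow> card (inversions (contacts D p' j) (contacts D p' k)) =
       card (inversions (contacts D p j) (contacts D p k))"
proof -
  obtain i t where it: "p = (i, t)" by (cases p)
  have i: "i < ncomp D" using p(2) it by (simp add: param_def)
  have "snd p' - snd p \<in> \<int>" using same_param_sym[OF p(1)] by (simp add: same_param_def)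
  then obtain m where "snd p' - snd p = of_int m" by (rule Ints_cases)
  then have p': "p' = reparam id (\<lambda>i t. t + of_int m) (i, t)"
    using p(1) by (simp add: it reparam_def same_param_def prod_eq_iff)
  note G = shift_gauss[OF D, of m]
  show "card (self_passes D p' b) = card (self_passes D p b)"
    unfolding p' it by (rule gauss_self_passes[OF G i])
  have "strict_mono (\<lambda>t. t + of_int m :: real)" by (simp add: strict_mono_def)
  from card_inversions_image[OF this]
  show "card (inversions (contacts D p' j) (contacts D p' k)) = card (inversions (contacts D p j) (contacts D p k))"
    if "j < ncomp D" "k < ncomp D"
    using gauss_contacts[OF G D D i that(1), of t] gauss_contacts[OF G D D i that(2), of t]
    unfolding p' it by (simp del: contacts.simps)
qed

lemma needs_omega1:
  assumes S: "generating S"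
  shows "\<exists>e r. Omega1 e r \<in> S \<and> ((e = Pos) = (r = Clockwise)) = b"
proof (rule ccontr)
  assume none: "\<not> ?thesis"
  define \<Phi> where "\<Phi> D ps \<longleftrightarrow> ps \<noteq> [] \<and> even (card (self_passes D (hd ps) b))"
    for D and ps :: "(nat \<times> real) list"
  obtain e r D D' C s u where ex: "reidemeister_move (Omega1 e r) C D D'"
    "plain_arcs D C [(0, - half_angle 0, half_angle 0)]" "arcs_in D' C [(0, - half_angle 0, half_angle 0)]"
    "- half_angle 0 \<le> s" "s < u" "u \<le> half_angle 0"
    "disk_passes D' C {if b then ((0, s), (0, u)) else ((0, u), (0, s))}"
    "pt D (0, 1 / 2) \<notin> C" "param D (0, 1 / 2)" "\<And>q. \<not> crossing D' (0, 1 / 2) q"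
    by (rule kink_example[of b]) blast
  note F = reidemeister_moveD[OF ex(1)]
  show False
  proof (rule not_generating[OF S ex(1), of \<Phi> "(0, 1 / 2)" "[]"])
    fix E E' \<pi> h and ps :: "(nat \<times> real) list"
    assume G: "gauss_equivalent E E' \<pi> h" and ps: "\<And>p. p \<in> set ps \<Longrightarrow> param E p"
    show "\<Phi> E (map (reparam \<pi> h) ps) = \<Phi> E' ps"
    proof (cases ps)
      case (Cons p ps')
      obtain i t where "p = (i, t)" by (cases p)
      moreover from this have "i < ncomp E" using ps[of p] Cons by (simp add: param_def)
      ultimately show ?thesis using gauss_self_passes[OF G] Cons by (simp add: \<Phi>_def)
    qed (simp add: \<Phi>_def)
  next
    fix \<omega> C' E E' and ps :: "(nat \<times> real) list"
    assume \<omega>: "\<omega> \<in> S" and R: "reidemeister_move \<omega> C' E E'"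
      and ps: "\<And>p. p \<in> set ps \<Longrightarrow> param E p \<and> pt E p \<notin> C'"
    show "\<Phi> E' ps = \<Phi> E ps"
    proof (cases ps)
      case (Cons p ps')
      obtain i t where it: "p = (i, t)" by (cases p)
      have p: "pt E (i, t) \<notin> C'" "param E (i, t)" using ps[of p] Cons it by simp_all
      have "even (card (self_passes E' (i, t) b)) = even (card (self_passes E (i, t) b))"
      proof (cases \<omega>)
        case (Omega1 e' r')
        then have "b \<noteq> ((e' = Pos) = (r' = Clockwise))" using none \<omega> by blast
        then have "card (self_passes E' (i, t) b) = card (self_passes E (i, t) b)"
          by (rule omega1_kind[OF R[unfolded Omega1] p])
        then show ?thesis by (rule arg_cong)
      next
        case (Omega2 k)
        show ?thesis by (rule omega2_self_passes[OF R[unfolded Omega2] p])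
      next
        case (Omega3 e1 e2 e3)
        show ?thesis by (simp only: omega3_self_passes[OF R[unfolded Omega3] p])
      qed
      then show ?thesis using Cons it by (simp add: \<Phi>_def)
    qed (simp add: \<Phi>_def)
  next
    fix p p' :: "nat \<times> real" and ps ps' :: "(nat \<times> real) list"
    assume "same_param p p'" "param D' p"
    then show "\<Phi> D' (p # ps) = \<Phi> D' (p' # ps')" by (simp add: \<Phi>_def shift_base(1)[OF F(2)] del: self_passes.simps)
  next
    show "\<Phi> D' [(0, 1 / 2)] \<noteq> \<Phi> D [(0, 1 / 2)]"
      using omega1_self_passes[OF F(1,2,3,5) ex(2-7) ex(8,9), of b] by (simp add: \<Phi>_def del: self_passes.simps)
  qed (use ex in auto)
qed

lemma needs_omega2:
  assumes S: "generating S"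
  shows "\<exists>h. Omega2 h \<in> S"
proof (rule ccontr)
  assume none: "\<not> ?thesis"
  define \<Phi> where "\<Phi> D ps \<longleftrightarrow> (\<exists>p q. ps = [p, q] \<and> fst p \<noteq> fst q \<and> meets D (fst p) (fst q))"
    for D and ps :: "(nat \<times> real) list"
  obtain h C D D' where ex: "reidemeister_move (Omega2 h) C D D'" "\<not> meets D 0 1" "meets D' 0 1"
    "\<And>p. p \<in> {(0, 1 / 2), (1, 1 / 2)} \<Longrightarrow> param D p \<and> pt D p \<notin> C \<and> (\<forall>q. \<not> crossing D' p q)"
    by (rule overlap_example) blast
  show False
  proof (rule not_generating[OF S ex(1), of \<Phi> "(0, 1 / 2)" "[(1, 1 / 2)]"])
    fix E E' \<pi> h and ps :: "(nat \<times> real) list"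
    assume G: "gauss_equivalent E E' \<pi> h" and L: "link_diagram E" "link_diagram E'"
      and ps: "\<And>p. p \<in> set ps \<Longrightarrow> param E p"
    show "\<Phi> E (map (reparam \<pi> h) ps) = \<Phi> E' ps"
    proof (cases "\<exists>p q. ps = [p, q]")
      case True
      then obtain p q where pq: "ps = [p, q]" by blast
      then have n: "fst p < ncomp E" "fst q < ncomp E" using ps by (simp_all add: param_def)
      have "inj_on \<pi> {..<ncomp E}" using G by (auto simp: gauss_equivalent_def bij_betw_def)
      then have "\<pi> (fst p) = \<pi> (fst q) \<longleftrightarrow> fst p = fst q" using n by (auto simp: inj_on_def)
      then show ?thesis using gauss_meets[OF G L n] pq by (simp add: \<Phi>_def reparam_def)
    qed (auto simp: \<Phi>_def)
  next
    fix \<omega> C' E E' and ps :: "(nat \<times> real) list"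
    assume \<omega>: "\<omega> \<in> S" and R: "reidemeister_move \<omega> C' E E'"
    have "meets E' i j = meets E i j" if "i \<noteq> j" for i j
    proof (cases \<omega>)
      case (Omega1 e r)
      then show ?thesis using omega1_meets[OF R[unfolded Omega1] that] by blast
    next
      case (Omega2 h)
      then show ?thesis using none \<omega> by blast
    next
      case (Omega3 e1 e2 e3)
      then show ?thesis using omega3_meets[OF R[unfolded Omega3]] by blast
    qed
    then show "\<Phi> E' ps = \<Phi> E ps" unfolding \<Phi>_def by blast
  next
    fix p p' :: "nat \<times> real" and ps ps' :: "(nat \<times> real) list"
    assume "same_param p p'" "map fst ps = map fst ps'"
    then show "\<Phi> D' (p # ps) = \<Phi> D' (p' # ps')"
      by (cases ps; cases ps') (auto simp: \<Phi>_def same_param_def)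
  next
    show "\<Phi> D' [(0, 1 / 2), (1, 1 / 2)] \<noteq> \<Phi> D [(0, 1 / 2), (1, 1 / 2)]" using ex(2,3) by (simp add: \<Phi>_def)
  next
    fix p :: "nat \<times> real" assume "p \<in> set [(0, 1 / 2), (1, 1 / 2)]"
    then show "param D p \<and> pt D p \<notin> C \<and> (\<forall>q. \<not> crossing D' p q)" by (intro ex(4)) simp
  qed
qed

text \<open>
  The marks are one point on each of three components; the first one serves as the base point.
\<close>

lemma needs_omega3:
  assumes S: "generating S"
  shows "\<exists>e1 e2 e3. Omega3 e1 e2 e3 \<in> S"
proof (rule ccontr)
  assume none: "\<not> ?thesis"
  define I where "I D p q r = card (inversions (contacts D p (fst q)) (contacts D p (fst r)))"
    for D and p q r :: "nat \<times> real"
  define \<Phi> where "\<Phi> D ps \<longleftrightarrow> (\<exists>p q r. ps = [p, q, r] \<and> distinct (map fst ps) \<and> even (I D p q r))"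
    for D and ps :: "(nat \<times> real) list"
  obtain C D D' T M B tm tb mt mb bt bm tm' tb' mt' mb' bt' bm'
  where ex: "reidemeister_move (Omega3 Neg Pos Neg) C D D'"
    "triangle_arcs Neg Pos Neg D C (0, T) (1, M) (2, B) tm tb mt mb bt bm"
    "triangle_arcs Neg Pos Neg D' C (0, T) (1, M) (2, B) tm' tb' mt' mb' bt' bm'"
    "tm < tb \<longleftrightarrow> tb' < tm'"
    "\<And>p. p \<in> {(0, 1 / 2), (1, 1 / 2), (2, 1 / 2)} \<Longrightarrow> param D p \<and> pt D p \<notin> C \<and> (\<forall>q. \<not> crossing D' p q)"
    by (rule triangle_example) blast
  note F = reidemeister_moveD[OF ex(1)]
  show False
  proof (rule not_generating[OF S ex(1), of \<Phi> "(0, 1 / 2)" "[(1, 1 / 2), (2, 1 / 2)]"])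
    fix E E' \<pi> h and ps :: "(nat \<times> real) list"
    assume G: "gauss_equivalent E E' \<pi> h" and L: "link_diagram E" "link_diagram E'"
      and ps: "\<And>p. p \<in> set ps \<Longrightarrow> param E p"
    show "\<Phi> E (map (reparam \<pi> h) ps) = \<Phi> E' ps"
    proof (cases "\<exists>p q r. ps = [p, q, r]")
      case True
      then obtain p q r where pq: "ps = [p, q, r]" by blast
      then have n: "fst p < ncomp E" "fst q < ncomp E" "fst r < ncomp E" using ps by (simp_all add: param_def)
      have "inj_on \<pi> {..<ncomp E}" using G by (auto simp: gauss_equivalent_def bij_betw_def)
      then have inj: "\<pi> x = \<pi> y \<longleftrightarrow> x = y" if "x < ncomp E" "y < ncomp E" for x y
        using that by (auto simp: inj_on_def)
      have mono: "strict_mono (h (fst p))" using G n(1) by (simp add: gauss_equivalent_def)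
      have c: "contacts E (reparam \<pi> h p) (fst (reparam \<pi> h x)) = h (fst p) ` contacts E' p (fst x)"
        if "fst x < ncomp E" for x
        using gauss_contacts[OF G L n(1) that, of "snd p"] by (simp add: reparam_def)
      have "I E (reparam \<pi> h p) (reparam \<pi> h q) (reparam \<pi> h r) = I E' p q r"
        unfolding I_def c[OF n(2)] c[OF n(3)] by (rule card_inversions_image[OF mono])
      then show ?thesis using pq inj n by (simp add: \<Phi>_def reparam_def)
    qed (auto simp: \<Phi>_def)
  next
    fix \<omega> C' E E' and ps :: "(nat \<times> real) list"
    assume \<omega>: "\<omega> \<in> S" and R: "reidemeister_move \<omega> C' E E'"
      and ps: "\<And>p. p \<in> set ps \<Longrightarrow> param E p \<and> pt E p \<notin> C'"
    have "even (I E' p q r) = even (I E p q r)" if pq: "ps = [p, q, r]" "distinct (map fst ps)" for p q r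
    proof -
      obtain i t where it: "p = (i, t)" by (cases p)
      have p: "pt E (i, t) \<notin> C'" "param E (i, t)" using ps[of p] pq it by simp_all
      have d: "i \<noteq> fst q" "i \<noteq> fst r" "fst q \<noteq> fst r" using pq it by auto
      show ?thesis
      proof (cases \<omega>)
        case (Omega1 e r)
        then show ?thesis using omega1_contacts[OF R[unfolded Omega1]] d unfolding I_def it by metis
      next
        case (Omega2 h)
        then show ?thesis using omega2_inversions[OF R[unfolded Omega2] p d] unfolding I_def it by blast
      next
        case (Omega3 e1 e2 e3)
        then show ?thesis using none \<omega> by blast
      qed
    qed
    then show "\<Phi> E' ps = \<Phi> E ps" unfolding \<Phi>_def by blast
  next
    fix p p' :: "nat \<times> real" and ps ps' :: "(nat \<times> real) list"
    assume pp: "same_param p p'" "param D' p" and f: "map fst ps = map fst ps'"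
      and n: "\<And>q. q \<in> set ps \<Longrightarrow> param D' q"
    have fp: "fst p' = fst p" using pp(1) by (simp add: same_param_def)
    show "\<Phi> D' (p # ps) = \<Phi> D' (p' # ps')"
    proof (cases "\<exists>q r. ps = [q, r]")
      case True
      then obtain q r where q: "ps = [q, r]" by blast
      then obtain q' r' where q': "ps' = [q', r']" "fst q' = fst q" "fst r' = fst r"
        using f by (cases ps'; cases "tl ps'") auto
      have "I D' p' q' r' = I D' p q r"
        unfolding I_def q'(2,3) using n q by (intro shift_base(2)[OF F(2) pp]) (simp_all add: param_def)
      then show ?thesis using q q' fp by (simp add: \<Phi>_def)
    next
      case False
      have "length ps = length ps'" using f by (metis length_map)
      moreover have "length ps \<noteq> 2" using False by (auto simp: length_Suc_conv numeral_2_eq_2)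
      ultimately have "\<not> \<Phi> D' (p # ps)" "\<not> \<Phi> D' (p' # ps')" by (auto simp: \<Phi>_def)
      then show ?thesis by blast
    qed
  next
    have "even (I D' (0, 1 / 2) (1, 1 / 2) (2, 1 / 2)) \<noteq> even (I D (0, 1 / 2) (1, 1 / 2) (2, 1 / 2))"
    proof -
      obtain a b c d e f where TMB: "T = (a, b)" "M = (c, d)" "B = (e, f)" by (cases T; cases M; cases B)
      have "pt D (0, 1 / 2) \<notin> C" using ex(5) by blast
      then show ?thesis unfolding I_def fst_conv
        by (intro omega3_inversions[OF F(1,2,3,5) ex(2,3)[unfolded TMB] ex(4)]) simp_all
    qed
    then show "\<Phi> D' [(0, 1 / 2), (1, 1 / 2), (2, 1 / 2)] \<noteq> \<Phi> D [(0, 1 / 2), (1, 1 / 2), (2, 1 / 2)]"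
      by (simp add: \<Phi>_def)
  next
    fix p :: "nat \<times> real" assume "p \<in> set [(0, 1 / 2), (1, 1 / 2), (2, 1 / 2)]"
    then show "param D p \<and> pt D p \<notin> C \<and> (\<forall>q. \<not> crossing D' p q)" by (intro ex(5)) simp
  qed
qed

text \<open>Otherwise \<open>card S\<close> could be 0 by the convention for infinite sets.\<close>

lemma finite_moves: "finite (S :: move set)"
proof -
  have fin: "finite (UNIV :: sign set)" "finite (UNIV :: rotation set)" "finite (UNIV :: move2 set)"
  proof -
    have "(UNIV :: sign set) \<subseteq> {Pos, Neg}" "(UNIV :: rotation set) \<subseteq> {Clockwise, Counterclockwise}"
      "(UNIV :: move2 set) \<subseteq> {Same_Order_Pos_First, Same_Order_Neg_First, Opp_Order_Under_Pos_First, Opp_Order_Over_Pos_First}"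
      using sign.exhaust rotation.exhaust move2.exhaust by blast+
    then show "finite (UNIV :: sign set)" "finite (UNIV :: rotation set)" "finite (UNIV :: move2 set)"
      by (meson finite.emptyI finite.insertI finite_subset)+
  qed
  have "(UNIV :: move set) \<subseteq> (\<lambda>(e, r). Omega1 e r) ` (UNIV \<times> UNIV) \<union> Omega2 ` UNIV \<union>
     (\<lambda>(e1, e2, e3). Omega3 e1 e2 e3) ` (UNIV \<times> UNIV \<times> UNIV)"
  proof
    fix m :: move
    show "m \<in> (\<lambda>(e, r). Omega1 e r) ` (UNIV \<times> UNIV) \<union> Omega2 ` UNIV \<union>
     (\<lambda>(e1, e2, e3). Omega3 e1 e2 e3) ` (UNIV \<times> UNIV \<times> UNIV)"
      by (cases m) (auto simp: image_iff)
  qed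
  moreover have "finite ((\<lambda>(e, r). Omega1 e r) ` (UNIV \<times> UNIV) \<union> Omega2 ` UNIV \<union>
     (\<lambda>(e1, e2, e3). Omega3 e1 e2 e3) ` (UNIV \<times> UNIV \<times> UNIV))"
    using fin by (intro finite_UnI finite_imageI finite_cartesian_product)
  ultimately have "finite (UNIV :: move set)" by (rule finite_subset)
  then show ?thesis by (rule rev_finite_subset) simp
qed

theorem mainTheorem3:
  fixes S :: "move set"
  assumes "generating S"
  shows "card S \<ge> 4"
proof -
  obtain e r where 1: "Omega1 e r \<in> S" "(e = Pos) = (r = Clockwise)"
    using needs_omega1[OF assms, of True] by blast
  obtain e' r' where 2: "Omega1 e' r' \<in> S" "(e' = Pos) \<noteq> (r' = Clockwise)"
    using needs_omega1[OF assms, of False] by blast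
  obtain h where 3: "Omega2 h \<in> S" using needs_omega2[OF assms] by blast
  obtain e1 e2 e3 where 4: "Omega3 e1 e2 e3 \<in> S" using needs_omega3[OF assms] by blast
  have "Omega1 e r \<noteq> Omega1 e' r'" using 1(2) 2(2) by blast
  then have "card {Omega1 e r, Omega1 e' r', Omega2 h, Omega3 e1 e2 e3} = 4" by simp
  moreover have "{Omega1 e r, Omega1 e' r', Omega2 h, Omega3 e1 e2 e3} \<subseteq> S" using 1 2 3 4 by blast
  ultimately show ?thesis using card_mono[OF finite_moves] by metis
qed


end
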